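(* Let $p>2$ be a prime, let $\mathbf{F}$ be a field of characteristic $p$, and let $G\cong\mathbf{Z}/p^2$. The Noether number of the $\mathbf{F}G$-module $V_{p+1}$ is $p^2+p-3$.
   Context: $V_{p+1}$ is the indecomposable $\mathbf{F}G$-module of dimension $p+1$ on which a generator of $G$ acts by a single Jordan block with eigenvalue $1$. $\mathbf{F}[V_{p+1}]:=S(V_{p+1}^* )$, with $G$ acting by algebra automorphisms extending the action on $V_{p+1}^*$, and $\mathbf{F}[V_{p+1}]^G$ is the ring of invariants. The Noether number of a representation is the largest degree of an element in a minimal homogeneous generating set (as an $\mathbf{F}$-algebra) for the corresponding ring of invariants. *)

theory Defs
  imports
    "HOL-Library.Poly_Mapping"
    "HOL-Algebra.Generated_Groups"
    "HOL-Algebra.Elementary_Groups"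
    "HOL-Computational_Algebra.Primes"
    "Jordan_Normal_Form.Jordan_Normal_Form"
begin

section \<open>The module with a single Jordan block\<close>

text \<open>
  A representation of \<open>G\<close> on the space of column vectors of length \<open>n\<close> is a homomorphism from
  \<open>G\<close> to the group of invertible \<open>n \<times> n\<close> matrices; \<open>g\<close> acts by \<open>v \<mapsto> \<rho> g *\<^sub>v v\<close>.
\<close>

definition representation ::
  "('g, 'm) monoid_scheme \<Rightarrow> nat \<Rightarrow> ('g \<Rightarrow> 'f::field mat) \<Rightarrow> bool" where
  "representation G n \<rho> \<longleftrightarrow> \<rho> \<in> hom G (units_of (ring_mat TYPE('f) n ()))"

text \<open>
  The module \<open>V\<^sub>n\<close> is determined only up to isomorphism, so the matrix of the generator is required
  to be a Jordan block after a change of basis. Indecomposability is implied by the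
  presence of a single block.
\<close>

definition single_jordan_block_module ::
  "('g, 'm) monoid_scheme \<Rightarrow> nat \<Rightarrow> ('g \<Rightarrow> 'f::field mat) \<Rightarrow> bool" where
  "single_jordan_block_module G n \<rho> \<longleftrightarrow>
     representation G n \<rho> \<and>
     (\<exists>g\<in>carrier G. generate G {g} = carrier G \<and> similar_mat (\<rho> g) (jordan_block n 1))"

section \<open>Polynomials\<close>

text \<open>
  A polynomial maps monomials (finitely supported exponent vectors) to coefficients.
\<close>

type_synonym 'f mpoly = "(nat \<Rightarrow>\<^sub>0 nat) \<Rightarrow>\<^sub>0 'f"

definition const :: "'f::field \<Rightarrow> 'f mpoly" where
  "const c = Poly_Mapping.single 0 c"

definition var :: "nat \<Rightarrow> 'f::field mpoly" where
  "var i = Poly_Mapping.single (Poly_Mapping.single i 1) 1"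

text \<open>
  The symmetric algebra of the dual of the \<open>n\<close>-dimensional column space is the polynomial ring in
  \<open>var 0, \<dots>, var (n - 1)\<close>, where \<open>var i\<close> is the \<open>i\<close>-th coordinate function.
\<close>

definition poly_ring :: "nat \<Rightarrow> 'f::field mpoly set" where
  "poly_ring n = {f. \<forall>m\<in>Poly_Mapping.keys f. Poly_Mapping.keys m \<subseteq> {..<n}}"

definition subst :: "(nat \<Rightarrow> 'f::field mpoly) \<Rightarrow> 'f mpoly \<Rightarrow> 'f mpoly" where
  "subst \<sigma> f =
     (\<Sum>m\<in>Poly_Mapping.keys f.
        const (Poly_Mapping.lookup f m) * (\<Prod>i\<in>Poly_Mapping.keys m. \<sigma> i ^ Poly_Mapping.lookup m i))"

definition mon_deg :: "(nat \<Rightarrow>\<^sub>0 nat) \<Rightarrow> nat" where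
  "mon_deg m = (\<Sum>i\<in>Poly_Mapping.keys m. Poly_Mapping.lookup m i)"

definition homogeneous :: "'f::field mpoly \<Rightarrow> bool" where
  "homogeneous f \<longleftrightarrow> (\<exists>d. \<forall>m\<in>Poly_Mapping.keys f. mon_deg m = d)"

text \<open>The zero polynomial is given degree \<open>0\<close>.\<close>

definition total_deg :: "'f::field mpoly \<Rightarrow> nat" where
  "total_deg f = Max (insert 0 (mon_deg ` Poly_Mapping.keys f))"

section \<open>The action on polynomials and the ring of invariants\<close>

text \<open>
  \<open>G\<close> acts on a linear form \<open>\<phi>\<close> by \<open>(g \<cdot> \<phi>) v = \<phi> (g\<^sup>-\<^sup>1 \<cdot> v)\<close>, so \<open>var i\<close> is sent to the linear form
  whose coefficients are the \<open>i\<close>-th row of \<open>\<rho> (g\<^sup>-\<^sup>1)\<close>. This is extended to an algebra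
  endomorphism by substitution.
\<close>

definition poly_act ::
  "('g, 'm) monoid_scheme \<Rightarrow> nat \<Rightarrow> ('g \<Rightarrow> 'f::field mat) \<Rightarrow> 'g \<Rightarrow> 'f mpoly \<Rightarrow> 'f mpoly" where
  "poly_act G n \<rho> g = subst (\<lambda>i. \<Sum>j<n. const (\<rho> (inv\<^bsub>G\<^esub> g) $$ (i, j)) * var j)"

definition invariant_ring ::
  "('g, 'm) monoid_scheme \<Rightarrow> nat \<Rightarrow> ('g \<Rightarrow> 'f::field mat) \<Rightarrow> 'f mpoly set" where
  "invariant_ring G n \<rho> = {f \<in> poly_ring n. \<forall>g\<in>carrier G. poly_act G n \<rho> g f = f}"

section \<open>The Noether number\<close>

inductive_set alg_generated :: "'f::field mpoly set \<Rightarrow> 'f mpoly set" for B where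
  const: "const c \<in> alg_generated B"
| gen: "b \<in> B \<Longrightarrow> b \<in> alg_generated B"
| add: "f \<in> alg_generated B \<Longrightarrow> h \<in> alg_generated B \<Longrightarrow> f + h \<in> alg_generated B"
| mult: "f \<in> alg_generated B \<Longrightarrow> h \<in> alg_generated B \<Longrightarrow> f * h \<in> alg_generated B"

definition minimal_homogeneous_generating_set ::
  "'f::field mpoly set \<Rightarrow> 'f mpoly set \<Rightarrow> bool" where
  "minimal_homogeneous_generating_set A B \<longleftrightarrow>
     (\<forall>b\<in>B. homogeneous b) \<and> alg_generated B = A \<and> (\<forall>C. C \<subset> B \<longrightarrow> alg_generated C \<noteq> A)"

text \<open>
  The Noether number does not depend on the minimal homogeneous generating set. The predicate
  includes this independence, and the existence of such a set, so that it holds for at most one \<open>d\<close>.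
\<close>

definition is_noether_number :: "'f::field mpoly set \<Rightarrow> nat \<Rightarrow> bool" where
  "is_noether_number A d \<longleftrightarrow>
     (\<exists>B. minimal_homogeneous_generating_set A B) \<and>
     (\<forall>B. minimal_homogeneous_generating_set A B \<longrightarrow>
        (\<exists>b\<in>B. total_deg b = d) \<and> (\<forall>b\<in>B. total_deg b \<le> d))"

end

theory Submission
  imports Defs
begin

text \<open>
  Over a field of characteristic \<open>p\<close> the Jordan block of size \<open>p + 1\<close> is similar to the action \<open>\<sigma>\<close> that
  permutes \<open>p\<close> coordinates \<open>y 0, \<dots>, y (p - 1)\<close> cyclically and sends a last coordinate \<open>z\<close> to \<open>z + y 0\<close>
  (\<open>similar_jordan_block_action_matrix\<close>). Let \<open>S\<close> be the polynomial ring in the \<open>y i\<close> and \<open>s\<close> their sum.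
  The power \<open>\<sigma>^p\<close> fixes \<open>S\<close> and adds \<open>s\<close> to \<open>z\<close>, so its invariants are \<open>S[N]\<close> for the Artin-Schreier
  element \<open>N = z^p - s^(p-1) z\<close> of degree \<open>p\<close> (\<open>subgroup_invariants\<close>). What remains is the automorphism of
  order \<open>p\<close> that \<open>\<sigma>\<close> induces on \<open>S[N]\<close>; it sends \<open>N\<close> to \<open>N + M 0\<close> with \<open>M 0 = (y 0)^p - s^(p-1) (y 0)\<close>.

  The module \<open>S\<close> is a permutation module in which all orbits of monomials are free, except for the
  powers of \<open>e = y 0 \<cdots> y (p - 1)\<close>. Hence the leading coefficient of an invariant with respect to \<open>N\<close> is a
  transfer plus a polynomial in \<open>e\<close>. The coefficient of \<open>M 0\<close> at \<open>e\<close> is not zero, and comparing the next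
  coefficients shows that the polynomial in \<open>e\<close> can only appear when the degree in \<open>N\<close> is divisible
  by \<open>p\<close>; then it can be removed with a power of the norm of \<open>N\<close>. So every invariant is the sum of a
  polynomial in \<open>e\<close> and the norm of \<open>N\<close>, and of a transfer (\<open>invariant_decomposition\<close>).

  For the upper bound, division by the norm leaves the transfers of \<open>h N^k\<close> with \<open>h \<in> S\<close> and \<open>k < p\<close>. If \<open>h\<close>
  has degree at least \<open>2p - 2\<close>, then \<open>h\<close> lies in the ideal of \<open>S\<close> generated by invariants of positive
  degree (\<open>monomial_in_hilbert_ideal\<close>), and the transfer is decomposable. The remaining generators have
  degree at most \<open>p (p - 1) + (2p - 3) = p^2 + p - 3\<close>; the norm has degree \<open>p^2\<close>, which is not larger.

  For the lower bound, a linear functional is produced that vanishes on products of invariants of positive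
  degree but not on some invariant of degree \<open>p^2 + p - 3\<close>. If \<open>p = 3\<close>, this invariant is the norm of \<open>N\<close>. For
  \<open>p \<ge> 5\<close> specialise \<open>y i\<close> to \<open>T + (i L)^2 + (i L)^3\<close>. The transfer becomes a sum over points with parameter
  \<open>k L\<close>, and the power sums of exponent below \<open>p - 1\<close> over the prime field vanish. So modulo
  \<open>T^p\<close> and \<open>X^(p^2)\<close>, where \<open>X\<close> is the image of \<open>z\<close>, all invariants of positive degree become divisible by \<open>L^(p-1)\<close>, and their products by
  \<open>L^(2p-2)\<close>; but a suitable transfer has a nonzero term with \<open>L^(2p-3)\<close> (\<open>\<Psi>_top_transfer\<close>).
\<close>

section \<open>Evaluation homomorphisms\<close>

abbreviation "lookup \<equiv> Poly_Mapping.lookup"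
abbreviation "keys \<equiv> Poly_Mapping.keys"
abbreviation "single \<equiv> Poly_Mapping.single"

definition monom_value :: "(nat \<Rightarrow> 'b::comm_ring_1) \<Rightarrow> (nat \<Rightarrow>\<^sub>0 nat) \<Rightarrow> 'b" where
  "monom_value v m = (\<Prod>i\<in>keys m. v i ^ lookup m i)"

definition evaluate :: "('f::field \<Rightarrow> 'b::comm_ring_1) \<Rightarrow> (nat \<Rightarrow> 'b) \<Rightarrow> 'f mpoly \<Rightarrow> 'b" where
  "evaluate \<kappa> v f =
     (\<Sum>m\<in>keys f. \<kappa> (lookup f m) * monom_value v m)"

lemma subst_eq_evaluate: "subst = evaluate const"
  by (simp add: fun_eq_iff subst_def evaluate_def monom_value_def)

lemma monom_value_superset:
  assumes "finite I" and "keys m \<subseteq> I"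
  shows "monom_value v m = (\<Prod>i\<in>I. v i ^ lookup m i)"
  unfolding monom_value_def
  by (rule prod.mono_neutral_left) (use assms in \<open>auto simp: in_keys_iff\<close>)

lemma monom_value_add: "monom_value v (m + n) = monom_value v m * monom_value v n"
proof -
  let ?I = "keys m \<union> keys n"
  have "monom_value v (m + n) = (\<Prod>i\<in>?I. v i ^ lookup (m + n) i)"
    by (rule monom_value_superset) (use keys_add[of m n] in auto)
  also have "\<dots> = (\<Prod>i\<in>?I. v i ^ lookup m i) * (\<Prod>i\<in>?I. v i ^ lookup n i)"
    by (simp add: lookup_add power_add prod.distrib)
  also have "\<dots> = monom_value v m * monom_value v n"
    by (simp add: monom_value_superset[of ?I])
  finally show ?thesis .
qed

lemma monom_value_zero [simp]: "monom_value v 0 = 1"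
  by (simp add: monom_value_def)

lemma monom_value_single [simp]: "monom_value v (single i k) = v i ^ k"
  by (cases "k = 0") (simp_all add: monom_value_def)

lemma mpoly_sum_of_terms:
  "f = (\<Sum>m\<in>keys f. single m (lookup f m))"
proof (rule poly_mapping_eqI)
  fix k
  show "lookup f k =
    lookup (\<Sum>m\<in>keys f. single m (lookup f m)) k"
    by (auto simp: lookup_sum lookup_single when_def sum.delta in_keys_iff)
qed

lemma evaluate_superset:
  assumes "comm_ring_hom \<kappa>" and "finite I" and "keys f \<subseteq> I"
  shows "evaluate \<kappa> v f = (\<Sum>m\<in>I. \<kappa> (lookup f m) * monom_value v m)"
proof -
  interpret \<kappa>: comm_ring_hom \<kappa> by fact
  show ?thesis
    unfolding evaluate_def
    by (rule sum.mono_neutral_left) (use assms in \<open>auto simp: in_keys_iff\<close>)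
qed

lemma evaluate_single:
  assumes "comm_ring_hom \<kappa>"
  shows "evaluate \<kappa> v (single m a) = \<kappa> a * monom_value v m"
proof -
  interpret \<kappa>: comm_ring_hom \<kappa> by fact
  show ?thesis by (cases "a = 0") (simp_all add: evaluate_def)
qed

lemma evaluate_add:
  assumes "comm_ring_hom \<kappa>"
  shows "evaluate \<kappa> v (f + g) = evaluate \<kappa> v f + evaluate \<kappa> v g"
proof -
  interpret \<kappa>: comm_ring_hom \<kappa> by fact
  let ?I = "keys f \<union> keys g"
  have "evaluate \<kappa> v (f + g) = (\<Sum>m\<in>?I. \<kappa> (lookup (f + g) m) * monom_value v m)"
    by (rule evaluate_superset) (use assms keys_add[of f g] in auto)
  also have "\<dots> = evaluate \<kappa> v f + evaluate \<kappa> v g"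
    by (simp add: evaluate_superset[OF assms, of ?I] lookup_add \<kappa>.hom_add ring_distribs sum.distrib)
  finally show ?thesis .
qed

lemma evaluate_mult:
  assumes "comm_ring_hom \<kappa>"
  shows "evaluate \<kappa> v (f * g) = evaluate \<kappa> v f * evaluate \<kappa> v g"
proof -
  interpret \<kappa>: comm_ring_hom \<kappa> by fact
  have zero: "evaluate \<kappa> v 0 = 0" by (simp add: evaluate_def)
  have ev_sum: "evaluate \<kappa> v (sum h I) = (\<Sum>i\<in>I. evaluate \<kappa> v (h i))" if "finite I"
    for h and I :: "'c set"
    using that by (induction I rule: finite_induct) (simp_all add: zero evaluate_add[OF assms])
  have ev_sum2: "evaluate \<kappa> v (\<Sum>i\<in>I. \<Sum>j\<in>J. h i j) = (\<Sum>i\<in>I. \<Sum>j\<in>J. evaluate \<kappa> v (h i j))"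
    if "finite I" "finite J" for h and I J :: "(nat \<Rightarrow>\<^sub>0 nat) set"
    using that(1)
    by (induction I rule: finite_induct)
      (simp_all add: zero evaluate_add[OF assms] ev_sum[OF that(2)] del: ev_sum)
  have "f * g = (\<Sum>m\<in>keys f. \<Sum>n\<in>keys g.
      single m (lookup f m) * single n (lookup g n))"
    by (subst mpoly_sum_of_terms[of f], subst mpoly_sum_of_terms[of g]) (rule sum_product)
  then have "evaluate \<kappa> v (f * g) = (\<Sum>m\<in>keys f. \<Sum>n\<in>keys g.
      (\<kappa> (lookup f m) * monom_value v m) * (\<kappa> (lookup g n) * monom_value v n))"
    by (simp add: ev_sum2 mult_single evaluate_single[OF assms] monom_value_add \<kappa>.hom_mult
        mult_ac)
  also have "\<dots> = evaluate \<kappa> v f * evaluate \<kappa> v g"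
    unfolding evaluate_def by (rule sum_product[symmetric])
  finally show ?thesis .
qed

lemma evaluate_hom:
  assumes "comm_ring_hom \<kappa>"
  shows "comm_ring_hom (evaluate \<kappa> v)"
proof -
  interpret \<kappa>: comm_ring_hom \<kappa> by fact
  show ?thesis
  proof
    show "evaluate \<kappa> v 0 = 0" by (simp add: evaluate_def)
    show "evaluate \<kappa> v 1 = 1"
      by (metis evaluate_single[OF assms] \<kappa>.hom_one monom_value_zero mult_1 single_one)
  qed (simp_all add: evaluate_add[OF assms] evaluate_mult[OF assms])
qed

lemma evaluate_const [simp]: "comm_ring_hom \<kappa> \<Longrightarrow> evaluate \<kappa> v (const c) = \<kappa> c"
  by (simp add: const_def evaluate_single)

lemma evaluate_var [simp]:
  assumes "comm_ring_hom \<kappa>"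
  shows "evaluate \<kappa> v (var i) = v i"
proof -
  interpret \<kappa>: comm_ring_hom \<kappa> by fact
  show ?thesis using assms by (simp add: var_def evaluate_single)
qed

lemma const_hom: "comm_ring_hom (const :: 'f::field \<Rightarrow> 'f mpoly)"
  by standard (simp_all add: const_def single_add mult_single)

lemma const_0 [simp]: "const 0 = 0" and const_1 [simp]: "const 1 = 1"
  by (simp_all add: const_def)

lemma const_of_nat: "const (of_nat k) = of_nat k"
  by (simp add: const_def)

lemma const_uminus: "const (- c) = - const c"
  by (simp add: const_def single_uminus)

lemma subst_hom: "comm_ring_hom (subst \<sigma>)"
  unfolding subst_eq_evaluate by (rule evaluate_hom[OF const_hom])

lemma subst_const [simp]: "subst \<sigma> (const c) = const c"
  by (simp add: subst_eq_evaluate const_hom)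

lemma subst_var [simp]: "subst \<sigma> (var i) = \<sigma> i"
  by (simp add: subst_eq_evaluate const_hom)

lemma CHAR_mpoly: "CHAR('f::field mpoly) = CHAR('f)"
proof (rule CHAR_eqI)
  interpret const: comm_ring_hom "const :: 'f \<Rightarrow> 'f mpoly" by (rule const_hom)
  have eq: "(of_nat n :: 'f mpoly) = single 0 (of_nat n)" for n
    by simp
  show "(of_nat CHAR('f) :: 'f mpoly) = 0" by (simp only: eq[of "CHAR('f)"] of_nat_CHAR single_zero)
  show "CHAR('f) dvd n" if "(of_nat n :: 'f mpoly) = 0" for n
  proof -
    have "lookup (of_nat n :: 'f mpoly) 0 = of_nat n" by (simp only: eq lookup_single_eq)
    with that have "(of_nat n :: 'f) = 0" by (metis lookup_zero)
    then show ?thesis by (simp only: of_nat_eq_0_iff_char_dvd)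
  qed
qed

section \<open>The subrings of polynomials in the first variables\<close>

lemma poly_ring_const [simp]: "const c \<in> poly_ring n"
  by (auto simp: poly_ring_def const_def)

lemma poly_ring_var [simp]: "i < n \<Longrightarrow> var i \<in> poly_ring n"
  by (auto simp: poly_ring_def var_def)

lemma poly_ring_add [simp]: "f \<in> poly_ring n \<Longrightarrow> g \<in> poly_ring n \<Longrightarrow> f + g \<in> poly_ring n"
  using keys_add[of f g] by (fastforce simp: poly_ring_def)

lemma poly_ring_mult [simp]:
  assumes "f \<in> poly_ring n" "g \<in> poly_ring n"
  shows "f * g \<in> poly_ring n"
proof -
  have "keys m \<subseteq> {..<n}" if m: "m \<in> keys (f * g)" for m
  proof -
    obtain a b where "m = a + b" "a \<in> keys f" "b \<in> keys g"
      using keys_mult[of f g] m by auto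
    with assms keys_add[of a b] show ?thesis by (fastforce simp: poly_ring_def)
  qed
  then show ?thesis by (auto simp: poly_ring_def)
qed

lemma poly_ring_0 [simp]: "0 \<in> poly_ring n"
  using poly_ring_const[of 0] by simp

lemma poly_ring_1 [simp]: "1 \<in> poly_ring n"
  using poly_ring_const[of 1] by simp

lemma poly_ring_uminus [simp]:
  assumes "f \<in> poly_ring n" shows "- f \<in> poly_ring n"
proof -
  have "- f = const (-1) * f" by (simp add: const_uminus)
  with assms show ?thesis by (metis poly_ring_const poly_ring_mult)
qed

lemma poly_ring_diff [simp]: "f \<in> poly_ring n \<Longrightarrow> g \<in> poly_ring n \<Longrightarrow> f - g \<in> poly_ring n"
  using poly_ring_add[of f n "- g"] by simp

lemma poly_ring_sum [simp]: "(\<And>i. i \<in> I \<Longrightarrow> f i \<in> poly_ring n) \<Longrightarrow> sum f I \<in> poly_ring n"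
  by (induction I rule: infinite_finite_induct) simp_all

lemma poly_ring_prod [simp]: "(\<And>i. i \<in> I \<Longrightarrow> f i \<in> poly_ring n) \<Longrightarrow> prod f I \<in> poly_ring n"
  by (induction I rule: infinite_finite_induct) simp_all

lemma poly_ring_power [simp]: "f \<in> poly_ring n \<Longrightarrow> f ^ k \<in> poly_ring n"
  by (induction k) simp_all

lemma poly_ring_mono: "m \<le> n \<Longrightarrow> f \<in> poly_ring m \<Longrightarrow> f \<in> poly_ring n"
  unfolding poly_ring_def by fastforce

lemma single_eq_monomial:
  "single m a = const a * monom_value var m"
proof -
  have "monom_value var m = single m (1::'a)"
  proof -
    have *: "(\<Prod>i\<in>I. var i ^ k i) = single (\<Sum>i\<in>I. single i (k i)) (1::'a)"
      if "finite I" for I k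
      using that
    proof (induction I rule: finite_induct)
      case (insert j I)
      have "var j ^ n = single (single j n) (1::'a)" for n
        by (induction n) (simp_all add: var_def mult_single flip: single_add)
      with insert show ?case by (simp add: mult_single)
    qed simp
    have "(\<Sum>i\<in>keys m. single i (lookup m i)) = m"
      by (rule poly_mapping_eqI)
        (auto simp: lookup_sum lookup_single when_def sum.delta in_keys_iff)
    then show ?thesis by (simp add: monom_value_def * )
  qed
  then show ?thesis by (simp add: const_def mult_single)
qed

lemma poly_ring_induct [consumes 1, case_names const var add mult]:
  fixes f :: "'f::field mpoly"
  assumes "f \<in> poly_ring n"
    and const: "\<And>c. P (const c)"
    and var: "\<And>i. i < n \<Longrightarrow> P (var i)"
    and add: "\<And>f g. f \<in> poly_ring n \<Longrightarrow> g \<in> poly_ring n \<Longrightarrow> P f \<Longrightarrow> P g \<Longrightarrow> P (f + g)"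
    and mult: "\<And>f g. f \<in> poly_ring n \<Longrightarrow> g \<in> poly_ring n \<Longrightarrow> P f \<Longrightarrow> P g \<Longrightarrow> P (f * g)"
  shows "P f"
proof -
  have one: "P 1" using const[of 1] by simp
  have pow: "P (var i ^ k)" if "i < n" for i k
    by (induction k) (use that one in \<open>auto intro!: mult var\<close>)
  have prod: "P (\<Prod>i\<in>I. var i ^ k i)" if "finite I" "I \<subseteq> {..<n}" for I k
    using that
  proof (induction I rule: finite_induct)
    case (insert j I)
    then have "(\<Prod>i\<in>I. var i ^ k i) \<in> poly_ring n" by (intro poly_ring_prod) auto
    with insert show ?case by (auto intro!: mult pow)
  qed (simp add: one)
  have term_in: "P (single m a) \<and> single m a \<in> poly_ring n"
    if "keys m \<subseteq> {..<n}" for m a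
  proof
    have mem: "(monom_value var m :: 'f mpoly) \<in> poly_ring n"
      unfolding monom_value_def using that by (intro poly_ring_prod) auto
    show "P (single m a)"
      unfolding single_eq_monomial using mem that
      by (intro mult const) (auto simp: monom_value_def intro!: prod)
    show "single m a \<in> poly_ring n"
      unfolding single_eq_monomial using mem by simp
  qed
  have sums: "P (\<Sum>m\<in>I. single m (c m)) \<and> (\<Sum>m\<in>I. single m (c m)) \<in> poly_ring n"
    if "finite I" "\<forall>m\<in>I. keys m \<subseteq> {..<n}" for I c
    using that
  proof (induction I rule: finite_induct)
    case empty
    show ?case using const[of 0] by simp
  next
    case (insert m I)
    then show ?case using term_in[of m "c m"] by (auto intro: add)
  qed
  have "P (\<Sum>m\<in>keys f. single m (lookup f m))"
    using sums[of "keys f" "lookup f"] assms(1)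
    by (simp add: poly_ring_def)
  then show ?thesis by (simp only: mpoly_sum_of_terms[symmetric])
qed

lemma hom_eq_on_poly_ring:
  assumes "comm_ring_hom \<phi>" and "comm_ring_hom \<psi>"
    and "\<And>c. \<phi> (const c) = \<psi> (const c)" and "\<And>i. i < n \<Longrightarrow> \<phi> (var i) = \<psi> (var i)"
    and "f \<in> poly_ring n"
  shows "\<phi> f = \<psi> f"
proof -
  interpret \<phi>: comm_ring_hom \<phi> by fact
  interpret \<psi>: comm_ring_hom \<psi> by fact
  from assms(5) show ?thesis
    by (induction rule: poly_ring_induct) (simp_all add: assms \<phi>.hom_add \<psi>.hom_add \<phi>.hom_mult \<psi>.hom_mult)
qed

lemma hom_in_poly_ring:
  assumes "comm_ring_hom \<phi>" and "\<And>c. \<phi> (const c) \<in> poly_ring m"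
    and "\<And>i. i < n \<Longrightarrow> \<phi> (var i) \<in> poly_ring m" and "f \<in> poly_ring n"
  shows "\<phi> f \<in> poly_ring m"
proof -
  interpret \<phi>: comm_ring_hom \<phi> by fact
  from assms(4) show ?thesis
    by (induction rule: poly_ring_induct) (simp_all add: assms \<phi>.hom_add \<phi>.hom_mult)
qed

lemma comm_ring_hom_compose:
  assumes "comm_ring_hom f" and "comm_ring_hom g"
  shows "comm_ring_hom (\<lambda>x. f (g x))"
proof -
  interpret f: comm_ring_hom f by fact
  interpret g: comm_ring_hom g by fact
  show ?thesis by standard (simp_all add: f.hom_add g.hom_add f.hom_mult g.hom_mult)
qed

section \<open>Homogeneous components\<close>

definition is_form :: "nat \<Rightarrow> 'f::field mpoly \<Rightarrow> bool" where
  "is_form d f \<longleftrightarrow> (\<forall>m\<in>keys f. mon_deg m = d)"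

text \<open>
  Replacing every variable by its product with a new variable \<open>X\<close> makes the homogeneous components
  of a polynomial appear as the coefficients of the powers of \<open>X\<close>. Since this is a ring
  homomorphism, the behaviour of components under sums and products is that of coefficients.
\<close>

definition grade :: "'f::field mpoly \<Rightarrow> 'f mpoly poly" where
  "grade = evaluate (\<lambda>c. [:const c:]) (\<lambda>i. monom (var i) 1)"

definition component :: "nat \<Rightarrow> 'f::field mpoly \<Rightarrow> 'f mpoly" where
  "component d f = coeff (grade f) d"

lemma pCons_hom: "comm_ring_hom \<kappa> \<Longrightarrow> comm_ring_hom (\<lambda>c. [:\<kappa> c:])"
proof -
  assume "comm_ring_hom \<kappa>"
  then interpret \<kappa>: comm_ring_hom \<kappa> .
  show ?thesis by standard (simp_all add: \<kappa>.hom_add \<kappa>.hom_mult one_pCons)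
qed

lemma grade_hom: "comm_ring_hom grade"
  unfolding grade_def by (intro evaluate_hom pCons_hom const_hom)

lemma mon_deg_superset:
  "finite I \<Longrightarrow> keys m \<subseteq> I \<Longrightarrow> mon_deg m = (\<Sum>i\<in>I. lookup m i)"
  unfolding mon_deg_def by (rule sum.mono_neutral_left) (auto simp: in_keys_iff)

lemma mon_deg_add: "mon_deg (m + n) = mon_deg m + mon_deg n"
proof -
  let ?I = "keys m \<union> keys n"
  have "mon_deg (m + n) = (\<Sum>i\<in>?I. lookup (m + n) i)"
    by (rule mon_deg_superset) (use keys_add[of m n] in auto)
  then show ?thesis
    by (simp add: mon_deg_superset[of ?I] lookup_add sum.distrib)
qed

lemma mon_deg_0 [simp]: "mon_deg 0 = 0"
  by (simp add: mon_deg_def)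

lemma mon_deg_eq_0: "mon_deg m = 0 \<Longrightarrow> m = 0"
  by (rule poly_mapping_eqI) (auto simp: mon_deg_def in_keys_iff)

lemma grade_single:
  "grade (single m a) = monom (single m a) (mon_deg m)"
proof -
  have *: "(\<Prod>i\<in>I. monom (var i :: 'a mpoly) (Suc 0) ^ k i) = monom (\<Prod>i\<in>I. var i ^ k i) (\<Sum>i\<in>I. k i)"
    if "finite I" for I k
    using that
    by (induction I rule: finite_induct) (simp_all add: monom_power mult_monom)
  have "grade (single m a) = [:const a:] * monom (monom_value var m) (mon_deg m)"
    unfolding grade_def
    by (subst evaluate_single) (simp_all add: pCons_hom const_hom monom_value_def * mon_deg_def)
  also have "[:const a:] = monom (const a) 0" by (simp add: monom_0)
  finally show ?thesis by (simp only: mult_monom single_eq_monomial) simp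
qed

lemma lookup_component:
  "lookup (component d f) m = (if mon_deg m = d then lookup f m else 0)"
proof -
  interpret grade: comm_ring_hom grade by (rule grade_hom)
  have "component d f =
    component d (\<Sum>m\<in>keys f. single m (lookup f m))"
    by (simp only: mpoly_sum_of_terms[symmetric])
  also have "\<dots> = (\<Sum>m\<in>keys f.
      if mon_deg m = d then single m (lookup f m) else 0)"
    by (simp add: component_def grade.hom_sum grade_single coeff_sum)
  finally show ?thesis
    by (auto simp: lookup_sum lookup_single when_def in_keys_iff if_distrib[of "\<lambda>f. lookup f _"]
        if_distrib sum.If_cases intro!: sum.neutral)
qed

lemma component_add: "component d (f + g) = component d f + component d g"
  by (rule poly_mapping_eqI) (simp add: lookup_component lookup_add)

lemma component_mult: "component d (f * g) = (\<Sum>i\<le>d. component i f * component (d - i) g)"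
proof -
  interpret grade: comm_ring_hom grade by (rule grade_hom)
  show ?thesis by (simp add: component_def grade.hom_mult coeff_mult)
qed

lemma is_form_component: "is_form d (component d f)"
  by (auto simp: is_form_def in_keys_iff lookup_component split: if_splits)

lemma component_of_form: "is_form k f \<Longrightarrow> component d f = (if d = k then f else 0)"
  by (rule poly_mapping_eqI) (auto simp: is_form_def in_keys_iff lookup_component)

lemma is_form_0_eq_const: "is_form 0 f \<Longrightarrow> \<exists>c. f = const c"
proof -
  assume f: "is_form 0 f"
  have "f = const (lookup f 0)"
  proof (rule poly_mapping_eqI)
    fix m
    show "lookup f m = lookup (const (lookup f 0)) m"
    proof (cases "m = 0")
      case False
      then have "m \<notin> keys f" using f mon_deg_eq_0[of m] by (auto simp: is_form_def)
      with False show ?thesis by (simp add: const_def lookup_single in_keys_iff)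
    qed (simp add: const_def)
  qed
  then show ?thesis by blast
qed

lemma is_form_zero [simp]: "is_form d 0"
  by (simp add: is_form_def)

lemma is_form_const [simp]: "is_form 0 (const c)"
  by (auto simp: is_form_def const_def)

lemma is_form_one [simp]: "is_form 0 1"
  using is_form_const[of 1] by simp

lemma is_form_var [simp]: "is_form 1 (var i)"
  by (auto simp: is_form_def var_def mon_deg_def)

lemma is_form_add: "is_form d f \<Longrightarrow> is_form d g \<Longrightarrow> is_form d (f + g)"
  using keys_add[of f g] by (auto simp: is_form_def)

lemma is_form_mult: "is_form a f \<Longrightarrow> is_form b g \<Longrightarrow> is_form (a + b) (f * g)"
  using keys_mult[of f g] by (fastforce simp: is_form_def mon_deg_add)

lemma is_form_mult_const: "is_form a f \<Longrightarrow> is_form a (const c * f)"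
  using is_form_mult[OF is_form_const] by fastforce

lemma is_form_uminus: "is_form d f \<Longrightarrow> is_form d (- f)"
  by (auto simp: is_form_def in_keys_iff)

lemma is_form_diff: "is_form d f \<Longrightarrow> is_form d g \<Longrightarrow> is_form d (f - g)"
  using is_form_add[of d f "- g"] is_form_uminus[of d g] by simp

lemma is_form_sum: "(\<And>i. i \<in> I \<Longrightarrow> is_form d (f i)) \<Longrightarrow> is_form d (sum f I)"
  by (induction I rule: infinite_finite_induct) (simp_all add: is_form_add)

lemma is_form_prod:
  "finite I \<Longrightarrow> (\<And>i. i \<in> I \<Longrightarrow> is_form (d i) (f i)) \<Longrightarrow> is_form (\<Sum>i\<in>I. d i) (prod f I)"
  by (induction I rule: finite_induct) (simp_all add: is_form_mult)

lemma is_form_power: "is_form d f \<Longrightarrow> is_form (k * d) (f ^ k)"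
  by (induction k) (simp_all add: is_form_mult)

lemma is_form_subst:
  assumes "is_form d f" and "\<And>i. is_form 1 (\<sigma> i)"
  shows "is_form d (subst \<sigma> f)"
  unfolding subst_def
proof (rule is_form_sum)
  fix m assume m: "m \<in> keys f"
  have "is_form (\<Sum>i\<in>keys m. lookup m i)
      (\<Prod>i\<in>keys m. \<sigma> i ^ lookup m i)"
    by (rule is_form_prod) (use is_form_power[OF assms(2)] in auto)
  moreover have "(\<Sum>i\<in>keys m. lookup m i) = d"
    using assms(1) m by (simp add: is_form_def mon_deg_def)
  ultimately show "is_form d (const (lookup f m) *
      (\<Prod>i\<in>keys m. \<sigma> i ^ lookup m i))"
    by (simp add: is_form_mult_const)
qed

lemma is_form_total_deg: "homogeneous f \<Longrightarrow> is_form (total_deg f) f"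
proof -
  assume "homogeneous f"
  then obtain d where d: "\<forall>m\<in>keys f. mon_deg m = d" by (auto simp: homogeneous_def)
  show ?thesis
  proof (cases "keys f = {}")
    case False
    then obtain m where "m \<in> keys f" by blast
    with d have "mon_deg ` keys f = {d}" by force
      
    with d show ?thesis by (simp add: is_form_def total_deg_def)
  qed (simp add: is_form_def)
qed

lemma homogeneousI: "is_form d f \<Longrightarrow> homogeneous f"
  by (auto simp: homogeneous_def is_form_def)

section \<open>A criterion for the Noether number\<close>

lemma alg_generated_mono: "B \<subseteq> C \<Longrightarrow> alg_generated B \<subseteq> alg_generated C"
proof
  fix f assume "B \<subseteq> C" "f \<in> alg_generated B"
  from this(2) show "f \<in> alg_generated C"
    by induction (use \<open>B \<subseteq> C\<close> in \<open>auto intro: alg_generated.intros\<close>)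
qed

lemma alg_generated_subset: "B \<subseteq> alg_generated C \<Longrightarrow> alg_generated B \<subseteq> alg_generated C"
proof
  fix f assume "B \<subseteq> alg_generated C" "f \<in> alg_generated B"
  from this(2) show "f \<in> alg_generated C"
    by induction (use \<open>B \<subseteq> alg_generated C\<close> in \<open>auto intro: alg_generated.intros\<close>)
qed

lemma alg_generated_0: "0 \<in> alg_generated B"
  using alg_generated.const[of 0] by simp

lemma alg_generated_1: "1 \<in> alg_generated B"
  using alg_generated.const[of 1] by simp

lemma alg_generated_sum: "(\<And>i. i \<in> I \<Longrightarrow> f i \<in> alg_generated B) \<Longrightarrow> sum f I \<in> alg_generated B"
  by (induction I rule: infinite_finite_induct) (auto intro: alg_generated_0 alg_generated.add)

lemma alg_generated_power: "f \<in> alg_generated B \<Longrightarrow> f ^ k \<in> alg_generated B"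
  by (induction k) (auto intro: alg_generated_1 alg_generated.mult)

text \<open>
  A component of degree \<open>i\<close> of a product only involves components of the factors of degree at most \<open>i\<close>.
\<close>

lemma component_in_alg_generated:
  assumes hom: "\<forall>b\<in>B. homogeneous b" and "f \<in> alg_generated B"
  shows "component i f \<in> alg_generated {b \<in> B. total_deg b \<le> i}"
  using assms(2)
proof (induction arbitrary: i)
  case (const c)
  show ?case
    using component_of_form[OF is_form_const, of i c]
    by (auto intro: alg_generated_0 alg_generated.const)
next
  case (gen b)
  then have "component i b = (if i = total_deg b then b else 0)"
    using hom by (intro component_of_form is_form_total_deg) auto
  with gen show ?case by (auto intro: alg_generated_0 alg_generated.gen)
next
  case (add f g)
  then show ?case by (auto simp: component_add intro: alg_generated.add)
next
  case (mult f g)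
  show ?case
    unfolding component_mult
  proof (rule alg_generated_sum, rule alg_generated.mult)
    fix j assume "j \<in> {..i}"
    then have "{b \<in> B. total_deg b \<le> j} \<subseteq> {b \<in> B. total_deg b \<le> i}"
      and "{b \<in> B. total_deg b \<le> i - j} \<subseteq> {b \<in> B. total_deg b \<le> i}" by auto
    with mult.IH(1)[of j] mult.IH(2)[of "i - j"]
    show "component j f \<in> alg_generated {b \<in> B. total_deg b \<le> i}"
      and "component (i - j) g \<in> alg_generated {b \<in> B. total_deg b \<le> i}"
      using alg_generated_mono by blast+
  qed
qed

text \<open>
  If the algebra has homogeneous generators of degree at most \<open>d\<close>, then an element of larger
  degree in any homogeneous generating set is redundant. Conversely, a linear functional that
  kills all products of forms of positive degree, but not some form of degree \<open>d\<close>, witnesses that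
  this form is not decomposable; a generating set without elements of degree \<open>d\<close> would express it
  through products.
\<close>

lemma is_noether_numberI:
  fixes A :: "'f::field mpoly set" and \<phi> :: "'f mpoly \<Rightarrow> 'f"
  assumes "finite B\<^sub>0" and B0: "\<And>b. b \<in> B\<^sub>0 \<Longrightarrow> \<exists>k\<le>d. is_form k b" and A: "A = alg_generated B\<^sub>0"
    and \<phi>_add: "\<And>f g. \<phi> (f + g) = \<phi> f + \<phi> g"
    and \<phi>_scale: "\<And>c f. \<phi> (const c * f) = c * \<phi> f"
    and \<phi>_mult: "\<And>i j f g. f \<in> A \<Longrightarrow> g \<in> A \<Longrightarrow> is_form i f \<Longrightarrow> is_form j g \<Longrightarrow> 0 < i \<Longrightarrow> 0 < j \<Longrightarrow>
      \<phi> (f * g) = 0"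
    and "d > 0" and T: "T \<in> A" "is_form d T" "\<phi> T \<noteq> 0"
  shows "is_noether_number A d"
  unfolding is_noether_number_def
proof (intro conjI allI impI)
  let ?\<B> = "{B. B \<subseteq> B\<^sub>0 \<and> alg_generated B = A}"
  have "finite ?\<B>" by (rule finite_subset[of _ "Pow B\<^sub>0"]) (use \<open>finite B\<^sub>0\<close> in auto)
  moreover have "B\<^sub>0 \<in> ?\<B>" using A by simp
  ultimately have "\<exists>B\<in>?\<B>. \<forall>C\<in>?\<B>. C \<subseteq> B \<longrightarrow> B = C"
    by (intro finite_has_minimal) auto
  then obtain B where B: "B \<in> ?\<B>" and min: "\<And>C. C \<in> ?\<B> \<Longrightarrow> C \<subseteq> B \<Longrightarrow> B = C"
    by auto
  have "minimal_homogeneous_generating_set A B"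
    unfolding minimal_homogeneous_generating_set_def
  proof (intro conjI ballI allI impI)
    show "homogeneous b" if "b \<in> B" for b using B B0[of b] that homogeneousI by auto
    show "alg_generated B = A" using B by simp
    show "alg_generated C \<noteq> A" if "C \<subset> B" for C
    proof
      assume "alg_generated C = A"
      with B that have "C \<in> ?\<B>" by auto
      with min[of C] that show False by auto
    qed
  qed
  then show "\<exists>B. minimal_homogeneous_generating_set A B" ..
next
  fix B assume "minimal_homogeneous_generating_set A B"
  then have hom: "\<forall>b\<in>B. homogeneous b" and gen: "alg_generated B = A"
    and min: "\<And>C. C \<subset> B \<Longrightarrow> alg_generated C \<noteq> A"
    by (auto simp: minimal_homogeneous_generating_set_def)
  show "\<forall>b\<in>B. total_deg b \<le> d"
  proof (rule ccontr)
    assume "\<not> (\<forall>b\<in>B. total_deg b \<le> d)"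
    then obtain b where b: "b \<in> B" "total_deg b > d" by auto
    let ?C = "B - {b}"
    have "B\<^sub>0 \<subseteq> alg_generated ?C"
    proof
      fix b' assume b': "b' \<in> B\<^sub>0"
      then obtain k where k: "k \<le> d" "is_form k b'" using B0 by blast
      have "b' \<in> alg_generated B" using b' A gen alg_generated.gen by blast
      then have "component k b' \<in> alg_generated {b \<in> B. total_deg b \<le> k}"
        by (rule component_in_alg_generated[OF hom])
      moreover have "{b \<in> B. total_deg b \<le> k} \<subseteq> ?C" using b k by auto
      ultimately show "b' \<in> alg_generated ?C"
        using component_of_form[OF k(2), of k] alg_generated_mono by auto
    qed
    then have "A \<subseteq> alg_generated ?C" unfolding A by (rule alg_generated_subset)
    moreover have "alg_generated ?C \<subseteq> A" using alg_generated_mono[of ?C B] gen by auto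
    ultimately show False using min[of ?C] b by blast
  qed
  show "\<exists>b\<in>B. total_deg b = d"
  proof (rule ccontr)
    assume none: "\<not> (\<exists>b\<in>B. total_deg b = d)"
    have \<phi>0: "\<phi> 0 = 0" using \<phi>_scale[of 0 0] by simp
    have \<phi>_sum: "\<phi> (sum h I) = (\<Sum>i\<in>I. \<phi> (h i))" if "finite I" for h and I :: "nat set"
      using that by (induction I rule: finite_induct) (simp_all add: \<phi>0 \<phi>_add)
    have "\<phi> (component d f) = 0" if "f \<in> alg_generated B" for f
      using that
    proof induction
      case (const c)
      show ?case using component_of_form[OF is_form_const, of d c] \<open>d > 0\<close> \<phi>0 by simp
    next
      case (gen b)
      then have "component d b = (if d = total_deg b then b else 0)"
        using hom by (intro component_of_form is_form_total_deg) auto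
      then show ?case using none gen \<phi>0 by auto
    next
      case (add f g)
      then show ?case by (simp add: component_add \<phi>_add)
    next
      case (mult f g)
      have "\<phi> (component i f * component (d - i) g) = 0" if "i \<le> d" for i
      proof -
        have in_A: "component j h \<in> A" if "h \<in> alg_generated B" for j h
          using component_in_alg_generated[OF hom that, of j] gen
            alg_generated_mono[of "{b \<in> B. total_deg b \<le> j}" B] by auto
        consider "i = 0" | "i = d" | "0 < i" "i < d" using \<open>i \<le> d\<close> by linarith
        then show ?thesis
        proof cases
          case 1
          obtain c where "component 0 f = const c" using is_form_0_eq_const is_form_component by blast
          with 1 mult.IH show ?thesis by (simp add: \<phi>_scale)
        next
          case 2
          obtain c where "component 0 g = const c" using is_form_0_eq_const is_form_component by blast
          with 2 mult.IH show ?thesis by (simp add: \<phi>_scale mult.commute[of _ "const c"])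
        next
          case 3
          then show ?thesis
            using mult.hyps by (intro \<phi>_mult[of _ _ i "d - i"] in_A is_form_component) auto
        qed
      qed
      then show ?case by (simp add: component_mult \<phi>_sum)
    qed
    then have "\<phi> (component d T) = 0" using T(1) gen by blast
    with T show False using component_of_form[OF T(2), of d] by simp
  qed
qed

section \<open>Linear substitutions\<close>

text \<open>
  The substitution of linear forms by which a matrix acts. It reverses products, but a group element and
  its inverse have the same fixed polynomials.
\<close>

definition matrix_subst :: "nat \<Rightarrow> 'f::field mat \<Rightarrow> 'f mpoly \<Rightarrow> 'f mpoly" where
  "matrix_subst n A = subst (\<lambda>i. \<Sum>j<n. const (A $$ (i, j)) * var j)"

lemma poly_act_eq_matrix_subst: "poly_act G n \<rho> g = matrix_subst n (\<rho> (inv\<^bsub>G\<^esub> g))"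
  by (simp add: poly_act_def matrix_subst_def)

lemma matrix_subst_hom: "comm_ring_hom (matrix_subst n A)"
  unfolding matrix_subst_def by (rule subst_hom)

lemma matrix_subst_const: "matrix_subst n A (const c) = const c"
  by (simp add: matrix_subst_def)

lemma matrix_subst_in: "f \<in> poly_ring n \<Longrightarrow> matrix_subst n A f \<in> poly_ring n"
  by (rule hom_in_poly_ring[OF matrix_subst_hom])
    (auto simp: matrix_subst_def intro!: poly_ring_sum poly_ring_mult)

lemma is_form_matrix_subst: "is_form d f \<Longrightarrow> is_form d (matrix_subst n A f)"
  unfolding matrix_subst_def
  by (erule is_form_subst) (intro is_form_sum is_form_mult_const is_form_var)

lemma matrix_subst_mult:
  assumes A: "A \<in> carrier_mat n n" and B: "B \<in> carrier_mat n n" and f: "f \<in> poly_ring n"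
  shows "matrix_subst n A (matrix_subst n B f) = matrix_subst n (B * A) f"
proof (rule hom_eq_on_poly_ring[OF _ matrix_subst_hom _ _ f])
  interpret A: comm_ring_hom "matrix_subst n A" by (rule matrix_subst_hom)
  interpret const: comm_ring_hom "const :: 'a \<Rightarrow> 'a mpoly" by (rule const_hom)
  show "comm_ring_hom (\<lambda>f. matrix_subst n A (matrix_subst n B f))"
    by (rule comm_ring_hom_compose[OF matrix_subst_hom matrix_subst_hom])
  fix i assume "i < n"
  have "matrix_subst n A (matrix_subst n B (var i)) =
    (\<Sum>j<n. \<Sum>k<n. const (B $$ (i, j) * A $$ (j, k)) * var k)"
    by (simp add: matrix_subst_def[of n B] A.hom_sum A.hom_mult matrix_subst_const)
      (simp add: matrix_subst_def sum_distrib_left const.hom_mult mult.assoc)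
  also have "\<dots> = (\<Sum>k<n. const (\<Sum>j<n. B $$ (i, j) * A $$ (j, k)) * var k)"
    by (subst sum.swap) (simp add: const.hom_sum sum_distrib_right)
  also have "\<dots> = (\<Sum>k<n. const ((B * A) $$ (i, k)) * var k)"
    using A B \<open>i < n\<close>
    by (intro sum.cong refl arg_cong[of _ _ "\<lambda>c. const c * _"])
      (auto simp: scalar_prod_def atLeast0LessThan intro!: sum.cong)
  finally show "matrix_subst n A (matrix_subst n B (var i)) = matrix_subst n (B * A) (var i)"
    by (simp add: matrix_subst_def)
qed (simp_all add: matrix_subst_const)

lemma matrix_subst_one:
  assumes "f \<in> poly_ring n" shows "matrix_subst n (1\<^sub>m n) f = f"
proof (rule hom_eq_on_poly_ring[OF matrix_subst_hom _ _ _ assms])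
  show "comm_ring_hom (\<lambda>f::'a mpoly. f)" by standard simp_all
  fix i assume "i < n"
  have "(\<Sum>j<n. const ((1\<^sub>m n :: 'a mat) $$ (i, j)) * var j) = (\<Sum>j<n. if j = i then var j else 0)"
    using \<open>i < n\<close> by (intro sum.cong) auto
  then show "matrix_subst n (1\<^sub>m n :: 'a mat) (var i) = var i"
    using \<open>i < n\<close> by (simp add: matrix_subst_def)
qed (simp add: matrix_subst_const)

lemma alg_generated_image:
  assumes "comm_ring_hom h" and const: "\<And>c. h (const c) = const c"
  shows "alg_generated (h ` B) = h ` alg_generated B"
proof
  interpret h: comm_ring_hom h by fact
  show "alg_generated (h ` B) \<subseteq> h ` alg_generated B"
  proof
    fix f assume "f \<in> alg_generated (h ` B)"
    then show "f \<in> h ` alg_generated B"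
    proof induction
      case (const c)
      show ?case using assms(2)[of c] alg_generated.const[of c B] by (metis imageI)
    next
      case (gen b)
      then show ?case using alg_generated.gen by blast
    next
      case (add f g)
      then show ?case by (auto simp flip: h.hom_add intro: alg_generated.add)
    next
      case (mult f g)
      then show ?case by (auto simp flip: h.hom_mult intro: alg_generated.mult)
    qed
  qed
  show "h ` alg_generated B \<subseteq> alg_generated (h ` B)"
  proof
    fix f assume "f \<in> h ` alg_generated B"
    then obtain g where "g \<in> alg_generated B" "f = h g" by blast
    from this(1) have "h g \<in> alg_generated (h ` B)"
      by induction (auto simp: const h.hom_add h.hom_mult intro: alg_generated.intros)
    with \<open>f = h g\<close> show "f \<in> alg_generated (h ` B)" by simp
  qed
qed

text \<open>
  The elements of the group fixing \<open>f\<close> form a subgroup, so it suffices to test a generator; and the generator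
  may act through its own matrix instead of the matrix of its inverse.
\<close>

lemma invariant_ring_cyclic:
  fixes \<rho> :: "'g \<Rightarrow> 'f::field mat"
  assumes "group G" and rep: "representation G n \<rho>" and g: "g \<in> carrier G" "generate G {g} = carrier G"
  shows "invariant_ring G n \<rho> = {f \<in> poly_ring n. matrix_subst n (\<rho> g) f = f}"
proof -
  interpret group G by fact
  let ?R = "ring_mat TYPE('f) n ()"
  interpret R: ring ?R by (rule ring_mat)
  have \<rho>: "\<rho> \<in> hom G (units_of ?R)" using rep by (simp add: representation_def)
  have carr: "\<rho> h \<in> carrier_mat n n" if "h \<in> carrier G" for h
    using hom_carrier[OF \<rho>] that by (auto simp: units_of_carrier Units_def ring_mat_simps)
  have mult: "\<rho> (h \<otimes>\<^bsub>G\<^esub> k) = \<rho> h * \<rho> k" if "h \<in> carrier G" "k \<in> carrier G" for h k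
    using hom_mult[OF \<rho> that] by (simp add: units_of_mult ring_mat_simps)
  have one: "\<rho> \<one>\<^bsub>G\<^esub> = 1\<^sub>m n"
    using hom_one[OF \<rho> group_axioms R.units_group] by (simp add: units_of_one ring_mat_simps)
  have inv_fix: "matrix_subst n (\<rho> (inv\<^bsub>G\<^esub> h)) f = f"
    if "h \<in> carrier G" "f \<in> poly_ring n" "matrix_subst n (\<rho> h) f = f" for h f
  proof -
    have "matrix_subst n (\<rho> (inv\<^bsub>G\<^esub> h)) f = matrix_subst n (\<rho> (inv\<^bsub>G\<^esub> h)) (matrix_subst n (\<rho> h) f)"
      using that by simp
    also have "\<dots> = matrix_subst n (\<rho> h * \<rho> (inv\<^bsub>G\<^esub> h)) f"
      using that carr by (intro matrix_subst_mult) auto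
    also have "\<rho> h * \<rho> (inv\<^bsub>G\<^esub> h) = 1\<^sub>m n" using mult[of h "inv\<^bsub>G\<^esub> h"] one that by simp
    finally show ?thesis using that by (simp add: matrix_subst_one)
  qed
  show ?thesis
  proof (intro equalityI subsetI)
    fix f assume "f \<in> invariant_ring G n \<rho>"
    then have "f \<in> poly_ring n" "poly_act G n \<rho> (inv\<^bsub>G\<^esub> g) f = f"
      using g by (auto simp: invariant_ring_def)
    then show "f \<in> {f \<in> poly_ring n. matrix_subst n (\<rho> g) f = f}"
      using g by (simp add: poly_act_eq_matrix_subst)
  next
    fix f assume "f \<in> {f \<in> poly_ring n. matrix_subst n (\<rho> g) f = f}"
    then have f: "f \<in> poly_ring n" "matrix_subst n (\<rho> g) f = f" by auto
    have "h \<in> carrier G \<and> matrix_subst n (\<rho> h) f = f" if "h \<in> generate G {g}" for h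
      using that
    proof induction
      case one
      show ?case using f(1) by (simp add: \<open>\<rho> \<one>\<^bsub>G\<^esub> = 1\<^sub>m n\<close> matrix_subst_one)
    next
      case (incl h)
      then show ?case using f g by simp
    next
      case (inv h)
      then show ?case using f g inv_fix[of g f] by simp
    next
      case (eng h k)
      then have "matrix_subst n (\<rho> h * \<rho> k) f = matrix_subst n (\<rho> k) (matrix_subst n (\<rho> h) f)"
        using carr f by (intro matrix_subst_mult[symmetric]) auto
      with eng show ?case by (simp add: mult)
    qed
    then have "matrix_subst n (\<rho> h) f = f" if "h \<in> carrier G" for h using that g(2) by blast
    then show "f \<in> invariant_ring G n \<rho>"
      using f(1) by (simp add: invariant_ring_def poly_act_eq_matrix_subst)
  qed
qed

section \<open>Shifting the variable of a univariate polynomial\<close>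

text \<open>
  The two leading coefficients of a translate are those of its Taylor expansion. They drive both inductions
  on degrees below: the one in \<open>z\<close> for the subgroup of order \<open>p\<close>, and the one in \<open>N\<close> for the quotient.
\<close>

lemma coeff_pcompose_shift:
  fixes q :: "'a::comm_ring_1 poly"
  shows "degree q \<le> m \<Longrightarrow> coeff (pcompose q [:c, 1:]) m = coeff q m"
    and "degree q \<le> Suc m \<Longrightarrow>
      coeff (pcompose q [:c, 1:]) m = coeff q m + of_nat (Suc m) * c * coeff q (Suc m)"
proof -
  have mult: "coeff ([:c, 1:] * g) (Suc k) = c * coeff g (Suc k) + coeff g k" for g :: "'a poly" and k
    by (simp add: coeff_pCons mult_pCons_left)
  have mult0: "coeff ([:c, 1:] * g) 0 = c * coeff g 0" for g :: "'a poly"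
    by (simp add: coeff_mult_0)
  have "(degree q \<le> m \<longrightarrow> coeff (pcompose q [:c, 1:]) m = coeff q m) \<and>
    (degree q \<le> Suc m \<longrightarrow>
      coeff (pcompose q [:c, 1:]) m = coeff q m + of_nat (Suc m) * c * coeff q (Suc m))"
  proof (induction q arbitrary: m)
    case (pCons a q)
    show ?case
    proof (intro conjI impI)
      assume deg: "degree (pCons a q) \<le> m"
      show "coeff (pcompose (pCons a q) [:c, 1:]) m = coeff (pCons a q) m"
      proof (cases m)
        case 0
        with deg have "q = 0" by (auto split: if_splits)
        with 0 show ?thesis by (simp add: pcompose_pCons)
      next
        case (Suc k)
        with deg have "degree q \<le> k" by (auto split: if_splits)
        with pCons.IH[of k] pCons.IH[of m] Suc show ?thesis
          by (simp add: pcompose_pCons mult coeff_eq_0)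
      qed
    next
      assume deg: "degree (pCons a q) \<le> Suc m"
      then have q: "degree q \<le> m" by (auto split: if_splits)
      show "coeff (pcompose (pCons a q) [:c, 1:]) m =
        coeff (pCons a q) m + of_nat (Suc m) * c * coeff (pCons a q) (Suc m)"
      proof (cases m)
        case 0
        with pCons.IH[of 0] q show ?thesis by (simp add: pcompose_pCons mult0)
      next
        case (Suc k)
        with pCons.IH[of k] pCons.IH[of m] q show ?thesis
          by (simp add: pcompose_pCons mult algebra_simps)
      qed
    qed
  qed simp
  then show "degree q \<le> m \<Longrightarrow> coeff (pcompose q [:c, 1:]) m = coeff q m"
    and "degree q \<le> Suc m \<Longrightarrow>
      coeff (pcompose q [:c, 1:]) m = coeff q m + of_nat (Suc m) * c * coeff q (Suc m)"
    by blast+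
qed

definition coeffs_in :: "'a::comm_ring_1 set \<Rightarrow> 'a poly set" where
  "coeffs_in U = {q. \<forall>i. coeff q i \<in> U}"

text \<open>
  A subring is needed as a set of coefficients, because the polynomials in the first variables form a subset
  of the type of all polynomials.
\<close>

locale subring_set =
  fixes U :: "'a::comm_ring_1 set"
  assumes zero [simp]: "0 \<in> U" and one [simp]: "1 \<in> U"
    and add [simp]: "a \<in> U \<Longrightarrow> b \<in> U \<Longrightarrow> a + b \<in> U"
    and mult [simp]: "a \<in> U \<Longrightarrow> b \<in> U \<Longrightarrow> a * b \<in> U"
    and uminus [simp]: "a \<in> U \<Longrightarrow> - a \<in> U"
begin

lemma sum_in: "(\<And>i. i \<in> I \<Longrightarrow> f i \<in> U) \<Longrightarrow> sum f I \<in> U"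
  by (induction I rule: infinite_finite_induct) simp_all

lemma coeffs_in_0 [simp]: "0 \<in> coeffs_in U"
  and coeffs_in_1 [simp]: "1 \<in> coeffs_in U"
  and coeffs_in_add [simp]: "q \<in> coeffs_in U \<Longrightarrow> r \<in> coeffs_in U \<Longrightarrow> q + r \<in> coeffs_in U"
  and coeffs_in_uminus [simp]: "q \<in> coeffs_in U \<Longrightarrow> - q \<in> coeffs_in U"
  and coeffs_in_smult [simp]: "a \<in> U \<Longrightarrow> q \<in> coeffs_in U \<Longrightarrow> Polynomial.smult a q \<in> coeffs_in U"
  and coeffs_in_pCons [simp]: "a \<in> U \<Longrightarrow> q \<in> coeffs_in U \<Longrightarrow> pCons a q \<in> coeffs_in U"
  and coeffs_in_monom [simp]: "a \<in> U \<Longrightarrow> monom a n \<in> coeffs_in U"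
  by (auto simp: coeffs_in_def coeff_pCons coeff_monom split: nat.splits)

lemma coeffs_in_diff [simp]: "q \<in> coeffs_in U \<Longrightarrow> r \<in> coeffs_in U \<Longrightarrow> q - r \<in> coeffs_in U"
  using coeffs_in_add[of q "- r"] by simp

lemma coeffs_in_mult [simp]: "q \<in> coeffs_in U \<Longrightarrow> r \<in> coeffs_in U \<Longrightarrow> q * r \<in> coeffs_in U"
  by (auto simp: coeffs_in_def coeff_mult intro!: sum_in)

lemma coeffs_in_power [simp]: "q \<in> coeffs_in U \<Longrightarrow> q ^ n \<in> coeffs_in U"
  by (induction n) simp_all

lemma coeffs_in_sum: "(\<And>i. i \<in> I \<Longrightarrow> f i \<in> coeffs_in U) \<Longrightarrow> sum f I \<in> coeffs_in U"
  by (induction I rule: infinite_finite_induct) simp_all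

lemma coeffs_in_prod: "(\<And>i. i \<in> I \<Longrightarrow> f i \<in> coeffs_in U) \<Longrightarrow> prod f I \<in> coeffs_in U"
  by (induction I rule: infinite_finite_induct) simp_all

lemma coeffs_in_pcompose:
  assumes "q \<in> coeffs_in U" and "r \<in> coeffs_in U"
  shows "pcompose q r \<in> coeffs_in U"
  using assms(1)
proof (induction q)
  case (pCons a q)
  then have "coeff (pCons a q) i \<in> U" for i by (auto simp: coeffs_in_def)
  from this[of 0] this[of "Suc i" for i] have "a \<in> U" "q \<in> coeffs_in U"
    by (auto simp: coeffs_in_def)
  with pCons.IH assms(2) show ?case by (simp add: pcompose_pCons)
qed simp

lemma coeff_in: "q \<in> coeffs_in U \<Longrightarrow> coeff q i \<in> U"
  by (simp add: coeffs_in_def)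

end

text \<open>
  Over a domain of characteristic \<open>p\<close>, this is the additive polynomial whose roots are the multiples of \<open>c\<close> by
  the elements of the prime field.
\<close>

definition artin_schreier :: "nat \<Rightarrow> 'a::comm_ring_1 \<Rightarrow> 'a poly" where
  "artin_schreier p c = monom 1 p - monom (c ^ (p - 1)) 1"

lemma degree_artin_schreier:
  assumes "p > 1" shows "degree (artin_schreier p (c::'a::comm_ring_1)) = p"
proof (rule antisym)
  show "degree (artin_schreier p c) \<le> p"
    by (rule degree_le) (use assms in \<open>auto simp: artin_schreier_def\<close>)
  show "p \<le> degree (artin_schreier p c)"
    by (rule le_degree) (use assms in \<open>simp add: artin_schreier_def\<close>)
qed

lemma lead_coeff_artin_schreier:
  "p > 1 \<Longrightarrow> coeff (artin_schreier p c) p = 1"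
  by (simp add: artin_schreier_def)

lemma poly_artin_schreier: "poly (artin_schreier p c) a = a ^ p - c ^ (p - 1) * a"
  by (simp add: artin_schreier_def poly_monom)

lemma artin_schreier_shift:
  fixes c :: "'a::comm_ring_1"
  assumes "prime p" and "CHAR('a) = p"
  shows "pcompose (artin_schreier p c) [:c, 1:] = artin_schreier p c"
proof -
  have "p > 0" using assms(1) prime_gt_0_nat by blast
  have mon: "pcompose (monom b n) [:c, 1:] = Polynomial.smult b ([:c, 1:] ^ n)" for b n
  proof -
    have "monom b n = Polynomial.smult b ([:0, 1:] ^ n)" by (simp add: monom_altdef)
    moreover have "pcompose ([:0, 1:] ^ n) [:c, 1:] = [:c, 1:] ^ n"
      by (induction n) (simp_all add: pcompose_mult pcompose_1 pcompose_pCons)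
    ultimately show ?thesis by (simp add: pcompose_smult)
  qed
  have "[:c, 1:] ^ p = ([:c:] + [:0, 1:]) ^ p" by simp
  also have "\<dots> = [:c:] ^ p + [:0, 1:] ^ p"
    by (rule freshmans_dream) (use assms in auto)
  also have "\<dots> = [:c ^ p:] + monom 1 p" by (simp add: poly_const_pow monom_altdef)
  finally have "pcompose (artin_schreier p c) [:c, 1:] =
      [:c ^ p:] + monom 1 p - Polynomial.smult (c ^ (p - 1)) [:c, 1:]"
    by (simp add: artin_schreier_def pcompose_diff mon)
  also have "Polynomial.smult (c ^ (p - 1)) [:c, 1:] = [:c ^ p:] + monom (c ^ (p - 1)) 1"
  proof -
    have "c ^ (p - 1) * c = c ^ p" using \<open>p > 0\<close> by (metis power_minus_mult)
    then show ?thesis by (simp add: monom_Suc monom_0)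
  qed
  finally show ?thesis by (simp add: artin_schreier_def)
qed

text \<open>
  The leading coefficients of an invariant polynomial show that its degree is divisible by \<open>p\<close>, so
  that its leading term can be removed by a power of the Artin-Schreier polynomial.
\<close>

lemma shift_invariant_imp_pcompose_artin_schreier:
  fixes q :: "'a::idom poly"
  assumes U: "subring_set U" and c: "c \<in> U" "c \<noteq> 0" and p: "prime p" "CHAR('a) = p"
    and q: "q \<in> coeffs_in U" "pcompose q [:c, 1:] = q"
  shows "\<exists>g\<in>coeffs_in U. q = pcompose g (artin_schreier p c)"
proof -
  interpret subring_set U by fact
  let ?P = "artin_schreier p c"
  have "p > 1" using p prime_gt_1_nat by blast
  have c_pow: "c ^ k \<in> U" for k by (induction k) (simp_all add: c)
  have P_U: "?P \<in> coeffs_in U" unfolding artin_schreier_def by (simp add: c_pow)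
  have "\<exists>g\<in>coeffs_in U. q = pcompose g ?P"
    if "\<And>i. i \<ge> n \<Longrightarrow> coeff q i = 0" "q \<in> coeffs_in U" "pcompose q [:c, 1:] = q" for n q
    using that
  proof (induction n arbitrary: q)
    case 0
    then have "q = 0" by (intro poly_eqI) simp
    then show ?case by (intro bexI[of _ 0]) simp_all
  next
    case (Suc n)
    define a where "a = coeff q n"
    have a: "a \<in> U" using Suc.prems(2) by (simp add: a_def coeff_in)
    have deg: "degree q \<le> n" by (rule degree_le) (use Suc.prems(1) in auto)
    have "a = 0 \<or> p dvd n"
    proof (cases n)
      case (Suc m)
      have "coeff q m = coeff q m + of_nat n * c * a"
        using coeff_pcompose_shift(2)[of q m c] deg Suc \<open>pcompose q [:c, 1:] = q\<close>
        by (simp add: a_def)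
      then have "of_nat n * c * a = 0" by simp
      then have "of_nat n = (0::'a) \<or> a = 0" using c(2) by simp
      then show ?thesis using p(2) by (simp only: of_nat_eq_0_iff_char_dvd) auto
    qed simp
    then obtain k where k: "a = 0 \<or> n = p * k" by (auto elim: dvdE)
    let ?q = "q - Polynomial.smult a (?P ^ k)"
    have "coeff ?q i = 0" if "i \<ge> n" for i
    proof (cases "a = 0")
      case True
      then show ?thesis using Suc.prems(1)[of i] that by (cases "i = n") (auto simp: a_def)
    next
      case False
      with k have n: "n = p * k" by simp
      have "?P \<noteq> 0" using lead_coeff_artin_schreier[OF \<open>p > 1\<close>, of c] by auto
      then have degP: "degree (?P ^ k) = n"
        by (simp add: n degree_power_eq degree_artin_schreier[OF \<open>p > 1\<close>])
      moreover have "coeff (?P ^ k) n = 1"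
        using degP lead_coeff_power[of ?P k] \<open>p > 1\<close>
        by (simp add: degree_artin_schreier lead_coeff_artin_schreier)
      ultimately show ?thesis
        using that Suc.prems(1)[of i] by (cases "i = n") (auto simp: a_def coeff_eq_0)
    qed
    moreover have "?q \<in> coeffs_in U" using Suc.prems(2) a P_U by simp
    moreover have "pcompose ?q [:c, 1:] = ?q"
    proof -
      have "pcompose (?P ^ k) [:c, 1:] = ?P ^ k"
        by (induction k) (simp_all add: pcompose_1 pcompose_mult artin_schreier_shift[OF p])
      then show ?thesis using Suc.prems(3) by (simp add: pcompose_diff pcompose_smult)
    qed
    ultimately obtain g where g: "g \<in> coeffs_in U" "?q = pcompose g ?P"
      using Suc.IH by blast
    have "pcompose (monom 1 k) ?P = ?P ^ k"
    proof (induction k)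
      case (Suc k)
      then show ?case by (simp add: monom_Suc pcompose_pCons)
    qed (simp add: pcompose_1)
    then have "pcompose (monom a k) ?P = Polynomial.smult a (?P ^ k)"
      by (metis mult.right_neutral pcompose_smult smult_monom)
    with g have "q = pcompose (g + monom a k) ?P" by (simp add: pcompose_add algebra_simps)
    moreover have "g + monom a k \<in> coeffs_in U" using g a by simp
    ultimately show ?case by blast
  qed
  from this[of "Suc (degree q)" q] q show ?thesis by (simp add: coeff_eq_0)
qed

section \<open>Congruences modulo an ideal\<close>

lemma first_order_expansion:
  fixes a b :: "'a::comm_ring_1"
  shows "\<exists>r. (a + b) ^ Suc n = a ^ Suc n + of_nat (Suc n) * a ^ n * b + b ^ 2 * r"
proof (induction n)
  case 0
  show ?case by (rule exI[of _ 0]) simp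
next
  case (Suc n)
  then obtain r where r: "(a + b) ^ Suc n = a ^ Suc n + of_nat (Suc n) * a ^ n * b + b ^ 2 * r" by blast
  have "(a + b) ^ Suc (Suc n) = (a + b) * (a ^ Suc n + of_nat (Suc n) * a ^ n * b + b ^ 2 * r)"
    by (simp only: power_Suc[of "a + b" "Suc n"] r)
  also have "\<dots> = a ^ Suc (Suc n) + of_nat (Suc (Suc n)) * a ^ Suc n * b +
      b ^ 2 * (of_nat (Suc n) * a ^ n + (a + b) * r)"
    by (simp add: algebra_simps power2_eq_square)
  finally show ?case by blast
qed

locale ring_ideal =
  fixes J :: "'a::comm_ring_1 set"
  assumes zero [simp]: "0 \<in> J" and add: "a \<in> J \<Longrightarrow> b \<in> J \<Longrightarrow> a + b \<in> J"
    and mult: "a \<in> J \<Longrightarrow> c * a \<in> J"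
begin

lemma sum: "(\<And>i. i \<in> I \<Longrightarrow> f i \<in> J) \<Longrightarrow> sum f I \<in> J"
  by (induction I rule: infinite_finite_induct) (simp_all add: add)

lemma cong_mult: "a - a' \<in> J \<Longrightarrow> b - b' \<in> J \<Longrightarrow> a * b - a' * b' \<in> J"
proof -
  assume "a - a' \<in> J" "b - b' \<in> J"
  then have "b * (a - a') + a' * (b - b') \<in> J" by (intro add mult)
  then show ?thesis by (simp add: algebra_simps)
qed

lemma cong_power: "a - a' \<in> J \<Longrightarrow> a ^ n - a' ^ n \<in> J"
  by (induction n) (simp_all add: cong_mult)

lemma cong_prod: "(\<And>i. i \<in> I \<Longrightarrow> f i - g i \<in> J) \<Longrightarrow> prod f I - prod g I \<in> J"
  by (induction I rule: infinite_finite_induct) (simp_all add: cong_mult)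

end

text \<open>
  The error term in the expansion of one summand of the transfer, with its factor \<open>L^2\<close> made explicit.
\<close>

lemma leading_term_difference: fixes t L :: "'a::comm_ring_1" shows
 "(t + L ^ 2 * r) * (l * k * (a + b * (3 * K * L) + (3 * K * L) ^ 2 * q)) - (k * a + (k * K) * (b * 3) * L) * (t * l) =
        (r * (k * (a + b * (3 * K * L) + (3 * K * L) ^ 2 * q)) + t * k * (9 * K ^ 2 * q)) * (l * L ^ 2)"
proof -
  define w where "w = a + b * (3 * K * L) + (3 * K * L) ^ 2 * q"
  have "(3 * K * L) ^ 2 = 9 * K ^ 2 * L ^ 2" by (simp add: power_mult_distrib)
  then have "k * w = (k * a + (k * K) * (b * 3) * L) + k * (9 * K ^ 2 * q) * L ^ 2"
    by (simp add: w_def algebra_simps)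
  then have V: "k * a + (k * K) * (b * 3) * L = k * w - k * (9 * K ^ 2 * q) * L ^ 2" by simp
  have "(t + L ^ 2 * r) * (l * k * w) - (k * w - k * z * L ^ 2) * (t * l) = (r * (k * w) + t * k * z) * (l * L ^ 2)" for z
    by (simp add: algebra_simps)
  then show ?thesis unfolding V w_def[symmetric] .
qed

type_synonym 'a poly3 = "'a poly poly poly"

section \<open>The normal form of the action\<close>

lemma funpow_hom:
  fixes f :: "'a::comm_ring_1 \<Rightarrow> 'a"
  shows "comm_ring_hom f \<Longrightarrow> comm_ring_hom (f ^^ k)"
proof (induction k)
  case 0
  show ?case by standard simp_all
next
  case (Suc k)
  then show ?case using comm_ring_hom_compose[of f "f ^^ k"] by (simp add: o_def)
qed

text \<open>
  In these coordinates a generator of the group acts by \<open>\<sigma>\<close>. The indices of the variables \<open>y i\<close> are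
  read modulo \<open>p\<close>, and \<open>z\<close> is the coordinate that is not fixed by the subgroup of order \<open>p\<close>. The
  type argument only fixes the field.
\<close>

locale normal_form =
  fixes p :: nat and field_type :: "'f::field itself"
  assumes prime_p: "prime p" and p_gt_2: "p > 2" and char_p: "CHAR('f) = p"
begin

lemma p_pos [simp]: "p > 0" and p_gt_1: "p > 1" using p_gt_2 by auto

lemma char_mpoly: "CHAR('f mpoly) = p" by (simp add: CHAR_mpoly char_p)

lemma of_nat_eq_0: "of_nat k = (0::'f) \<longleftrightarrow> p dvd k"
  using of_nat_eq_0_iff_char_dvd[where ?'a = 'f] char_p by simp

abbreviation S :: "'f mpoly set" where "S \<equiv> poly_ring p"
abbreviation R :: "'f mpoly set" where "R \<equiv> poly_ring (Suc p)"

definition y :: "nat \<Rightarrow> 'f mpoly" where "y i = var (i mod p)"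
definition z :: "'f mpoly" where "z = var p"

definition \<sigma> :: "'f mpoly \<Rightarrow> 'f mpoly" where
  "\<sigma> = subst (\<lambda>i. if i < p then y (Suc i) else if i = p then z + y 0 else var i)"

sublocale sigma: comm_ring_hom \<sigma>
  unfolding \<sigma>_def by (rule subst_hom)

sublocale sigma_pow: comm_ring_hom "\<sigma> ^^ k" for k
  by (rule funpow_hom) (rule sigma.comm_ring_hom_axioms)

sublocale S: subring_set S by unfold_locales simp_all

lemma S_subset_R: "f \<in> S \<Longrightarrow> f \<in> R" by (rule poly_ring_mono) auto

lemma y_in_S [simp]: "y i \<in> S" by (simp add: y_def)
lemma z_in_R [simp]: "z \<in> R" by (simp add: z_def)

lemma y_period [simp]: "y (i + p) = y i" "y (p + i) = y i" by (simp_all add: y_def)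

lemma sigma_const [simp]: "\<sigma> (const c) = const c" by (simp add: \<sigma>_def)
lemma sigma_pow_const [simp]: "(\<sigma> ^^ k) (const c) = const c" by (induction k) simp_all

lemma sigma_y [simp]: "\<sigma> (y i) = y (Suc i)"
  by (simp add: \<sigma>_def y_def mod_Suc_eq)

lemma sigma_pow_y [simp]: "(\<sigma> ^^ k) (y i) = y (i + k)"
  by (induction k) simp_all

lemma sigma_z [simp]: "\<sigma> z = z + y 0" by (simp add: \<sigma>_def z_def)

lemma sigma_pow_z: "(\<sigma> ^^ k) z = z + (\<Sum>i<k. y i)"
proof (induction k)
  case (Suc k)
  have "(\<Sum>i<Suc k. y i) = y 0 + (\<Sum>i<k. y (Suc i))" by (rule sum.lessThan_Suc_shift)
  with Suc show ?case by (simp add: sigma.hom_add sigma.hom_sum)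
qed simp

lemma sigma_in_S: "f \<in> S \<Longrightarrow> \<sigma> f \<in> S"
  by (rule hom_in_poly_ring[OF sigma.comm_ring_hom_axioms]) (auto simp: \<sigma>_def)

lemma sigma_in_R: "f \<in> R \<Longrightarrow> \<sigma> f \<in> R"
  by (rule hom_in_poly_ring[OF sigma.comm_ring_hom_axioms])
    (auto simp: \<sigma>_def less_Suc_eq S_subset_R)

lemma sigma_pow_in_S: "f \<in> S \<Longrightarrow> (\<sigma> ^^ k) f \<in> S"
  by (induction k) (simp_all add: sigma_in_S)

lemma sigma_pow_in_R: "f \<in> R \<Longrightarrow> (\<sigma> ^^ k) f \<in> R"
  by (induction k) (simp_all add: sigma_in_R)

lemma sigma_pow_fixed: "\<sigma> f = f \<Longrightarrow> (\<sigma> ^^ k) f = f"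
  by (induction k) simp_all

lemma sigma_pow_p_S: "f \<in> S \<Longrightarrow> (\<sigma> ^^ p) f = f"
proof (rule hom_eq_on_poly_ring[of _ "\<lambda>f. f" p])
  show "comm_ring_hom (\<lambda>f::'f mpoly. f)" by standard simp_all
  show "(\<sigma> ^^ p) (var i) = var i" if "i < p" for i
    using sigma_pow_y[of p i] that by (simp add: y_def)
qed (simp_all add: sigma_pow.comm_ring_hom_axioms)

lemma sum_cyclic_shift: "(\<Sum>i<p. h (Suc i)) = (\<Sum>i<p. h i)" if "h p = h 0" for h :: "nat \<Rightarrow> 'a::ab_group_add"
proof -
  have "h 0 + (\<Sum>i<p. h (Suc i)) = (\<Sum>i<Suc p. h i)" by (rule sum.lessThan_Suc_shift[symmetric])
  also have "\<dots> = (\<Sum>i<p. h i) + h 0" using that by simp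
  finally show ?thesis by (simp add: add.commute)
qed

lemma prod_cyclic_shift: "(\<Prod>i<p. h (Suc i)) = (\<Prod>i<p. h i)" if "h p = h 0" for h :: "nat \<Rightarrow> 'a::comm_ring_1"
proof -
  have "{..<p} = insert 0 {1..<p}" "{1..<Suc p} = insert p {1..<p}" using p_gt_1 by auto
  moreover have "(\<Prod>i<p. h (Suc i)) = prod h {1..<Suc p}"
    by (rule prod.reindex_bij_witness[of _ "\<lambda>i. i - 1" Suc]) auto
  ultimately show ?thesis using that by simp
qed

definition s :: "'f mpoly" where "s = (\<Sum>i<p. y i)"
definition e :: "'f mpoly" where "e = (\<Prod>i<p. y i)"
definition M :: "nat \<Rightarrow> 'f mpoly" where "M i = y i ^ p - s ^ (p - 1) * y i"
definition N :: "'f mpoly" where "N = z ^ p - s ^ (p - 1) * z"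
definition norm_N :: "'f mpoly" where "norm_N = (\<Prod>k<p. (\<sigma> ^^ k) N)"
definition tr :: "'f mpoly \<Rightarrow> 'f mpoly" where "tr f = (\<Sum>k<p. (\<sigma> ^^ k) f)"

lemma s_in_S [simp]: "s \<in> S" by (simp add: s_def)
lemma e_in_S [simp]: "e \<in> S" by (simp add: e_def)
lemma M_in_S [simp]: "M i \<in> S" by (simp add: M_def)
lemma N_in_R [simp]: "N \<in> R" using S_subset_R[OF s_in_S] by (simp add: N_def)

lemma sigma_s [simp]: "\<sigma> s = s"
  unfolding s_def sigma.hom_sum using sum_cyclic_shift[of y] y_period(2)[of 0] by simp

lemma sigma_e [simp]: "\<sigma> e = e"
  unfolding e_def sigma.hom_prod using prod_cyclic_shift[of y] y_period(2)[of 0] by simp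

lemma frobenius: "(f + g) ^ p = f ^ p + g ^ p" for f g :: "'f mpoly"
  by (rule freshmans_dream) (simp_all add: char_mpoly prime_p)

lemma frobenius_sum: "sum f I ^ p = (\<Sum>i\<in>I. f i ^ p)" for f :: "'i \<Rightarrow> 'f mpoly"
  by (rule freshmans_dream_sum) (simp_all add: char_mpoly prime_p)

lemma sigma_pow_N: "(\<sigma> ^^ k) N = N + (\<Sum>i<k. M i)"
proof -
  have "(\<sigma> ^^ k) N = (z + (\<Sum>i<k. y i)) ^ p - s ^ (p - 1) * (z + (\<Sum>i<k. y i))"
    by (simp add: N_def sigma_pow.hom_minus sigma_pow.hom_mult sigma_pow.hom_power
        sigma_pow_z sigma_pow_fixed)
  also have "\<dots> = N + (\<Sum>i<k. M i)"
    by (simp add: frobenius frobenius_sum N_def M_def sum_subtractf ring_distribs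
        sum_distrib_left[symmetric])
  finally show ?thesis .
qed

lemma s_pow: "s ^ (p - 1) * s = s ^ p"
  by (metis p_pos power_minus_mult)

text \<open>
  The \<open>M i\<close> sum to \<open>s^p - s^(p-1) s = 0\<close>, since the Frobenius map is additive.
\<close>

lemma sigma_pow_p_N: "(\<sigma> ^^ p) N = N"
proof -
  have "(\<Sum>i<p. M i) = s ^ p - s ^ (p - 1) * s"
    by (simp add: M_def sum_subtractf s_def frobenius_sum sum_distrib_left)
  then have "(\<Sum>i<p. M i) = 0" by (simp only: s_pow diff_self)
  then show ?thesis by (simp add: sigma_pow_N)
qed

lemma sigma_N: "\<sigma> N = N + M 0"
  using sigma_pow_N[of 1] by simp

lemma sigma_norm_N [simp]: "\<sigma> norm_N = norm_N"
  unfolding norm_N_def sigma.hom_prod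
  using prod_cyclic_shift[of "\<lambda>k. (\<sigma> ^^ k) N"] sigma_pow_p_N by simp

lemma tr_add: "tr (f + g) = tr f + tr g"
  by (simp add: tr_def sigma_pow.hom_add sum.distrib)

lemma tr_0 [simp]: "tr 0 = 0"
  by (simp add: tr_def)

lemma tr_sum: "tr (sum f I) = (\<Sum>i\<in>I. tr (f i))"
  by (induction I rule: infinite_finite_induct) (simp_all add: tr_add)

lemma tr_mult: "\<sigma> h = h \<Longrightarrow> tr (h * f) = h * tr f"
  by (simp add: tr_def sigma_pow.hom_mult sigma_pow_fixed sum_distrib_left)

lemma sigma_tr: "(\<sigma> ^^ p) f = f \<Longrightarrow> \<sigma> (tr f) = tr f"
  unfolding tr_def sigma.hom_sum using sum_cyclic_shift[of "\<lambda>k. (\<sigma> ^^ k) f"] by simp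

lemma tr_in_S: "f \<in> S \<Longrightarrow> tr f \<in> S"
  unfolding tr_def by (simp add: sigma_pow_in_S)

section \<open>Invariants of the subgroup of order \<open>p\<close>\<close>

text \<open>
  The element \<open>z\<close> is transcendental over \<open>S\<close>: a homomorphism to univariate polynomials over \<open>S\<close> that sends \<open>z\<close>
  to the variable recovers the coefficients.
\<close>

lemma coeffs_poly_z:
  assumes "q \<in> coeffs_in S" and "poly q z = 0"
  shows "q = 0"
proof -
  let ?v = "\<lambda>i. if i = p then [:0, 1:] else [:var i:] :: 'f mpoly poly"
  let ?\<Phi> = "evaluate (\<lambda>c. [:const c:]) ?v"
  have \<kappa>: "comm_ring_hom (\<lambda>c::'f. [:const c:])" by (intro pCons_hom const_hom)
  interpret \<Phi>: comm_ring_hom ?\<Phi> by (rule evaluate_hom[OF \<kappa>])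
  have "?\<Phi> a = [:a:]" if "a \<in> S" for a
  proof (rule hom_eq_on_poly_ring[OF _ _ _ _ that])
    show "comm_ring_hom (\<lambda>f::'f mpoly. [:f:])"
      by standard (simp_all add: one_pCons)
  qed (use \<kappa> in \<open>simp_all add: \<Phi>.comm_ring_hom_axioms\<close>)
  then have coeff: "?\<Phi> (coeff q i) = [:coeff q i:]" for i
    using assms(1) by (simp add: coeffs_in_def)
  have "?\<Phi> z = [:0, 1:]" by (simp add: z_def \<kappa>)
  then have "?\<Phi> (poly q z) = (\<Sum>i\<le>degree q. [:coeff q i:] * [:0, 1:] ^ i)"
    by (simp add: poly_altdef \<Phi>.hom_sum \<Phi>.hom_mult \<Phi>.hom_power coeff)
  also have "\<dots> = (\<Sum>i\<le>degree q. monom (coeff q i) i)"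
    by (simp add: monom_altdef)
  also have "\<dots> = q" by (rule poly_as_sum_of_monoms)
  finally show ?thesis using assms(2) by simp
qed

lemma R_eq_poly_z:
  assumes "f \<in> R" shows "\<exists>q\<in>coeffs_in S. f = poly q z"
  using assms
proof (induction rule: poly_ring_induct)
  case (const c)
  show ?case by (rule bexI[of _ "[:const c:]"]) simp_all
next
  case (var i)
  show ?case
  proof (cases "i = p")
    case True
    then show ?thesis by (intro bexI[of _ "[:0, 1:]"]) (simp_all add: z_def)
  next
    case False
    with var show ?thesis by (intro bexI[of _ "[:var i:]"]) simp_all
  qed
next
  case (add f g)
  then show ?case by (metis S.coeffs_in_add poly_add)
next
  case (mult f g)
  then show ?case by (metis S.coeffs_in_mult poly_mult)
qed

text \<open>
  The subring \<open>S[N]\<close>.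
\<close>

definition SN :: "'f mpoly set" where "SN = (\<lambda>q. poly q N) ` coeffs_in S"

lemma s_neq_0: "s \<noteq> 0"
proof
  assume "s = 0"
  have "lookup s (single 0 1) =
    (\<Sum>i<p. if i = 0 then 1 else 0 :: 'f)"
    unfolding s_def lookup_sum
    by (rule sum.cong) (auto simp: y_def var_def lookup_single when_def
        dest!: arg_cong[of "single _ _" _ keys])
  with \<open>s = 0\<close> p_pos show False by (simp add: sum.delta)
qed

lemma artin_schreier_in: "artin_schreier p s \<in> coeffs_in S"
  by (simp add: artin_schreier_def)

lemma poly_N_eq: "poly q N = poly (pcompose q (artin_schreier p s)) z"
  by (simp add: poly_pcompose poly_artin_schreier N_def)

text \<open>
  In terms of the polynomial in \<open>z\<close> over \<open>S\<close>, invariance under \<open>\<sigma>^p\<close> is invariance under the translation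
  by \<open>s\<close>.
\<close>

lemma subgroup_invariants:
  assumes "f \<in> R" and "(\<sigma> ^^ p) f = f"
  shows "f \<in> SN"
proof -
  obtain q where q: "q \<in> coeffs_in S" "f = poly q z" using R_eq_poly_z assms(1) by blast
  have "(\<sigma> ^^ p) z = z + s" by (simp add: sigma_pow_z s_def)
  then have "(\<sigma> ^^ p) f = poly q (z + s)"
    using q sigma_pow_p_S
    by (simp add: poly_altdef sigma_pow.hom_sum sigma_pow.hom_mult sigma_pow.hom_power coeffs_in_def)
  then have "poly (pcompose q [:s, 1:] - q) z = 0"
    using assms(2) q by (simp add: poly_pcompose add.commute)
  moreover have "pcompose q [:s, 1:] - q \<in> coeffs_in S"
    using q by (simp add: S.coeffs_in_pcompose)
  ultimately have "pcompose q [:s, 1:] = q" using coeffs_poly_z by fastforce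
  then obtain g where "g \<in> coeffs_in S" "q = pcompose g (artin_schreier p s)"
    using shift_invariant_imp_pcompose_artin_schreier[OF S.subring_set_axioms s_in_S s_neq_0 prime_p
        char_mpoly q(1)] by blast
  then have "f = poly g N" using q(2) poly_N_eq[of g] by simp
  with \<open>g \<in> coeffs_in S\<close> show ?thesis unfolding SN_def by blast
qed

lemma coeffs_poly_N:
  assumes "q \<in> coeffs_in S" and "poly q N = 0"
  shows "q = 0"
proof -
  let ?P = "artin_schreier p s"
  have "pcompose q ?P = 0"
    by (rule coeffs_poly_z) (use assms in \<open>simp_all add: S.coeffs_in_pcompose artin_schreier_in poly_N_eq\<close>)
  then show ?thesis
    using pcompose_eq_0[of q ?P] by (simp add: degree_artin_schreier[OF p_gt_1])
qed

lemma SN_in_R: "f \<in> SN \<Longrightarrow> f \<in> R"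
  unfolding SN_def coeffs_in_def poly_altdef
  by (auto simp: S_subset_R)

lemma SN_fixed: "f \<in> SN \<Longrightarrow> (\<sigma> ^^ p) f = f"
  unfolding SN_def coeffs_in_def poly_altdef
  by (auto simp: sigma_pow.hom_sum sigma_pow.hom_mult sigma_pow.hom_power sigma_pow_p_S
      sigma_pow_p_N)

lemma S_mult_N_in_SN: "a \<in> S \<Longrightarrow> a * N ^ k \<in> SN"
  unfolding SN_def by (rule image_eqI[of _ _ "monom a k"]) (simp_all add: poly_monom)

lemma S_in_SN: "a \<in> S \<Longrightarrow> a \<in> SN"
  using S_mult_N_in_SN[of a 0] by simp

lemma SN_add: "f \<in> SN \<Longrightarrow> g \<in> SN \<Longrightarrow> f + g \<in> SN"
proof -
  assume "f \<in> SN" "g \<in> SN"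
  then obtain q r where "q \<in> coeffs_in S" "r \<in> coeffs_in S" "f = poly q N" "g = poly r N"
    unfolding SN_def by blast
  then have "f + g = poly (q + r) N" "q + r \<in> coeffs_in S" by simp_all
  then show "f + g \<in> SN" unfolding SN_def by blast
qed

section \<open>Invariants of the cyclic permutation of the variables\<close>

text \<open>
  The inverse of the cyclic permutation of the indices, needed because \<open>map_key\<close> is contravariant.
\<close>

definition pred_mod :: "nat \<Rightarrow> nat" where
  "pred_mod i = (if i < p then (i + (p - 1)) mod p else i)"

definition rotate_exp :: "(nat \<Rightarrow>\<^sub>0 nat) \<Rightarrow> (nat \<Rightarrow>\<^sub>0 nat)" where
  "rotate_exp m = Poly_Mapping.map_key pred_mod m"

lemma pred_Suc_mod: "i < p \<Longrightarrow> pred_mod (Suc i mod p) = i"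
proof -
  assume "i < p"
  have "(Suc i mod p + (p - 1)) mod p = i"
  proof (cases "Suc i = p")
    case False
    with \<open>i < p\<close> have "Suc i mod p + (p - 1) = i + p" by simp
    with \<open>i < p\<close> show ?thesis by simp
  qed auto
  with \<open>i < p\<close> show ?thesis by (simp add: pred_mod_def)
qed

lemma Suc_pred_mod: "i < p \<Longrightarrow> Suc (pred_mod i) mod p = i"
proof -
  assume "i < p"
  then have "Suc (pred_mod i) mod p = Suc (i + (p - 1)) mod p"
    by (simp add: pred_mod_def mod_Suc_eq)
  also have "\<dots> = (i + p) mod p" using p_pos by (simp del: p_pos)
  finally show ?thesis using \<open>i < p\<close> by simp
qed

lemma pred_mod_less_iff: "pred_mod i < p \<longleftrightarrow> i < p" by (simp add: pred_mod_def)

lemma pred_mod_less: "i < p \<Longrightarrow> pred_mod i < p" by (simp add: pred_mod_less_iff)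

lemma inj_pred_mod: "inj pred_mod"
proof (rule injI)
  fix i j assume eq: "pred_mod i = pred_mod j"
  consider "i < p" "j < p" | "i < p" "j \<ge> p" | "i \<ge> p" "j < p" | "i \<ge> p" "j \<ge> p" by linarith
  then show "i = j"
  proof cases
    case 1
    then show ?thesis using Suc_pred_mod eq by metis
  next
    case 2
    then have "pred_mod j = j" by (simp add: pred_mod_def)
    then show ?thesis using pred_mod_less[OF 2(1)] 2 eq by linarith
  next
    case 3
    then have "pred_mod i = i" by (simp add: pred_mod_def)
    then show ?thesis using pred_mod_less[OF 3(2)] 3 eq by linarith
  qed (use eq in \<open>simp add: pred_mod_def\<close>)
qed

lemma lookup_rotate: "lookup (rotate_exp m) i = lookup m (pred_mod i)"
  by (simp add: rotate_exp_def map_key.rep_eq inj_pred_mod)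

lemma keys_rotate: "keys m \<subseteq> {..<p} \<Longrightarrow> keys (rotate_exp m) \<subseteq> {..<p}"
proof
  fix i assume m: "keys m \<subseteq> {..<p}" and "i \<in> keys (rotate_exp m)"
  then have "pred_mod i \<in> keys m" by (simp add: in_keys_iff lookup_rotate)
  with m have "pred_mod i < p" by blast
  then show "i \<in> {..<p}" by (cases "i < p") (simp_all add: pred_mod_def)
qed

lemma keys_rotate_pow:
  "keys m \<subseteq> {..<p} \<Longrightarrow> keys ((rotate_exp ^^ k) m) \<subseteq> {..<p}"
  by (induction k) (simp_all add: keys_rotate)

lemma inj_rotate: "inj rotate_exp"
proof (rule injI, rule poly_mapping_eqI)
  fix m n j assume eq: "rotate_exp m = rotate_exp n"
  let ?i = "if j < p then Suc j mod p else j"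
  have "pred_mod ?i = j" using pred_Suc_mod[of j] by (auto simp: pred_mod_def)
  with arg_cong[OF eq, of "\<lambda>m. lookup m ?i"]
  show "lookup m j = lookup n j" by (simp add: lookup_rotate)
qed

lemma sigma_single:
  assumes "keys m \<subseteq> {..<p}"
  shows "\<sigma> (single m a) = single (rotate_exp m) a"
proof -
  let ?g = "\<lambda>j. var j ^ lookup (rotate_exp m) j :: 'f mpoly"
  have bij: "bij_betw (\<lambda>i. Suc i mod p) {..<p} {..<p}"
    by (rule bij_betw_byWitness[of _ pred_mod]) (auto simp: pred_Suc_mod Suc_pred_mod pred_mod_less)
  have "\<sigma> (monom_value var m) = (\<Prod>i<p. \<sigma> (var i) ^ lookup m i)"
    using assms by (simp add: monom_value_superset[of "{..<p}"] sigma.hom_prod sigma.hom_power)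
  also have "\<dots> = (\<Prod>i<p. ?g (Suc i mod p))"
    by (rule prod.cong) (simp_all add: \<sigma>_def y_def lookup_rotate pred_Suc_mod)
  also have "\<dots> = (\<Prod>j<p. ?g j)" by (rule prod.reindex_bij_betw[OF bij])
  also have "\<dots> = monom_value var (rotate_exp m)"
    using keys_rotate[OF assms] by (simp add: monom_value_superset[of "{..<p}"])
  finally show ?thesis by (simp add: single_eq_monomial sigma.hom_mult)
qed

lemma sigma_pow_single:
  assumes "keys m \<subseteq> {..<p}"
  shows "(\<sigma> ^^ k) (single m a) = single ((rotate_exp ^^ k) m) a"
  by (induction k) (simp_all add: sigma_single keys_rotate_pow[OF assms])

lemma lookup_sigma:
  assumes "g \<in> S"
  shows "lookup (\<sigma> g) (rotate_exp m) = lookup g m"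
proof -
  have "\<sigma> g = \<sigma> (\<Sum>m\<in>keys g. single m (lookup g m))"
    by (simp only: mpoly_sum_of_terms[symmetric])
  also have "\<dots> = (\<Sum>m\<in>keys g. single (rotate_exp m) (lookup g m))"
    unfolding sigma.hom_sum
    by (rule sum.cong) (use assms in \<open>auto simp: sigma_single poly_ring_def\<close>)
  finally show ?thesis
    using inj_rotate
    by (auto simp: lookup_sum lookup_single when_def inj_eq in_keys_iff)
qed

definition const_exp :: "nat \<Rightarrow> (nat \<Rightarrow>\<^sub>0 nat)" where
  "const_exp d = (\<Sum>i<p. single i d)"

lemma lookup_const_exp: "lookup (const_exp d) i = (if i < p then d else 0)"
  by (auto simp: const_exp_def lookup_sum lookup_single when_def)

lemma keys_const_exp: "keys (const_exp d) \<subseteq> {..<p}"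
  by (auto simp: in_keys_iff lookup_const_exp split: if_splits)

lemma rotate_const_exp: "rotate_exp (const_exp d) = const_exp d"
  by (rule poly_mapping_eqI) (simp add: lookup_rotate lookup_const_exp pred_mod_less_iff)

lemma const_exp_add: "const_exp (c + d) = const_exp c + const_exp d"
  by (rule poly_mapping_eqI) (simp add: lookup_const_exp lookup_add)

lemma mon_deg_const_exp: "mon_deg (const_exp d) = p * d"
  by (simp add: mon_deg_superset[OF _ keys_const_exp] lookup_const_exp)

lemma single_const_exp: "single (const_exp d) a = const a * e ^ d"
proof -
  have "monom_value var (const_exp d) = (\<Prod>i<p. y i ^ d)"
    unfolding monom_value_superset[OF finite_lessThan keys_const_exp]
    by (rule prod.cong) (simp_all add: lookup_const_exp y_def)
  then show ?thesis by (simp add: single_eq_monomial e_def prod_power_distrib)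
qed

lemma rotate_fixed_imp_const_exp:
  assumes "rotate_exp m = m" and "keys m \<subseteq> {..<p}"
  shows "m = const_exp (lookup m 0)"
proof (rule poly_mapping_eqI)
  fix i
  have "lookup m i = lookup m 0" if "i < p" for i
    using that
  proof (induction i)
    case (Suc i)
    then have "pred_mod (Suc i) = i" using pred_Suc_mod[of i] by simp
    then have "lookup m (Suc i) = lookup m i"
      using assms(1) lookup_rotate[of m "Suc i"] by simp
    with Suc show ?case by simp
  qed simp
  moreover have "lookup m i = 0" if "\<not> i < p" for i
    using that assms(2) by (metis in_keys_iff lessThan_iff subsetD)
  ultimately show "lookup m i = lookup (const_exp (lookup m 0)) i"
    by (simp only: lookup_const_exp split: if_split) blast
qed

lemma rotate_pow_p:
  assumes "keys m \<subseteq> {..<p}" shows "(rotate_exp ^^ p) m = m"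
proof -
  have "(single m 1 :: 'f mpoly) \<in> S" using assms by (simp add: poly_ring_def)
  then have "single ((rotate_exp ^^ p) m) 1 = (single m 1 :: 'f mpoly)"
    using sigma_pow_p_S sigma_pow_single[OF assms, of p 1] by simp
  from arg_cong[OF this, of keys] show ?thesis by simp
qed

text \<open>
  A power \<open>\<sigma>^k\<close> with \<open>k\<close> prime to \<open>p\<close> generates the same cyclic group as \<open>\<sigma>\<close>, so that the orbit of a monomial
  that is not fixed has \<open>p\<close> elements.
\<close>

lemma rotate_free:
  assumes m: "keys m \<subseteq> {..<p}" and "0 < k" "k < p" and "(rotate_exp ^^ k) m = m"
  shows "rotate_exp m = m"
proof -
  have mult: "(rotate_exp ^^ (n * j)) m = m" if "(rotate_exp ^^ n) m = m" for n j
    using that by (induction j) (simp_all add: funpow_add)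
  have "coprime k p"
    using assms prime_p by (metis coprime_commute nat_dvd_not_less prime_imp_coprime_nat)
  moreover obtain a b where "k * a = p * b + gcd k p" using bezout_nat[of k p] \<open>0 < k\<close> by auto
  ultimately have "k * a = Suc (p * b)" by simp
  then have "rotate_exp ((rotate_exp ^^ (p * b)) m) = (rotate_exp ^^ (k * a)) m" by simp
  with mult[OF assms(4), of a] mult[OF rotate_pow_p[OF m], of b] show ?thesis by simp
qed

text \<open>
  Polynomials in \<open>e\<close>, the invariants that need not be transfers.
\<close>

definition in_e :: "'f poly \<Rightarrow> 'f mpoly" where
  "in_e c = poly (map_poly const c) e"

lemma in_e_add: "in_e (c + d) = in_e c + in_e d"
proof -
  interpret const: comm_ring_hom "const :: 'f \<Rightarrow> 'f mpoly" by (rule const_hom)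
  have "map_poly const (c + d) = (map_poly const c + map_poly const d :: 'f mpoly poly)"
    by (rule poly_eqI) (simp add: coeff_map_poly const.hom_add)
  then show ?thesis by (simp add: in_e_def)
qed

lemma const_eq_0_iff: "const c = (0 :: 'f mpoly) \<longleftrightarrow> c = 0"
  unfolding const_def by (metis lookup_single_eq lookup_zero single_zero)

lemma in_e_altdef: "in_e c = (\<Sum>d\<le>degree c. const (coeff c d) * e ^ d)"
proof -
  have "in_e c = (\<Sum>d\<le>degree (map_poly const c :: 'f mpoly poly). const (coeff c d) * e ^ d)"
    by (simp add: in_e_def poly_altdef coeff_map_poly)
  also have "degree (map_poly const c :: 'f mpoly poly) = degree c"
    by (rule degree_map_poly) (simp add: const_eq_0_iff)
  finally show ?thesis .
qed

lemma in_e_monom: "in_e (monom a d) = const a * e ^ d"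
  by (simp add: in_e_def map_poly_monom poly_monom)

lemma in_e_in_S: "in_e c \<in> S"
  by (simp add: in_e_altdef)

lemma sigma_in_e: "\<sigma> (in_e c) = in_e c"
  by (simp add: in_e_altdef sigma.hom_sum sigma.hom_mult sigma.hom_power)

lemma in_e_alg: "in_e c \<in> alg_generated {norm_N, e}"
  unfolding in_e_altdef
  by (intro alg_generated_sum alg_generated.mult alg_generated_power alg_generated.const
      alg_generated.gen) simp

text \<open>
  An orbit of monomials is either free, and then its sum is a transfer, or a single monomial whose
  exponents are all equal.
\<close>

lemma S_invariants:
  assumes "g \<in> S" and "\<sigma> g = g"
  shows "\<exists>v\<in>S. \<exists>c. g = tr v + in_e c"
  using assms
proof (induction "card (keys g)" arbitrary: g rule: less_induct)
  case less
  show ?case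
  proof (cases "g = 0")
    case True
    then show ?thesis by (intro bexI[of _ 0] exI[of _ 0]) (simp_all add: in_e_def)
  next
    case False
    then obtain m where m: "m \<in> keys g" by fastforce
    define a where "a = lookup g m"
    have keys_m: "keys m \<subseteq> {..<p}" using less.prems(1) m by (simp add: poly_ring_def)
    have orbit: "lookup g ((rotate_exp ^^ k) m) = a" for k
      by (induction k) (use lookup_sigma[OF less.prems(1)] less.prems(2) in \<open>simp_all add: a_def\<close>)
    have single_S: "single m b \<in> S" for b
      using keys_m by (simp add: poly_ring_def)
    have reduce: "\<exists>v\<in>S. \<exists>c. g = h + (tr v + in_e c)"
      if h: "h \<in> S" "\<sigma> h = h" and off: "\<And>m'. lookup (g - h) m' \<noteq> 0 \<Longrightarrow>
        lookup g m' \<noteq> 0 \<and> m' \<noteq> m" for h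
    proof -
      have "keys (g - h) \<subseteq> keys g - {m}"
        using off by (auto simp: in_keys_iff)
      then have "keys (g - h) \<subset> keys g" using m by blast
      then have "card (keys (g - h)) < card (keys g)"
        by (rule psubset_card_mono[OF finite_keys])
      then have "\<exists>v\<in>S. \<exists>c. g - h = tr v + in_e c"
        by (rule less.hyps) (use h less.prems in \<open>simp_all add: sigma.hom_minus\<close>)
      then show ?thesis by (metis add.commute diff_add_cancel)
    qed
    show ?thesis
    proof (cases "rotate_exp m = m")
      case True
      define d where "d = lookup m 0"
      have m_eq: "m = const_exp d"
        unfolding d_def using rotate_fixed_imp_const_exp[OF True keys_m] .
      have "\<exists>v\<in>S. \<exists>c. g = single m a + (tr v + in_e c)"
        by (rule reduce) (auto simp: single_S sigma_single[OF keys_m] True lookup_minus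
            lookup_single when_def a_def split: if_splits)
      then obtain v c where "v \<in> S" and g: "g = single m a + (tr v + in_e c)" by blast
      have "single m a = in_e (monom a d)"
        by (simp add: m_eq single_const_exp in_e_monom)
      with g have "g = tr v + in_e (c + monom a d)" by (simp add: in_e_add algebra_simps)
      with \<open>v \<in> S\<close> show ?thesis by blast
    next
      case False
      let ?o = "\<lambda>k. (rotate_exp ^^ k) m"
      have inj: "inj_on ?o {..<p}"
      proof (rule linorder_inj_onI')
        fix i j assume "i \<in> {..<p}" "j \<in> {..<p}" "i < j"
        then obtain k where j: "j = i + k" "0 < k" "k < p"
          by (metis add_diff_inverse_nat lessThan_iff less_imp_diff_less not_less_iff_gr_or_eq zero_less_diff)
        have "inj (rotate_exp ^^ i)" using inj_rotate by (rule inj_fn)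
        show "?o i \<noteq> ?o j"
        proof
          assume "?o i = ?o j"
          then have "(rotate_exp ^^ i) m = (rotate_exp ^^ i) ((rotate_exp ^^ k) m)"
            by (simp add: j funpow_add)
          then have "m = (rotate_exp ^^ k) m" using \<open>inj (rotate_exp ^^ i)\<close> by (simp add: inj_eq)
          with rotate_free[OF keys_m j(2,3)] False show False by simp
        qed
      qed
      have lookup_tr: "lookup (tr (single m a)) m' =
        (if m' \<in> ?o ` {..<p} then a else 0)" for m'
      proof -
        have "lookup (tr (single m a)) m' =
          (\<Sum>k<p. if ?o k = m' then a else 0)"
          by (simp add: tr_def lookup_sum sigma_pow_single[OF keys_m] lookup_single when_def)
        also have "\<dots> = (\<Sum>n\<in>?o ` {..<p}. if n = m' then a else 0)"
          by (simp add: sum.reindex[OF inj])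
        also have "\<dots> = (if m' \<in> ?o ` {..<p} then a else 0)" by (simp add: sum.delta')
        finally show ?thesis .
      qed
      have "m \<in> ?o ` {..<p}" by (rule image_eqI[of _ _ 0]) simp_all
      have "\<exists>v\<in>S. \<exists>c. g = tr (single m a) + (tr v + in_e c)"
      proof (rule reduce)
        show "tr (single m a) \<in> S" by (rule tr_in_S[OF single_S])
        show "\<sigma> (tr (single m a)) = tr (single m a)"
          by (rule sigma_tr) (rule sigma_pow_p_S[OF single_S])
        fix m' assume m': "lookup (g - tr (single m a)) m' \<noteq> 0"
        have "m' \<notin> ?o ` {..<p}"
        proof
          assume "m' \<in> ?o ` {..<p}"
          then have "lookup g m' = a" using orbit by blast
          with \<open>m' \<in> ?o ` {..<p}\<close> m' show False by (simp only: lookup_minus lookup_tr if_True) simp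
        qed
        moreover from this m' have "lookup g m' \<noteq> 0"
          by (simp only: lookup_minus lookup_tr if_False) simp
        ultimately show "lookup g m' \<noteq> 0 \<and> m' \<noteq> m"
          using \<open>m \<in> ?o ` {..<p}\<close> by blast
      qed
      then obtain v c where "v \<in> S" "g = tr (single m a) + (tr v + in_e c)" by blast
      then have "g = tr (single m a + v) + in_e c" by (simp only: tr_add add.assoc)
      then show ?thesis using poly_ring_add[OF single_S \<open>v \<in> S\<close>] by blast
    qed
  qed
qed

section \<open>The obstruction class\<close>

lemma lookup_const_mult: "lookup (const a * f) m = a * lookup f m"
  by (simp add: const_def mult_map_scale_conv_mult[symmetric] map.rep_eq when_def)

lemma lookup_mult_single:
  "lookup (g * single a 1) (b + a) = lookup g b"
  for g :: "'f mpoly"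
proof -
  have "g * single a 1 = (\<Sum>m\<in>keys g.
    single m (lookup g m)) * single a 1"
    by (simp only: mpoly_sum_of_terms[symmetric])
  also have "\<dots> = (\<Sum>m\<in>keys g. single (m + a) (lookup g m))"
    by (simp add: sum_distrib_right mult_single)
  finally show ?thesis by (auto simp: lookup_sum lookup_single when_def in_keys_iff)
qed

definition squarefree_exp :: "nat set \<Rightarrow> (nat \<Rightarrow>\<^sub>0 nat)" where
  "squarefree_exp A = (\<Sum>i\<in>A. single i 1)"

lemma lookup_squarefree_exp:
  "finite A \<Longrightarrow> lookup (squarefree_exp A) i = (if i \<in> A then 1 else 0)"
  by (auto simp: squarefree_exp_def lookup_sum lookup_single when_def)

text \<open>
  By induction: a squarefree monomial of degree \<open>n + 1\<close> arises from each of its \<open>n + 1\<close> divisors of degree \<open>n\<close>.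
\<close>

lemma lookup_s_power:
  "A \<subseteq> {..<p} \<Longrightarrow> card A = n \<Longrightarrow> lookup (s ^ n) (squarefree_exp A) = of_nat (fact n)"
proof (induction n arbitrary: A)
  case 0
  then have "A = {}" using finite_subset by fastforce
  then show ?case by (simp add: squarefree_exp_def lookup_one)
next
  case (Suc n)
  have "finite A" using Suc.prems finite_subset by blast
  have term_i: "lookup (s ^ n * y i) (squarefree_exp A) = (if i \<in> A then of_nat (fact n) else 0)"
    if "i < p" for i
  proof -
    have y_i: "y i = single (single i 1) 1"
      using that by (simp add: y_def var_def)
    show ?thesis
    proof (cases "i \<in> A")
      case True
      have "squarefree_exp A = squarefree_exp (A - {i}) + single i 1"
        unfolding squarefree_exp_def using True \<open>finite A\<close>
        by (simp add: sum.remove[of A i] add.commute)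
      moreover have "lookup (s ^ n) (squarefree_exp (A - {i})) = of_nat (fact n)"
        by (rule Suc.IH) (use Suc.prems True \<open>finite A\<close> in auto)
      ultimately show ?thesis using True by (simp add: y_i lookup_mult_single)
    next
      case False
      have "squarefree_exp A \<notin> keys (s ^ n * y i)"
      proof
        assume "squarefree_exp A \<in> keys (s ^ n * y i)"
        then obtain b where "squarefree_exp A = b + single i 1"
          using keys_mult[of "s ^ n" "y i"] by (auto simp: y_i)
        from arg_cong[OF this, of "\<lambda>m. lookup m i"] False \<open>finite A\<close>
        show False by (simp add: lookup_squarefree_exp lookup_add)
      qed
      with False show ?thesis by (simp add: in_keys_iff)
    qed
  qed
  have "lookup (s ^ Suc n) (squarefree_exp A) =
      (\<Sum>i<p. lookup (s ^ n * y i) (squarefree_exp A))"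
  proof -
    have "s ^ n * s = (\<Sum>i<p. s ^ n * y i)"
      using sum_distrib_left[of "s ^ n" y "{..<p}"] by (simp only: s_def[symmetric])
    then have "s ^ Suc n = (\<Sum>i<p. s ^ n * y i)" by (simp only: power_Suc2)
    then show ?thesis by (simp only: lookup_sum)
  qed
  also have "\<dots> = (\<Sum>i<p. if i \<in> A then of_nat (fact n) else 0)" by (simp add: term_i)
  also have "\<dots> = (\<Sum>i\<in>A. of_nat (fact n))"
    using Suc.prems(1) by (intro sum.mono_neutral_cong_right) auto
  finally show ?case using Suc.prems by (simp add: algebra_simps)
qed

text \<open>
  The coefficient of \<open>e\<close> in \<open>M 0 = \<sigma> N - N\<close> is \<open>- (p - 1)!\<close>. So \<open>M 0\<close> is not of the form
  \<open>\<sigma> g - g\<close> with \<open>g \<in> S\<close>, in which all coefficients of powers of \<open>e\<close> vanish.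
\<close>

lemma lookup_M_0: "lookup (M 0) (const_exp 1) \<noteq> 0"
proof -
  have y0: "y 0 = single (single 0 1) 1" by (simp add: y_def var_def)
  have "y 0 ^ p = monom_value var (single 0 p)" by (simp add: y_def)
  then have "y 0 ^ p = single (single 0 p) 1"
    using single_eq_monomial[of "single 0 p" "1::'f"] by simp
  moreover have "single 0 p \<noteq> const_exp 1"
  proof
    assume "single 0 p = const_exp 1"
    from arg_cong[OF this, of "\<lambda>m. lookup m 0"] show False
      using p_gt_1 by (simp add: lookup_const_exp)
  qed
  ultimately have 1: "lookup (y 0 ^ p) (const_exp 1) = 0"
    by (simp add: lookup_single when_def)
  have "const_exp 1 = squarefree_exp {1..<p} + single 0 1"
    by (rule poly_mapping_eqI)
      (auto simp: lookup_const_exp lookup_squarefree_exp lookup_add lookup_single when_def)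
  then have "lookup (s ^ (p - 1) * y 0) (const_exp 1) = of_nat (fact (p - 1))"
    by (simp only: y0 lookup_mult_single) (rule lookup_s_power, auto)
  with 1 have "lookup (M 0) (const_exp 1) = - of_nat (fact (p - 1))"
    by (simp add: M_def lookup_minus)
  moreover have "\<not> p dvd fact (p - 1)" using prime_p p_gt_1 by (simp add: prime_dvd_fact_iff)
  then have "of_nat (fact (p - 1)) \<noteq> (0::'f)" by (simp only: of_nat_eq_0) simp
  ultimately show ?thesis by simp
qed

lemma is_form_y [simp]: "is_form (Suc 0) (y i)" unfolding y_def using is_form_var by simp

lemma is_form_s: "is_form 1 s" unfolding s_def by (rule is_form_sum) simp

lemma is_form_e: "is_form p e"
  unfolding e_def using is_form_prod[of "{..<p}" "\<lambda>_. 1" y] by simp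

lemma is_form_AS: "is_form 1 a \<Longrightarrow> is_form p (a ^ p - s ^ (p - 1) * a)"
  using is_form_power[of 1 a p] is_form_mult[OF is_form_power[OF is_form_s, of "p - 1"], of 1 a]
  by (intro is_form_diff) simp_all

lemma is_form_M: "is_form p (M i)" unfolding M_def by (rule is_form_AS) simp

lemma is_form_N: "is_form p N" unfolding N_def z_def by (rule is_form_AS) (rule is_form_var)

text \<open>
  The powers of \<open>e\<close> are fixed monomials, so their coefficients in \<open>\<sigma> g - g\<close> vanish. In \<open>M 0 * e^j\<close>, for
  reasons of degree, the only power of \<open>e\<close> is the one with exponent \<open>j + 1\<close>.
\<close>

lemma M_0_in_e_coboundary:
  assumes "g \<in> S" and "\<sigma> g - g = M 0 * in_e c"
  shows "c = 0"
proof (rule poly_eqI)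
  fix d
  have "0 = lookup (\<sigma> g - g) (const_exp (Suc d))"
    using lookup_sigma[OF assms(1), of "const_exp (Suc d)"]
    by (simp add: lookup_minus rotate_const_exp)
  also have "\<dots> = (\<Sum>j\<le>degree c. coeff c j * lookup (M 0 * e ^ j) (const_exp (Suc d)))"
  proof -
    show ?thesis
      by (simp add: lookup_const_mult assms(2) in_e_altdef sum_distrib_left lookup_sum mult.left_commute[of "M 0"])
  qed
  also have "\<dots> = (\<Sum>j\<le>degree c. if j = d then coeff c j * lookup (M 0) (const_exp 1) else 0)"
  proof (rule sum.cong)
    fix j
    show "coeff c j * lookup (M 0 * e ^ j) (const_exp (Suc d)) =
      (if j = d then coeff c j * lookup (M 0) (const_exp 1) else 0)"
    proof (cases "j = d")
      case True
      have "e ^ d = single (const_exp d) 1" by (simp add: single_const_exp)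
      moreover have "const_exp (Suc d) = const_exp 1 + const_exp d" using const_exp_add[of 1 d] by simp
      ultimately show ?thesis using True by (simp only: lookup_mult_single) simp
    next
      case False
      have "is_form (p + j * p) (M 0 * e ^ j)" by (intro is_form_mult is_form_M is_form_power is_form_e)
      moreover have "mon_deg (const_exp (Suc d)) \<noteq> p + j * p"
        using False by (simp add: mon_deg_const_exp)
      ultimately show ?thesis using False by (auto simp: is_form_def in_keys_iff)
    qed
  qed simp
  also have "\<dots> = coeff c d * lookup (M 0) (const_exp 1)"
    by (auto simp: coeff_eq_0)
  finally show "coeff c d = coeff 0 d" using lookup_M_0 by simp
qed

section \<open>Invariants are transfers up to norms\<close>

lemma poly_sigma:
  "\<sigma> (poly q N) = poly (pcompose (map_poly \<sigma> q) [:M 0, 1:]) N"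
  using sigma.poly_map_poly[of q N] by (simp add: poly_pcompose sigma_N add.commute)

lemma map_poly_sigma_in: "q \<in> coeffs_in S \<Longrightarrow> map_poly \<sigma> q \<in> coeffs_in S"
  by (simp add: coeffs_in_def coeff_map_poly sigma_in_S)

lemma invariant_poly_N:
  assumes "q \<in> coeffs_in S" and "\<sigma> (poly q N) = poly q N"
  shows "pcompose (map_poly \<sigma> q) [:M 0, 1:] = q"
proof -
  have "pcompose (map_poly \<sigma> q) [:M 0, 1:] - q = 0"
    by (rule coeffs_poly_N)
      (use assms in \<open>simp_all add: S.coeffs_in_pcompose map_poly_sigma_in poly_sigma\<close>)
  then show ?thesis by simp
qed

lemma in_e_smult: "in_e (Polynomial.smult a c) = const a * in_e c"
proof -
  interpret const: comm_ring_hom "const :: 'f \<Rightarrow> 'f mpoly" by (rule const_hom)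
  have "map_poly const (Polynomial.smult a c) = Polynomial.smult (const a) (map_poly const c :: 'f mpoly poly)"
    by (rule poly_eqI) (simp add: coeff_map_poly const.hom_mult)
  then show ?thesis by (simp add: in_e_def)
qed

lemma coeff_linear_power_above:
  fixes a :: "'a::comm_ring_1"
  shows "i > n \<Longrightarrow> coeff ([:a, 1:] ^ n) i = 0"
  by (rule coeff_eq_0) (rule le_less_trans[OF degree_power_le], auto)

lemma norm_N_eq_poly:
  "\<exists>\<nu>\<in>coeffs_in S. poly \<nu> N = norm_N \<and> degree \<nu> = p \<and> lead_coeff \<nu> = 1"
proof (intro bexI conjI)
  let ?\<nu> = "\<Prod>k<p. [:\<Sum>i<k. M i, 1:]"
  show "?\<nu> \<in> coeffs_in S" by (rule S.coeffs_in_prod) (simp add: S.sum_in)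
  show "poly ?\<nu> N = norm_N" by (simp add: poly_prod norm_N_def sigma_pow_N add.commute)
  show "degree ?\<nu> = p" by (subst degree_prod_eq_sum_degree) auto
  show "lead_coeff ?\<nu> = 1" by (subst lead_coeff_prod) simp
qed

text \<open>
  Induction on the degree in \<open>N\<close>. The transfer \<open>tr v\<close> in the leading coefficient is the leading coefficient of
  \<open>tr (v * N^n)\<close>. For what is left, a polynomial in \<open>e\<close>, the norm of \<open>N\<close> helps if \<open>p\<close> divides \<open>n\<close>; otherwise
  the coefficient of \<open>N^(n-1)\<close> in the invariance equation says that \<open>n\<close> times \<open>M 0\<close> times this polynomial
  is of the form \<open>g - \<sigma> g\<close>, which forces it to vanish.
\<close>

lemma invariant_decomposition:
  assumes "f \<in> SN" and "\<sigma> f = f"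
  shows "\<exists>u\<in>alg_generated {norm_N, e}. \<exists>v\<in>SN. f = u + tr v"
proof -
  have "\<exists>u\<in>alg_generated {norm_N, e}. \<exists>v\<in>SN. poly q N = u + tr v"
    if "\<And>i. i \<ge> n \<Longrightarrow> coeff q i = 0" "q \<in> coeffs_in S" "\<sigma> (poly q N) = poly q N" for n q
    using that
  proof (induction n arbitrary: q)
    case 0
    then have "q = 0" by (intro poly_eqI) simp
    then show ?case
      by (intro bexI[of _ 0]) (simp_all add: alg_generated_0 S_in_SN)
  next
    case (Suc n)
    define a where "a = coeff q n"
    have "a \<in> S" using Suc.prems(2) by (simp add: a_def coeffs_in_def)
    have deg: "degree q \<le> n" by (rule degree_le) (use Suc.prems(1) in auto)
    have "\<sigma> a = coeff (pcompose (map_poly \<sigma> q) [:M 0, 1:]) n"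
      using coeff_pcompose_shift(1)[of "map_poly \<sigma> q" n "M 0"] deg degree_map_poly_le[of \<sigma> q]
      by (simp add: a_def coeff_map_poly)
    then have "\<sigma> a = a" by (simp add: invariant_poly_N[OF Suc.prems(2,3)] a_def)
    then obtain v c where v: "v \<in> S" and a_eq: "a = tr v + in_e c"
      using S_invariants \<open>a \<in> S\<close> by blast
    define t where "t = (\<Sum>k<p. Polynomial.smult ((\<sigma> ^^ k) v) ([:\<Sum>i<k. M i, 1:] ^ n))"
    have t_S: "t \<in> coeffs_in S"
      unfolding t_def by (rule S.coeffs_in_sum) (simp add: v sigma_pow_in_S S.sum_in)
    have t_N: "poly t N = tr (v * N ^ n)"
      by (simp add: t_def poly_sum tr_def sigma_pow.hom_mult sigma_pow.hom_power sigma_pow_N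
          add.commute)
    have t_n: "coeff t n = tr v"
      by (simp add: t_def coeff_sum coeff_linear_power tr_def)
    have t_above: "coeff t i = 0" if "i > n" for i
      using that by (simp add: t_def coeff_sum coeff_linear_power_above)
    have vN: "v * N ^ n \<in> SN" using v by (rule S_mult_N_in_SN)
    (* The leading coefficient of q' is the part of a that is not a transfer. *)
    define q' where "q' = q - t"
    have q'_S: "q' \<in> coeffs_in S" using Suc.prems(2) t_S by (simp add: q'_def)
    have q'_n: "coeff q' n = in_e c" using a_eq t_n by (simp add: q'_def a_def)
    have q'_above: "coeff q' i = 0" if "i > n" for i
      using that Suc.prems(1)[of i] t_above by (simp add: q'_def)
    have q'_inv: "\<sigma> (poly q' N) = poly q' N"
      using Suc.prems(3) sigma_tr[OF SN_fixed[OF vN]] by (simp add: q'_def t_N sigma.hom_minus)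
    have finish: ?case if "u' \<in> alg_generated {norm_N, e}" "v' \<in> SN" "poly q' N = u' + tr v'" for u' v'
    proof -
      have "poly q N = u' + tr (v' + v * N ^ n)"
        using that by (simp add: q'_def t_N tr_add algebra_simps)
      with that SN_add[OF that(2) vN] show ?case by blast
    qed
    show ?case
    proof (cases "p dvd n")
      case True
      then obtain k where n: "n = p * k" by (auto elim: dvdE)
      obtain \<nu> where "\<nu> \<in> coeffs_in S" and \<nu>_N: "poly \<nu> N = norm_N"
        and "degree \<nu> = p" and "lead_coeff \<nu> = 1" using norm_N_eq_poly by blast
      have "\<nu> \<noteq> 0" using \<open>degree \<nu> = p\<close> p_pos by force
      have deg_k: "degree (\<nu> ^ k) = n" using \<open>\<nu> \<noteq> 0\<close> \<open>degree \<nu> = p\<close> by (simp add: degree_power_eq n)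
      have "coeff (\<nu> ^ k) n = 1"
        using lead_coeff_power[of \<nu> k] deg_k \<open>lead_coeff \<nu> = 1\<close> by simp
      let ?q = "q' - Polynomial.smult (in_e c) (\<nu> ^ k)"
      have "\<exists>u\<in>alg_generated {norm_N, e}. \<exists>v\<in>SN. poly ?q N = u + tr v"
      proof (rule Suc.IH)
        show "coeff ?q i = 0" if "i \<ge> n" for i
          using that q'_n q'_above[of i] \<open>coeff (\<nu> ^ k) n = 1\<close> deg_k
          by (cases "i = n") (auto simp: coeff_eq_0)
        show "?q \<in> coeffs_in S" using q'_S \<open>\<nu> \<in> coeffs_in S\<close> by (simp add: in_e_in_S)
        show "\<sigma> (poly ?q N) = poly ?q N"
          using q'_inv by (simp add: \<nu>_N sigma.hom_minus sigma.hom_mult sigma.hom_power sigma_in_e)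
      qed
      then obtain u' v' where uv: "u' \<in> alg_generated {norm_N, e}" "v' \<in> SN" "poly ?q N = u' + tr v'"
        by blast
      have "poly q' N = (u' + in_e c * norm_N ^ k) + tr v'"
        using uv(3) by (simp add: \<nu>_N algebra_simps)
      moreover have "u' + in_e c * norm_N ^ k \<in> alg_generated {norm_N, e}"
        by (intro alg_generated.add uv alg_generated.mult in_e_alg alg_generated_power
            alg_generated.gen) simp
      ultimately show ?thesis using finish uv(2) by blast
    next
      case False
      then obtain m where n: "n = Suc m" by (cases n) auto
      have deg': "degree q' \<le> n" by (rule degree_le) (use q'_above in auto)
      have "coeff q' m = coeff (pcompose (map_poly \<sigma> q') [:M 0, 1:]) m"
        by (simp add: invariant_poly_N[OF q'_S q'_inv])
      also have "\<dots> = \<sigma> (coeff q' m) + of_nat n * M 0 * \<sigma> (coeff q' n)"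
        using coeff_pcompose_shift(2)[of "map_poly \<sigma> q'" m "M 0"] deg' degree_map_poly_le[of \<sigma> q']
        by (simp add: n coeff_map_poly del: of_nat_Suc)
      finally have "\<sigma> (coeff q' m) - coeff q' m = M 0 * (- of_nat n * in_e c)"
        by (simp add: q'_n sigma_in_e algebra_simps)
      also have "- of_nat n * in_e c = in_e (Polynomial.smult (- of_nat n) c)"
        by (simp only: in_e_smult const_uminus const_of_nat)
      finally have "\<sigma> (coeff q' m) - coeff q' m = M 0 * in_e (Polynomial.smult (- of_nat n) c)" .
      then have "Polynomial.smult (- of_nat n) c = 0"
        by (rule M_0_in_e_coboundary[rotated]) (use q'_S in \<open>simp add: coeffs_in_def\<close>)
      moreover have "of_nat n \<noteq> (0::'f)" using False by (simp only: of_nat_eq_0) simp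
      ultimately have "c = 0" by simp
      then have "coeff q' n = 0" using q'_n by (simp add: in_e_def)
      with q'_above have "coeff q' i = 0" if "i \<ge> n" for i using that by (cases "i = n") auto
      from Suc.IH[OF this q'_S q'_inv] show ?thesis using finish by blast
    qed
  qed
  note main = this
  obtain q where q: "q \<in> coeffs_in S" "f = poly q N" using assms(1) SN_def by auto
  show ?thesis
    unfolding q(2)
    by (rule main[of "Suc (degree q)" q]) (use q assms(2) in \<open>simp_all add: coeff_eq_0\<close>)
qed

section \<open>Power sums over the prime field\<close>

lemma of_nat_pow_p: "(of_nat k :: 'f) ^ p = of_nat k"
proof (induction k)
  case (Suc k)
  have "(1 + of_nat k :: 'f) ^ p = 1 ^ p + of_nat k ^ p"
    by (rule freshmans_dream) (simp_all add: char_p prime_p)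
  with Suc show ?case by simp
qed simp

lemma of_nat_pow_p_minus_1: "k \<in> {1..<p} \<Longrightarrow> (of_nat k :: 'f) ^ (p - 1) = 1"
proof -
  assume "k \<in> {1..<p}"
  then have "\<not> p dvd k" by (auto dest: dvd_imp_le)
  then have "(of_nat k :: 'f) \<noteq> 0" by (simp only: of_nat_eq_0) simp
  moreover have "(of_nat k :: 'f) ^ (p - 1) * of_nat k = of_nat k"
    by (metis of_nat_pow_p p_pos power_minus_mult)
  ultimately show ?thesis by simp
qed

lemma inj_of_nat_p: "inj_on (of_nat :: nat \<Rightarrow> 'f) {..<p}"
proof (rule linorder_inj_onI')
  fix i j assume "i \<in> {..<p}" "j \<in> {..<p}" "i < j"
  then have "\<not> p dvd (j - i)" by (auto dest: dvd_imp_le)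
  then have "(of_nat (j - i) :: 'f) \<noteq> 0" by (simp only: of_nat_eq_0) simp
  with \<open>i < j\<close> show "(of_nat i :: 'f) \<noteq> of_nat j" by (simp add: of_nat_diff)
qed

text \<open>
  Otherwise \<open>X^n - 1\<close> would have \<open>p - 1\<close> roots.
\<close>

lemma exists_pow_neq_1:
  assumes "0 < n" and "n < p - 1"
  shows "\<exists>k\<in>{1..<p}. (of_nat k :: 'f) ^ n \<noteq> 1"
proof (rule ccontr)
  assume "\<not> ?thesis"
  then have all: "(of_nat k :: 'f) ^ n = 1" if "k \<in> {1..<p}" for k using that by blast
  let ?P = "monom 1 n - 1 :: 'f poly"
  have deg: "degree ?P = n"
  proof (rule antisym)
    show "degree ?P \<le> n" by (rule degree_le) (use assms in auto)
    show "n \<le> degree ?P" by (rule le_degree) (use assms in auto)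
  qed
  then have "?P \<noteq> 0" using assms by force
  have "of_nat ` {1..<p} \<subseteq> {x. poly ?P x = 0}" by (auto simp: poly_monom all)
  then have "card ((of_nat :: nat \<Rightarrow> 'f) ` {1..<p}) \<le> degree ?P"
    using card_mono[OF poly_roots_finite[OF \<open>?P \<noteq> 0\<close>]] card_poly_roots_bound[OF \<open>?P \<noteq> 0\<close>]
    by (meson le_trans)
  moreover have "card ((of_nat :: nat \<Rightarrow> 'f) ` {1..<p}) = p - 1"
    using inj_of_nat_p by (subst card_image) (auto intro: inj_on_subset)
  ultimately show False using deg assms by simp
qed

lemma of_nat_mod_p: "(of_nat (m mod p) :: 'f) = of_nat m"
proof -
  have "(of_nat m :: 'f) = of_nat (p * (m div p) + m mod p)" by simp
  also have "\<dots> = of_nat p * of_nat (m div p) + of_nat (m mod p)" by (simp only: of_nat_add of_nat_mult)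
  also have "(of_nat p :: 'f) = 0" using of_nat_eq_0[of p] by simp
  finally show ?thesis by simp
qed

lemma mult_permutes:
  assumes "c \<in> {1..<p}"
  shows "bij_betw (\<lambda>k. c * k mod p) {..<p} {..<p}"
proof -
  have "inj_on (\<lambda>k. c * k mod p) {..<p}"
  proof (rule inj_onI)
    fix i j assume ij: "i \<in> {..<p}" "j \<in> {..<p}" "c * i mod p = c * j mod p"
    have "(of_nat c :: 'f) * of_nat i = of_nat c * of_nat j"
      using arg_cong[OF ij(3), of "of_nat :: nat \<Rightarrow> 'f"] by (simp add: of_nat_mod_p)
    moreover have "(of_nat c :: 'f) \<noteq> 0"
      using of_nat_pow_p_minus_1[OF assms] p_gt_2 by (auto simp: power_0_left)
    ultimately have "(of_nat i :: 'f) = of_nat j" by simp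
    then show "i = j" using inj_of_nat_p ij by (auto dest: inj_onD)
  qed
  moreover have "(\<lambda>k. c * k mod p) ` {..<p} \<subseteq> {..<p}" by auto
  ultimately show ?thesis
    by (metis bij_betw_def card_image card_subset_eq finite_lessThan)
qed

text \<open>
  Multiplication by \<open>c\<close> permutes the prime field and multiplies the sum by \<open>c^n\<close>.
\<close>

lemma power_sum_eq_0:
  assumes "n < p - 1"
  shows "(\<Sum>k<p. (of_nat k :: 'f) ^ n) = 0"
proof (cases "n = 0")
  case True
  then show ?thesis using of_nat_eq_0[of p] by simp
next
  case False
  then obtain c where c: "c \<in> {1..<p}" "(of_nat c :: 'f) ^ n \<noteq> 1" using exists_pow_neq_1 assms by blast
  have "of_nat c ^ n * (\<Sum>k<p. (of_nat k :: 'f) ^ n) = (\<Sum>k<p. of_nat (c * k mod p) ^ n)"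
    by (simp add: sum_distrib_left of_nat_mod_p power_mult_distrib)
  also have "\<dots> = (\<Sum>k<p. of_nat k ^ n)"
    by (rule sum.reindex_bij_betw[OF mult_permutes[OF c(1)]])
  finally have "(of_nat c ^ n - 1) * (\<Sum>k<p. (of_nat k :: 'f) ^ n) = 0" by (simp add: algebra_simps)
  with c(2) show ?thesis by simp
qed

lemma power_sum_eq_minus_1: "(\<Sum>k<p. (of_nat k :: 'f) ^ (p - 1)) = - 1"
proof -
  have "{..<p} = insert 0 {1..<p}" by auto
  then have "(\<Sum>k<p. (of_nat k :: 'f) ^ (p - 1)) = (\<Sum>k\<in>{1..<p}. of_nat k ^ (p - 1))"
    using p_gt_2 by (simp add: power_0_left)
  also have "\<dots> = (\<Sum>k\<in>{1..<p}. 1)" by (rule sum.cong[OF refl], rule of_nat_pow_p_minus_1)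
  also have "\<dots> = of_nat p - 1" using of_nat_diff[of 1 p, where 'a = 'f] p_gt_1 by simp
  also have "(of_nat p :: 'f) = 0" using of_nat_eq_0[of p] by simp
  finally show ?thesis by simp
qed

section \<open>The Hilbert ideal of the permutation action\<close>

text \<open>
  Enough invariants of positive degree to generate the Hilbert ideal, all of degree at most \<open>p\<close>.
\<close>

definition positive_invariants :: "'f mpoly set" where
  "positive_invariants = insert e (tr ` {u \<in> S. \<exists>r\<in>{1..<p}. is_form r u})"

inductive_set hilbert_ideal :: "'f mpoly set" where
  zero: "0 \<in> hilbert_ideal"
| add: "f \<in> hilbert_ideal \<Longrightarrow> g \<in> hilbert_ideal \<Longrightarrow> f + g \<in> hilbert_ideal"
| gen: "\<gamma> \<in> positive_invariants \<Longrightarrow> f \<in> S \<Longrightarrow> \<gamma> * f \<in> hilbert_ideal"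

lemma hilbert_ideal_mult: "f \<in> hilbert_ideal \<Longrightarrow> g \<in> S \<Longrightarrow> f * g \<in> hilbert_ideal"
  by (induction rule: hilbert_ideal.induct)
    (auto simp: ring_distribs mult.assoc intro: hilbert_ideal.intros)

lemma hilbert_ideal_sum: "(\<And>i. i \<in> I \<Longrightarrow> f i \<in> hilbert_ideal) \<Longrightarrow> sum f I \<in> hilbert_ideal"
  by (induction I rule: infinite_finite_induct) (auto intro: hilbert_ideal.intros)

lemma hilbert_ideal_uminus: "f \<in> hilbert_ideal \<Longrightarrow> - f \<in> hilbert_ideal"
  using hilbert_ideal_mult[of f "- 1"] by simp

lemma hilbert_ideal_diff: "f \<in> hilbert_ideal \<Longrightarrow> g \<in> hilbert_ideal \<Longrightarrow> f - g \<in> hilbert_ideal"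
  using hilbert_ideal.add[of f "- g"] hilbert_ideal_uminus by simp

text \<open>
  Expanding the products, the sum over \<open>k\<close> turns every subset of the factors into a transfer; the empty
  subset contributes nothing because \<open>tr 1 = p = 0\<close>.
\<close>

lemma sum_prod_differences_in_hilbert_ideal:
  assumes "finite I" and "card I < p" and v: "\<And>l. l \<in> I \<Longrightarrow> v l \<in> S \<and> is_form 1 (v l)"
  shows "(\<Sum>k<p. \<Prod>l\<in>I. (\<sigma> ^^ k) (v l) - v l) \<in> hilbert_ideal"
proof -
  have "(\<Sum>k<p. \<Prod>l\<in>I. (\<sigma> ^^ k) (v l) - v l) =
      (\<Sum>k<p. \<Sum>X\<in>Pow I. (\<Prod>l\<in>X. (\<sigma> ^^ k) (v l)) * (\<Prod>l\<in>I - X. - v l))"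
    using prod_add[OF \<open>finite I\<close>, of "\<lambda>l. (\<sigma> ^^ k) (v l)" "\<lambda>l. - v l" for k] by simp
  also have "\<dots> = (\<Sum>X\<in>Pow I. tr (\<Prod>l\<in>X. v l) * (\<Prod>l\<in>I - X. - v l))"
    by (subst sum.swap) (simp add: tr_def sigma_pow.hom_prod sum_distrib_right)
  also have "\<dots> \<in> hilbert_ideal"
  proof (rule hilbert_ideal_sum)
    fix X assume X: "X \<in> Pow I"
    show "tr (\<Prod>l\<in>X. v l) * (\<Prod>l\<in>I - X. - v l) \<in> hilbert_ideal"
    proof (cases "X = {}")
      case True
      have "(of_nat p :: 'f mpoly) = 0"
        using of_nat_eq_0_iff_char_dvd[where ?'a = "'f mpoly", of p] by (simp add: char_mpoly)
      then have "tr 1 = 0" by (simp add: tr_def)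
      with True show ?thesis by (simp add: hilbert_ideal.zero)
    next
      case False
      have "finite X" using X \<open>finite I\<close> finite_subset by blast
      have "card X \<le> card I" using X \<open>finite I\<close> card_mono by blast
      moreover have "card X \<noteq> 0" using False \<open>finite X\<close> by simp
      moreover have "is_form (card X) (\<Prod>l\<in>X. v l)"
        using is_form_prod[OF \<open>finite X\<close>, of "\<lambda>_. 1" v] X v by auto
      moreover have "(\<Prod>l\<in>X. v l) \<in> S" using X v by (intro poly_ring_prod) auto
      ultimately have "(\<Prod>l\<in>X. v l) \<in> {u \<in> S. \<exists>r\<in>{1..<p}. is_form r u}"
        using \<open>card I < p\<close> by (intro CollectI conjI bexI[of _ "card X"]) auto
      then have "tr (\<Prod>l\<in>X. v l) \<in> positive_invariants"
        unfolding positive_invariants_def by (intro insertI2 imageI)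
      moreover have "(\<Prod>l\<in>I - X. - v l) \<in> S" using v by (intro poly_ring_prod) auto
      ultimately show ?thesis by (rule hilbert_ideal.gen)
    qed
  qed
  finally show ?thesis .
qed

text \<open>
  The span of the variables \<open>y i\<close> as a quotient of the polynomial ring in one variable, on which
  \<open>\<sigma>\<close> acts as multiplication by that variable.
\<close>

definition lin :: "'f poly \<Rightarrow> 'f mpoly" where
  "lin q = (\<Sum>i\<le>degree q. const (coeff q i) * y i)"

lemma lin_bound: "degree q \<le> n \<Longrightarrow> lin q = (\<Sum>i\<le>n. const (coeff q i) * y i)"
  unfolding lin_def by (rule sum.mono_neutral_left) (auto simp: coeff_eq_0)

lemma lin_add: "lin (q + r) = lin q + lin r"
proof -
  interpret const: comm_ring_hom "const :: 'f \<Rightarrow> 'f mpoly" by (rule const_hom)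
  let ?n = "max (degree q) (degree r)"
  have "degree (q + r) \<le> ?n" by (rule degree_add_le) auto
  then show ?thesis
    by (simp add: lin_bound[of _ ?n] const.hom_add ring_distribs sum.distrib)
qed

lemma lin_smult: "lin (Polynomial.smult c q) = const c * lin q"
proof -
  interpret const: comm_ring_hom "const :: 'f \<Rightarrow> 'f mpoly" by (rule const_hom)
  have "degree (Polynomial.smult c q) \<le> degree q" by simp
  then show ?thesis
    by (simp add: lin_bound[of _ "degree q"] const.hom_mult sum_distrib_left mult.assoc)
qed

lemma lin_diff: "lin (q - r) = lin q - lin r"
  using lin_add[of "q - r" r] by (simp add: algebra_simps)

lemma lin_1 [simp]: "lin 1 = y 0" by (simp add: lin_def)

lemma lin_of_nat: "lin (of_nat k * q) = of_nat k * lin q"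
  using lin_smult[of "of_nat k" q] by (simp add: of_nat_poly const_of_nat)

lemma lin_X: "lin ([:0, 1:] * q) = \<sigma> (lin q)"
proof -
  have "lin (pCons 0 q) = (\<Sum>i\<le>Suc (degree q). const (coeff (pCons 0 q) i) * y i)"
    by (rule lin_bound) (rule degree_pCons_le)
  also have "\<dots> = (\<Sum>i\<le>degree q. const (coeff q i) * y (Suc i))"
    by (simp add: sum.atMost_Suc_shift del: sum.atMost_Suc)
  also have "\<dots> = \<sigma> (lin q)" by (simp add: lin_def sigma.hom_sum sigma.hom_mult)
  finally show ?thesis by simp
qed

lemma lin_X_pow: "lin ([:0, 1:] ^ k * q) = (\<sigma> ^^ k) (lin q)"
  by (induction k) (simp_all only: power.simps mult_1 funpow.simps id_apply o_apply mult.assoc lin_X)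

lemma lin_in_S [simp]: "lin q \<in> S" by (simp add: lin_def)

lemma is_form_lin: "is_form 1 (lin q)"
  unfolding lin_def by (rule is_form_sum) (simp add: is_form_mult_const)

abbreviation \<Delta> :: "'f poly" where "\<Delta> \<equiv> [:-1, 1:]"

lemma lin_Delta_pow_p: "lin (\<Delta> ^ p * q) = 0"
proof -
  have odd: "odd p" using prime_p p_gt_2 by (simp add: prime_odd_nat)
  have "\<Delta> ^ p = ([:0, 1:] + [:-1:]) ^ p" by simp
  also have "\<dots> = [:0, 1:] ^ p + [:-1:] ^ p"
    by (rule freshmans_dream) (simp_all add: char_p prime_p)
  also have "[:-1 :: 'f:] ^ p = - 1" using odd by (simp add: poly_const_pow one_pCons)
  finally have "\<Delta> ^ p = [:0, 1:] ^ p - 1" by simp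
  then have "\<Delta> ^ p * q = [:0, 1:] ^ p * q - q" by (simp only: left_diff_distrib mult_1)
  then have "lin (\<Delta> ^ p * q) = (\<sigma> ^^ p) (lin q) - lin q" by (simp only: lin_diff lin_X_pow)
  then show ?thesis by (simp add: sigma_pow_p_S)
qed

lemma X_pow_minus_1: "\<exists>r. [:0, 1:] ^ k - 1 = of_nat k * \<Delta> + \<Delta> ^ 2 * r"
proof (induction k)
  case 0
  show ?case by (intro exI[of _ 0]) simp
next
  case (Suc k)
  then obtain r where r: "[:0, 1:] ^ k - 1 = of_nat k * \<Delta> + \<Delta> ^ 2 * r" by blast
  have X: "[:0, 1:] = 1 + \<Delta>" by (simp add: one_pCons)
  have "[:0, 1:] ^ Suc k - 1 = (1 + \<Delta>) * ([:0, 1:] ^ k - 1) + \<Delta>"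
    unfolding power_Suc by (subst X, subst X) (simp add: algebra_simps)
  also have "\<dots> = of_nat (Suc k) * \<Delta> + \<Delta> ^ 2 * (of_nat k + r + \<Delta> * r)"
  proof -
    have "(1 + d) * (n * d + d ^ 2 * r) + d = (1 + n) * d + d ^ 2 * (n + r + d * r)" for d n :: "'f poly"
      by (simp add: algebra_simps power2_eq_square)
    then show ?thesis unfolding r of_nat_Suc .
  qed
  finally show ?case by blast
qed

text \<open>
  The leading part of the products over \<open>l\<close> of \<open>(\<sigma>^k - 1) (v l)\<close> is \<open>k ^ (p - 1)\<close> times the product
  of the \<open>\<Delta> (v l)\<close>, and the sum of \<open>k ^ (p - 1)\<close> over \<open>k\<close> is \<open>-1\<close>. The other terms contain more
  factors \<open>\<Delta>\<close>, and \<open>\<Delta>\<close> is nilpotent.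
\<close>

lemma prod_lin_in_hilbert_ideal:
  assumes "\<And>l. l < p - 1 \<Longrightarrow> c l \<ge> 1"
  shows "(\<Prod>l<p - 1. lin (\<Delta> ^ c l * q l)) \<in> hilbert_ideal"
  using assms
  (* Once no exponent exceeds p - 1, their sum is below p * p, so the measure decreases strictly. *)
proof (induction "p * p - sum c {..<p - 1}" arbitrary: c q rule: less_induct)
  case less
  let ?I = "{..<p - 1}"
  show ?case
  proof (cases "\<exists>l<p - 1. c l \<ge> p")
    case True
    then obtain l where l: "l < p - 1" "c l \<ge> p" by blast
    have "\<Delta> ^ c l = \<Delta> ^ p * \<Delta> ^ (c l - p)" using l by (simp flip: power_add)
    then have "lin (\<Delta> ^ c l * q l) = 0" using lin_Delta_pow_p[of "\<Delta> ^ (c l - p) * q l"] by (simp only: mult.assoc)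
    then have "(\<Prod>l<p - 1. lin (\<Delta> ^ c l * q l)) = 0" using l by (intro prod_zero) auto
    then show ?thesis by (simp only: hilbert_ideal.zero)
  next
    case False
    then have c_less: "c l < p" if "l < p - 1" for l using that by force
    have "sum c ?I \<le> (\<Sum>l\<in>?I. p)" by (rule sum_mono) (use c_less in force)
    also have "\<dots> < p * p" using p_gt_1 by simp
    finally have sum_less: "sum c ?I < p * p" .
    (* One factor less, so that applying sigma^k - 1 restores the product A with the factor k. *)
    define v where "v l = lin (\<Delta> ^ (c l - 1) * q l)" for l
    define A where "A l = lin (\<Delta> ^ c l * q l)" for l
    obtain r where r: "[:0, 1:] ^ k - 1 = of_nat k * \<Delta> + \<Delta> ^ 2 * r k" for k
      using X_pow_minus_1 by metis
    define B where "B k l = lin (\<Delta> ^ Suc (c l) * (r k * q l))" for k l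
    have diff: "(\<sigma> ^^ k) (v l) - v l = of_nat k * A l + B k l" if "l \<in> ?I" for k l
    proof -
      have "c l = Suc (c l - 1)" using less.prems[of l] that by simp
      then have D: "\<Delta> ^ c l = \<Delta> * \<Delta> ^ (c l - 1)" by (metis power_Suc)
      have "(\<sigma> ^^ k) (v l) - v l = lin (([:0, 1:] ^ k - 1) * (\<Delta> ^ (c l - 1) * q l))"
        by (simp only: v_def left_diff_distrib mult_1 lin_diff lin_X_pow)
      also have "([:0, 1:] ^ k - 1) * (\<Delta> ^ (c l - 1) * q l) =
          of_nat k * (\<Delta> ^ c l * q l) + \<Delta> ^ Suc (c l) * (r k * q l)"
      proof -
        have "(n * d + d ^ 2 * r) * (f * q) = n * (d * f * q) + d * (d * f) * (r * q)"
          for d n r f q :: "'f poly"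
          by (simp add: algebra_simps power2_eq_square)
        then show ?thesis unfolding r power_Suc D .
      qed
      finally show ?thesis by (simp only: A_def B_def lin_add lin_of_nat)
    qed
    have "(\<Sum>k<p. \<Prod>l\<in>?I. (\<sigma> ^^ k) (v l) - v l) \<in> hilbert_ideal"
      by (rule sum_prod_differences_in_hilbert_ideal) (use p_gt_1 in \<open>auto simp: v_def is_form_lin[simplified]\<close>)
    also have "(\<Sum>k<p. \<Prod>l\<in>?I. (\<sigma> ^^ k) (v l) - v l) =
      (\<Sum>k<p. \<Sum>X\<in>Pow ?I. (\<Prod>l\<in>X. of_nat k * A l) * (\<Prod>l\<in>?I - X. B k l))"
      by (rule sum.cong) (simp_all add: diff prod_add)
    also have "\<dots> = (\<Sum>k<p. of_nat k ^ (p - 1) * (\<Prod>l\<in>?I. A l)) +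
      (\<Sum>k<p. \<Sum>X\<in>Pow ?I - {?I}. (\<Prod>l\<in>X. of_nat k * A l) * (\<Prod>l\<in>?I - X. B k l))"
    proof -
      have "(\<Sum>X\<in>Pow ?I. (\<Prod>l\<in>X. of_nat k * A l) * (\<Prod>l\<in>?I - X. B k l)) =
        of_nat k ^ (p - 1) * (\<Prod>l\<in>?I. A l) +
        (\<Sum>X\<in>Pow ?I - {?I}. (\<Prod>l\<in>X. of_nat k * A l) * (\<Prod>l\<in>?I - X. B k l))" for k
        by (subst sum.remove[of _ ?I]) (simp_all add: prod.distrib)
      then show ?thesis by (simp add: sum.distrib)
    qed
    also have "(\<Sum>k<p. of_nat k ^ (p - 1) * (\<Prod>l\<in>?I. A l)) = - (\<Prod>l\<in>?I. A l)"
    proof -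
      interpret const: comm_ring_hom "const :: 'f \<Rightarrow> 'f mpoly" by (rule const_hom)
      have "(\<Sum>k<p. (of_nat k :: 'f mpoly) ^ (p - 1)) = const (\<Sum>k<p. of_nat k ^ (p - 1))"
        by (simp only: const.hom_sum const.hom_power const_of_nat)
      also have "\<dots> = - 1" by (simp only: power_sum_eq_minus_1 const_uminus const_1)
      finally show ?thesis by (simp only: sum_distrib_right[symmetric]) simp
    qed
    finally have main: "- (\<Prod>l\<in>?I. A l) +
      (\<Sum>k<p. \<Sum>X\<in>Pow ?I - {?I}. (\<Prod>l\<in>X. of_nat k * A l) * (\<Prod>l\<in>?I - X. B k l)) \<in> hilbert_ideal" .
    have rest: "(\<Sum>k<p. \<Sum>X\<in>Pow ?I - {?I}. (\<Prod>l\<in>X. of_nat k * A l) * (\<Prod>l\<in>?I - X. B k l)) \<in> hilbert_ideal"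
    proof (intro hilbert_ideal_sum)
      fix k X assume "X \<in> Pow ?I - {?I}"
      then have X: "X \<subseteq> ?I" "X \<noteq> ?I" by auto
      let ?c = "\<lambda>l. if l \<in> X then c l else Suc (c l)"
      let ?q = "\<lambda>l. if l \<in> X then of_nat k * q l else r k * q l"
      have "sum c ?I < sum ?c ?I"
        by (rule sum_strict_mono_ex1) (use X in auto)
      then have "(\<Prod>l<p - 1. lin (\<Delta> ^ ?c l * ?q l)) \<in> hilbert_ideal"
        using less.prems sum_less by (intro less.hyps) auto
      also have "(\<Prod>l<p - 1. lin (\<Delta> ^ ?c l * ?q l)) =
        (\<Prod>l\<in>?I. if l \<in> X then of_nat k * A l else B k l)"
        by (rule prod.cong) (simp_all only: A_def B_def lin_of_nat mult.left_commute[of "\<Delta> ^ _" "of_nat k"] split: if_split, simp_all)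
      also have "\<dots> = (\<Prod>l\<in>X. of_nat k * A l) * (\<Prod>l\<in>?I - X. B k l)"
        using X(1) by (subst prod.If_cases) (simp_all add: Int_absorb1 Diff_eq)
      finally show "(\<Prod>l\<in>X. of_nat k * A l) * (\<Prod>l\<in>?I - X. B k l) \<in> hilbert_ideal" .
    qed
    show ?thesis using hilbert_ideal_diff[OF rest main] by (simp add: A_def)
  qed
qed


text \<open>
  The linear forms \<open>(\<sigma> - 1) v\<close>, where \<open>v\<close> is in the span of the \<open>y i\<close>.
\<close>

definition differences :: "'f mpoly set" where
  "differences = {lin (\<Delta> * q) |q. True}"

lemma y_diff_in_differences: "y i - y 0 \<in> differences"
proof -
  obtain r where r: "[:0, 1:] ^ i - 1 = of_nat i * \<Delta> + \<Delta> ^ 2 * r" using X_pow_minus_1 by blast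
  have "y i - y 0 = lin ([:0, 1:] ^ i * 1) - lin 1"
    by (simp only: lin_X_pow lin_1 sigma_pow_y add_0)
  also have "\<dots> = lin ([:0, 1:] ^ i - 1)" by (simp only: mult_1_right lin_diff)
  also have "[:0, 1:] ^ i - 1 = \<Delta> * (of_nat i + \<Delta> * r)"
  proof -
    have "n * d + d ^ 2 * r = d * (n + d * r)" for d n :: "'f poly"
      by (simp add: algebra_simps power2_eq_square)
    then show ?thesis unfolding r .
  qed
  finally show ?thesis unfolding differences_def by blast
qed

lemma differences_in_S: "w \<in> differences \<Longrightarrow> w \<in> S"
  by (auto simp: differences_def)

lemma prod_list_differences_in_S: "set ws \<subseteq> differences \<Longrightarrow> prod_list ws \<in> S"
  by (induction ws) (simp_all add: differences_in_S)

lemma prod_list_y_in_S: "prod_list (map y is) \<in> S"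
  by (induction "is") simp_all

lemma prod_list_differences_in_hilbert_ideal:
  assumes "set ws \<subseteq> differences" and "length ws \<ge> p - 1"
  shows "prod_list ws \<in> hilbert_ideal"
proof -
  let ?us = "take (p - 1) ws"
  have "\<exists>q. ws ! l = lin (\<Delta> * q)" if "l < length ws" for l
    using assms(1) nth_mem[OF that] unfolding differences_def by blast
  then obtain q where q: "\<And>l. l < length ws \<Longrightarrow> ws ! l = lin (\<Delta> * q l)" by metis
  have "prod_list ?us = (\<Prod>l<p - 1. ?us ! l)"
    using assms(2) by (simp add: prod.list_conv_set_nth atLeast0LessThan)
  also have "\<dots> = (\<Prod>l<p - 1. lin (\<Delta> ^ 1 * q l))"
    by (rule prod.cong) (use q assms(2) in auto)
  also have "\<dots> \<in> hilbert_ideal" by (rule prod_lin_in_hilbert_ideal) simp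
  finally have "prod_list ?us * prod_list (drop (p - 1) ws) \<in> hilbert_ideal"
    by (rule hilbert_ideal_mult)
      (use assms(1) set_drop_subset in \<open>fast intro: prod_list_differences_in_S\<close>)
  then show ?thesis by (simp flip: prod_list.append)
qed

text \<open>
  Each \<open>y i\<close> is the sum of \<open>y 0\<close> and a difference, so factors \<open>y i\<close> can be expanded as long as the exponent
  of \<open>y 0\<close> stays below a bound.
\<close>

lemma mixed_product_in_hilbert_ideal:
  assumes "\<And>b us. b < a \<Longrightarrow> set us \<subseteq> differences \<Longrightarrow> b + length us \<ge> n \<Longrightarrow>
      y 0 ^ b * prod_list us \<in> hilbert_ideal"
    and "set us \<subseteq> differences" "b + length is < a" "b + length us + length is \<ge> n"
  shows "y 0 ^ b * prod_list us * prod_list (map y is) \<in> hilbert_ideal"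
  using assms(2-4)
proof (induction "is" arbitrary: b us)
  case Nil
  then show ?case using assms(1)[of b us] by simp
next
  case (Cons i js)
  have "y 0 ^ b * prod_list us * prod_list (map y (i # js)) =
    y 0 ^ Suc b * prod_list us * prod_list (map y js) +
    y 0 ^ b * prod_list ((y i - y 0) # us) * prod_list (map y js)"
    by (simp add: algebra_simps)
  moreover have "y 0 ^ Suc b * prod_list us * prod_list (map y js) \<in> hilbert_ideal"
    by (rule Cons.IH) (use Cons.prems in auto)
  moreover have "y 0 ^ b * prod_list ((y i - y 0) # us) * prod_list (map y js) \<in> hilbert_ideal"
    by (rule Cons.IH) (use Cons.prems y_diff_in_differences in auto)
  ultimately show ?case by (simp only: hilbert_ideal.add)
qed

text \<open>
  Since \<open>y 0 ^ p\<close> agrees with \<open>e\<close> up to products with at least one factor \<open>y i - y 0\<close>, powers of \<open>y 0\<close>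
  can be traded for differences until there are \<open>p - 1\<close> of them. A product with at most \<open>p - 1\<close>
  factors \<open>y 0\<close> and at most \<open>p - 2\<close> differences has degree at most \<open>2 * p - 3\<close>.
\<close>

lemma y0_power_differences_in_hilbert_ideal:
  assumes "set ws \<subseteq> differences" and "a + length ws \<ge> 2 * p - 2"
  shows "y 0 ^ a * prod_list ws \<in> hilbert_ideal"
  using assms
proof (induction a arbitrary: ws rule: less_induct)
  case (less a)
  show ?case
  proof (cases "length ws \<ge> p - 1")
    case True
    then show ?thesis
      using hilbert_ideal_mult[OF prod_list_differences_in_hilbert_ideal[OF less.prems(1)], of "y 0 ^ a"]
      by (simp add: mult.commute)
  next
    case False
    then have "a \<ge> p" using less.prems(2) by linarith
    have mixed: "y 0 ^ b * prod_list us * prod_list (map y is) \<in> hilbert_ideal"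
      if "set us \<subseteq> differences" "b + length is < a" "b + length us + length is \<ge> 2 * p - 2" for b us "is"
      using mixed_product_in_hilbert_ideal[OF less.IH that] by simp
    (* Replace n of the factors y 0 by y 0, ..., y (n - 1), one at a time, until their product is e. *)
    have "y 0 ^ a * prod_list ws - y 0 ^ (a - n) * prod_list ws * prod_list (map y [0..<n]) \<in> hilbert_ideal"
      if "n \<le> p" for n
      using that
    proof (induction n)
      case 0
      show ?case by (simp add: hilbert_ideal.zero)
    next
      case (Suc n)
      let ?b = "a - Suc n"
      have b: "a - n = Suc ?b" using Suc.prems \<open>a \<ge> p\<close> by linarith
      have "y 0 ^ a * prod_list ws - y 0 ^ ?b * prod_list ws * prod_list (map y [0..<Suc n]) =
        (y 0 ^ a * prod_list ws - y 0 ^ (a - n) * prod_list ws * prod_list (map y [0..<n])) -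
        y 0 ^ ?b * prod_list ((y n - y 0) # ws) * prod_list (map y [0..<n])"
        unfolding b by (simp add: algebra_simps)
      moreover have "y 0 ^ ?b * prod_list ((y n - y 0) # ws) * prod_list (map y [0..<n]) \<in> hilbert_ideal"
        by (rule mixed) (use less.prems Suc.prems y_diff_in_differences \<open>a \<ge> p\<close> in auto)
      ultimately show ?case using Suc by (simp only: hilbert_ideal_diff Suc_leD)
    qed
    from this[of p] have diff: "y 0 ^ a * prod_list ws -
      y 0 ^ (a - p) * prod_list ws * prod_list (map y [0..<p]) \<in> hilbert_ideal" by simp
    have "prod_list (map y [0..<p]) = e"
      by (simp add: e_def prod.list_conv_set_nth atLeast0LessThan)
    moreover have "e * (y 0 ^ (a - p) * prod_list ws) \<in> hilbert_ideal"
      by (rule hilbert_ideal.gen)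
        (use less.prems(1) in \<open>auto simp: positive_invariants_def prod_list_differences_in_S\<close>)
    moreover have "y 0 ^ a * prod_list ws = (y 0 ^ a * prod_list ws -
      y 0 ^ (a - p) * prod_list ws * e) + e * (y 0 ^ (a - p) * prod_list ws)"
      by (simp add: mult_ac)
    ultimately show ?thesis using diff by (metis hilbert_ideal.add)
  qed
qed

lemma monomial_in_hilbert_ideal:
  assumes "length is \<ge> 2 * p - 2"
  shows "prod_list (map y is) \<in> hilbert_ideal"
  using mixed_product_in_hilbert_ideal[of "Suc (length is)" "2 * p - 2" "[]" 0 "is"] assms
    y0_power_differences_in_hilbert_ideal by simp

section \<open>Generators of the ring of invariants\<close>

text \<open>
  Monomials are given by lists of indices, for which the finiteness of the family is immediate.
\<close>

definition generators :: "'f mpoly set" where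
  "generators = {norm_N, e} \<union> (\<lambda>(k, is). tr (prod_list (map y is) * N ^ k)) `
     ({..<p} \<times> {is. set is \<subseteq> {..<p} \<and> length is \<le> 2 * p - 3})"

lemma finite_generators: "finite generators"
  unfolding generators_def by (simp add: finite_lists_length_le)

lemma is_form_sigma: "is_form d f \<Longrightarrow> is_form d (\<sigma> f)"
  unfolding \<sigma>_def by (rule is_form_subst) (auto simp: z_def is_form_add is_form_var[simplified])

lemma is_form_sigma_pow: "is_form d f \<Longrightarrow> is_form d ((\<sigma> ^^ k) f)"
  by (induction k) (simp_all add: is_form_sigma)

lemma is_form_tr: "is_form d f \<Longrightarrow> is_form d (tr f)"
  unfolding tr_def by (rule is_form_sum) (rule is_form_sigma_pow)

lemma is_form_norm_N: "is_form (p ^ 2) norm_N"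
  unfolding norm_N_def using is_form_prod[of "{..<p}" "\<lambda>_. p" "\<lambda>k. (\<sigma> ^^ k) N"]
  by (simp add: is_form_sigma_pow is_form_N power2_eq_square)

lemma is_form_monomial: "is_form (length is) (prod_list (map y is))"
proof (induction "is")
  case (Cons i js)
  then show ?case using is_form_mult[OF is_form_y, of "length js"] by simp
qed simp

lemma degree_bound: "p * (p - 1) + (2 * p - 3) = p ^ 2 + p - 3" "p ^ 2 \<le> p ^ 2 + p - 3"
  using p_gt_2 by (cases p; simp add: power2_eq_square)+

lemma generators_degree:
  assumes "b \<in> generators" shows "\<exists>k\<le>p ^ 2 + p - 3. is_form k b"
proof -
  consider "b = norm_N" | "b = e" | k "is" where "k < p" "length is \<le> 2 * p - 3"
      "b = tr (prod_list (map y is) * N ^ k)"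
    using assms unfolding generators_def by auto
  then show ?thesis
  proof cases
    case 1
    then show ?thesis using is_form_norm_N degree_bound(2) by blast
  next
    case 2
    have "p \<le> p ^ 2" using p_gt_1 by (simp add: power2_eq_square)
    then show ?thesis using 2 is_form_e degree_bound(2) le_trans by blast
  next
    case 3
    have "is_form (length is + k * p) b"
      unfolding 3 by (intro is_form_tr is_form_mult is_form_monomial is_form_power is_form_N)
    moreover have "length is + k * p \<le> p ^ 2 + p - 3"
    proof -
      have "k * p \<le> (p - 1) * p" using 3(1) by (intro mult_le_mono1) simp
      with 3(2) have "length is + k * p \<le> (2 * p - 3) + (p - 1) * p" by (rule add_mono)
      also have "\<dots> = p ^ 2 + p - 3" using degree_bound(1) by (metis add.commute mult.commute)
      finally show ?thesis .
    qed
    ultimately show ?thesis by blast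
  qed
qed

definition invariants :: "'f mpoly set" where
  "invariants = {f \<in> R. \<sigma> f = f}"

lemma SN_mult_N: "h \<in> S \<Longrightarrow> \<sigma> (tr (h * N ^ k)) = tr (h * N ^ k)"
  by (rule sigma_tr[OF SN_fixed[OF S_mult_N_in_SN]])

lemma tr_in_R: "f \<in> R \<Longrightarrow> tr f \<in> R"
  unfolding tr_def by (simp add: sigma_pow_in_R)

lemma generators_invariant: "alg_generated generators \<subseteq> invariants"
proof
  fix f assume "f \<in> alg_generated generators"
  then show "f \<in> invariants"
  proof induction
    case (gen b)
    then consider "b = norm_N" | "b = e" | k "is" where "b = tr (prod_list (map y is) * N ^ k)"
      unfolding generators_def by auto
    then show ?case
    proof cases
      case 1
      have "norm_N \<in> R" unfolding norm_N_def by (simp add: sigma_pow_in_R)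
      with 1 show ?thesis by (simp add: invariants_def)
    next
      case 2
      then show ?thesis by (simp add: invariants_def S_subset_R)
    next
      case 3
      then show ?thesis
        by (simp add: invariants_def SN_mult_N prod_list_y_in_S tr_in_R S_subset_R)
    qed
  qed (simp_all add: invariants_def sigma.hom_add sigma.hom_mult)
qed

lemma monom_value_eq_prod_list:
  assumes "keys m \<subseteq> {..<p}"
  shows "\<exists>is. set is \<subseteq> {..<p} \<and> length is = mon_deg m \<and> monom_value var m = prod_list (map y is)"
proof -
  have "\<exists>is. set is \<subseteq> {..<p} \<and> length is = (\<Sum>i\<in>I. k i) \<and> (\<Prod>i\<in>I. var i ^ k i) = prod_list (map y is)"
    if "finite I" "I \<subseteq> {..<p}" for I k
    using that
  proof (induction I rule: finite_induct)
    case empty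
    show ?case by (intro exI[of _ "[]"]) simp
  next
    case (insert j I)
    then obtain js where "set js \<subseteq> {..<p}" "length js = (\<Sum>i\<in>I. k i)"
      "(\<Prod>i\<in>I. var i ^ k i) = prod_list (map y js)" by auto
    moreover have "y j = var j" using insert.prems by (simp add: y_def)
    ultimately show ?case
      using insert.hyps insert.prems by (intro exI[of _ "replicate (k j) j @ js"]) (simp add: set_replicate_conv_if)
  qed
  from this[of "keys m" "lookup m"] assms show ?thesis
    by (simp add: monom_value_def mon_deg_def)
qed

lemma form_induct [consumes 2, case_names add scale monomial]:
  assumes "f \<in> S" and "is_form d f"
    and "\<And>f g. P f \<Longrightarrow> P g \<Longrightarrow> P (f + g)" and "\<And>c f. P f \<Longrightarrow> P (const c * f)"
    and "\<And>is. set is \<subseteq> {..<p} \<Longrightarrow> length is = d \<Longrightarrow> P (prod_list (map y is))"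
  shows "P f"
proof -
  have "P (prod_list (map y (replicate d 0)))"
    by (rule assms(5)) (auto simp: set_replicate_conv_if)
  from assms(4)[OF this, of 0] have P0: "P 0" by simp
  have sums: "P (sum h I)" if "finite I" "\<And>i. i \<in> I \<Longrightarrow> P (h i)" for h and I :: "(nat \<Rightarrow>\<^sub>0 nat) set"
    using that by (induction I rule: finite_induct) (simp_all add: P0 assms(3))
  have "P (\<Sum>m\<in>keys f. single m (lookup f m))"
  proof (rule sums)
    fix m assume m: "m \<in> keys f"
    then have "keys m \<subseteq> {..<p}" "mon_deg m = d"
      using assms(1,2) by (auto simp: poly_ring_def is_form_def)
    then obtain "is" where "set is \<subseteq> {..<p}" "length is = d" "monom_value var m = prod_list (map y is)"
      using monom_value_eq_prod_list by blast
    then show "P (single m (lookup f m))"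
      unfolding single_eq_monomial using assms(4,5) by metis
  qed simp
  then show ?thesis by (simp only: mpoly_sum_of_terms[symmetric])
qed

lemma tr_const_mult: "tr (const c * f) = const c * tr f"
  by (rule tr_mult) simp

lemma component_in_S: "f \<in> S \<Longrightarrow> component d f \<in> S"
  unfolding poly_ring_def by (auto simp: in_keys_iff lookup_component split: if_splits)

text \<open>
  An element of large degree lies in the Hilbert ideal, and a transfer pulls out the invariant
  coefficients of a representation witnessing this.
\<close>

lemma tr_form_N_generated:
  assumes "h \<in> S" and "is_form d h" and "k < p"
  shows "tr (h * N ^ k) \<in> alg_generated generators"
  using assms(1,2)
proof (induction d arbitrary: h rule: less_induct)
  case (less d)
  have small: "tr (u * N ^ j) \<in> alg_generated generators"
    if "u \<in> S" "is_form r u" "r \<le> 2 * p - 3" "j < p" for u r j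
    using that(1,2)
  proof (induction rule: form_induct)
    case (add f g)
    then show ?case by (simp add: ring_distribs tr_add alg_generated.add)
  next
    case (scale c f)
    then show ?case by (simp add: mult.assoc tr_const_mult alg_generated.mult alg_generated.const)
  next
    case (monomial "is")
    then show ?case using that(3,4) by (intro alg_generated.gen) (auto simp: generators_def)
  qed
  show ?case
  proof (cases "d \<le> 2 * p - 3")
    case True
    then show ?thesis using small less.prems assms(3) by blast
  next
    case False
    have hilb: "tr (component d f * N ^ k) \<in> alg_generated generators" if "f \<in> hilbert_ideal" for f
      using that
    proof induction
      case zero
      have "component d 0 = (0 :: 'f mpoly)" by (rule poly_mapping_eqI) (simp add: lookup_component)
      then show ?case by (simp add: alg_generated_0)
    next
      case (add f g)
      then show ?case by (simp add: component_add ring_distribs tr_add alg_generated.add)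
    next
      case (gen \<gamma> f)
      have \<gamma>: "\<exists>a>0. is_form a \<gamma> \<and> \<sigma> \<gamma> = \<gamma> \<and> \<gamma> \<in> alg_generated generators"
      proof (cases "\<gamma> = e")
        case True
        then show ?thesis
          using is_form_e p_pos by (auto simp: generators_def intro!: exI[of _ p] alg_generated.gen)
      next
        case False
        then obtain u r where u: "u \<in> S" "r \<in> {1..<p}" "is_form r u" "\<gamma> = tr u"
          using gen.hyps(1) unfolding positive_invariants_def by auto
        have "\<gamma> \<in> alg_generated generators"
          using small[of u r 0] u p_gt_2 by auto
        moreover have "\<sigma> \<gamma> = \<gamma>" using u sigma_tr[OF sigma_pow_p_S] by blast
        ultimately show ?thesis using u is_form_tr by (intro exI[of _ r]) auto
      qed
      then obtain a where a: "a > 0" "is_form a \<gamma>" "\<sigma> \<gamma> = \<gamma>" "\<gamma> \<in> alg_generated generators" by blast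
      have comp: "component d (\<gamma> * f) = (if a \<le> d then \<gamma> * component (d - a) f else 0)"
        by (simp add: component_mult component_of_form[OF a(2)] if_distrib[of "\<lambda>g. g * _"] sum.delta cong: if_cong)
      show ?case
      proof (cases "a \<le> d")
        case True
        have "tr (component (d - a) f * N ^ k) \<in> alg_generated generators"
          by (rule less.IH[of "d - a"]) (use True a gen.hyps(2) in \<open>simp_all add: component_in_S is_form_component\<close>)
        then show ?thesis using True a by (simp add: comp mult.assoc tr_mult alg_generated.mult)
      qed (simp add: comp alg_generated_0)
    qed
    have "h \<in> hilbert_ideal"
      using less.prems
    proof (induction rule: form_induct)
      case (scale c f)
      then show ?case using hilbert_ideal_mult[of f "const c"] by (simp add: mult.commute)
    next
      case (monomial "is")
      then show ?case using False by (intro monomial_in_hilbert_ideal) auto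
    qed (rule hilbert_ideal.add)
    from hilb[OF this] show ?thesis using component_of_form[OF less.prems(2), of d] by simp
  qed
qed

lemma tr_S_N_generated:
  assumes "h \<in> S" and "k < p"
  shows "tr (h * N ^ k) \<in> alg_generated generators"
proof -
  have "tr ((\<Sum>m\<in>keys h. single m (lookup h m)) * N ^ k)
      \<in> alg_generated generators"
    unfolding sum_distrib_right tr_sum
  proof (rule alg_generated_sum)
    fix m assume "m \<in> keys h"
    then have "single m (lookup h m) \<in> S"
      using assms(1) by (simp add: poly_ring_def)
    moreover have "is_form (mon_deg m) (single m (lookup h m))"
      by (simp add: is_form_def)
    ultimately show "tr (single m (lookup h m) * N ^ k) \<in> alg_generated generators"
      using tr_form_N_generated assms(2) by blast
  qed
  then show ?thesis by (simp only: mpoly_sum_of_terms[symmetric])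
qed

text \<open>
  Division by the norm, a monic polynomial of degree \<open>p\<close> in \<open>N\<close>, reduces to exponents of \<open>N\<close> below \<open>p\<close>.
\<close>

lemma tr_SN_generated:
  assumes "f \<in> SN" shows "tr f \<in> alg_generated generators"
proof -
  obtain \<nu> where \<nu>: "\<nu> \<in> coeffs_in S" "poly \<nu> N = norm_N" "degree \<nu> = p" "lead_coeff \<nu> = 1"
    using norm_N_eq_poly by blast
  have "tr (poly q N) \<in> alg_generated generators"
    if "q \<in> coeffs_in S" "\<And>i. i \<ge> n \<Longrightarrow> coeff q i = 0" for n q
    using that
  proof (induction n arbitrary: q rule: less_induct)
    case (less n)
    show ?case
    proof (cases n)
      case 0
      then have "q = 0" using less.prems by (intro poly_eqI) simp
      then show ?thesis by (simp add: alg_generated_0)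
    next
      case (Suc m)
      define a where "a = coeff q m"
      have a: "a \<in> S" using less.prems(1) by (simp add: a_def coeffs_in_def)
      show ?thesis
      proof (cases "m < p")
        case True
        let ?q = "q - monom a m"
        have "tr (poly ?q N) \<in> alg_generated generators"
        proof (rule less.IH[of m])
          show "coeff ?q i = 0" if "i \<ge> m" for i
            using less.prems(2)[of i] that Suc by (cases "i = m") (auto simp: a_def)
        qed (use Suc a less.prems(1) in simp_all)
        moreover have "poly q N = poly ?q N + a * N ^ m" by (simp add: poly_monom)
        ultimately show ?thesis
          using tr_S_N_generated[OF a True] by (simp only: tr_add alg_generated.add)
      next
        case False
        let ?b = "monom a (m - p)"
        let ?q = "q - \<nu> * ?b"
        have "tr (poly ?q N) \<in> alg_generated generators"
        proof (rule less.IH[of m])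
          fix i assume "i \<ge> m"
          have "coeff (\<nu> * ?b) i = a * coeff \<nu> (i - (m - p))"
            using coeff_monom_mult[of a "m - p" \<nu> i] \<open>i \<ge> m\<close> by (simp add: mult.commute)
          moreover have "coeff \<nu> (i - (m - p)) = (if i = m then 1 else 0)"
            using \<nu>(3,4) \<open>i \<ge> m\<close> False by (auto intro!: coeff_eq_0)
          ultimately show "coeff ?q i = 0"
            using less.prems(2)[of i] \<open>i \<ge> m\<close> Suc by (auto simp: a_def)
        qed (use Suc a less.prems(1) \<nu>(1) in simp_all)
        moreover have "tr (poly ?b N) \<in> alg_generated generators"
        proof (rule less.IH[of "Suc (m - p)"])
          show "Suc (m - p) < n" using Suc False p_gt_1 by linarith
        qed (use a in auto)
        moreover have "poly q N = poly ?q N + norm_N * poly ?b N" by (simp add: \<nu>(2))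
        moreover have "norm_N \<in> alg_generated generators"
          by (rule alg_generated.gen) (simp add: generators_def)
        ultimately show ?thesis
          by (simp only: tr_add tr_mult[OF sigma_norm_N] alg_generated.add alg_generated.mult)
      qed
    qed
  qed
  note main = this
  obtain q where q: "q \<in> coeffs_in S" "f = poly q N" using assms SN_def by auto
  show ?thesis unfolding q(2) by (rule main[of q "Suc (degree q)"]) (use q(1) in \<open>simp_all add: coeff_eq_0\<close>)
qed

lemma invariants_decomposition:
  assumes "f \<in> invariants"
  shows "\<exists>u\<in>alg_generated {norm_N, e}. \<exists>v\<in>SN. f = u + tr v"
proof (rule invariant_decomposition)
  show "\<sigma> f = f" using assms by (simp add: invariants_def)
  then show "f \<in> SN"
    using assms by (intro subgroup_invariants) (simp_all add: invariants_def sigma_pow_fixed)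
qed

theorem invariants_eq_alg_generated: "invariants = alg_generated generators"
proof
  show "invariants \<subseteq> alg_generated generators"
  proof
    fix f assume "f \<in> invariants"
    then obtain u v where "u \<in> alg_generated {norm_N, e}" "v \<in> SN" "f = u + tr v"
      using invariants_decomposition by blast
    moreover have "alg_generated {norm_N, e} \<subseteq> alg_generated generators"
      by (rule alg_generated_mono) (simp add: generators_def)
    ultimately show "f \<in> alg_generated generators"
      using tr_SN_generated by (auto intro: alg_generated.add)
  qed
qed (rule generators_invariant)

section \<open>Decomposable invariants\<close>

definition constant_term :: "'f mpoly \<Rightarrow> 'f" where
  "constant_term = evaluate (\<lambda>c. c) (\<lambda>_. 0)"

lemma id_hom: "comm_ring_hom (\<lambda>c::'f. c)" by standard simp_all

lemma constant_term_hom: "comm_ring_hom constant_term"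
  unfolding constant_term_def by (rule evaluate_hom[OF id_hom])

lemma constant_term_form:
  assumes "is_form d f" and "d > 0" shows "constant_term f = 0"
  unfolding constant_term_def evaluate_def
proof (rule sum.neutral, rule ballI)
  fix m assume "m \<in> keys f"
  then have "m \<noteq> 0" using assms by (auto simp: is_form_def)
  then have "keys m \<noteq> {}" by simp
  then obtain i where "i \<in> keys m" by blast
  then have "monom_value (\<lambda>_. 0 :: 'f) m = 0"
    unfolding monom_value_def by (intro prod_zero) (auto simp: in_keys_iff)
  then show "lookup f m * monom_value (\<lambda>_. 0) m = 0" by simp
qed

lemma constant_term_tr: "f \<in> R \<Longrightarrow> constant_term (tr f) = 0"
proof -
  assume "f \<in> R"
  interpret ct: comm_ring_hom constant_term by (rule constant_term_hom)
  have "constant_term ((\<sigma> ^^ k) f) = constant_term f" for k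
  proof (rule hom_eq_on_poly_ring[OF _ constant_term_hom _ _ \<open>f \<in> R\<close>])
    show "comm_ring_hom (\<lambda>f. constant_term ((\<sigma> ^^ k) f))"
      by (rule comm_ring_hom_compose[OF constant_term_hom sigma_pow.comm_ring_hom_axioms])
    have "constant_term ((\<sigma> ^^ k) (var i)) = 0" for i
      by (rule constant_term_form[OF is_form_sigma_pow[OF is_form_var]]) simp
    moreover have "constant_term (var i) = 0" for i
      by (rule constant_term_form[OF is_form_var]) simp
    ultimately show "constant_term ((\<sigma> ^^ k) (var i)) = constant_term (var i)" for i by simp
  qed simp
  then have "constant_term (tr f) = of_nat p * constant_term f" by (simp add: tr_def ct.hom_sum)
  then show ?thesis using of_nat_eq_0[of p] by simp
qed

text \<open>
  It is enough to check the generators of the two parts of the decomposition. The constant term of the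
  first part vanishes because neither a form of positive degree nor a transfer has one.
\<close>

lemma positive_invariant_in_ideal:
  assumes \<Psi>: "comm_ring_hom \<Psi>" and J: "ring_ideal J"
    and "\<Psi> norm_N \<in> J" and "\<Psi> e \<in> J" and tr: "\<And>a i. a \<in> S \<Longrightarrow> \<Psi> (tr (a * N ^ i)) \<in> J"
    and f: "f \<in> invariants" "is_form d f" "d > 0"
  shows "\<Psi> f \<in> J"
proof -
  interpret \<Psi>: comm_ring_hom \<Psi> by fact
  interpret J: ring_ideal J by fact
  interpret ct: comm_ring_hom constant_term by (rule constant_term_hom)
  interpret const: comm_ring_hom "const :: 'f \<Rightarrow> 'f mpoly" by (rule const_hom)
  obtain u v where uv: "u \<in> alg_generated {norm_N, e}" "v \<in> SN" "f = u + tr v"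
    using invariants_decomposition[OF f(1)] by blast
  obtain q where q: "q \<in> coeffs_in S" "v = poly q N" using uv(2) SN_def by auto
  have tr_v: "\<Psi> (tr v) \<in> J"
    using q(1) by (simp add: q(2) poly_altdef tr_sum \<Psi>.hom_sum J.sum tr coeffs_in_def)
  have "\<Psi> u - \<Psi> (const (constant_term u)) \<in> J"
    using uv(1)
  proof induction
    case (const c)
    have "constant_term (const c) = c" by (simp add: constant_term_def id_hom)
    then show ?case by simp
  next
    case (gen b)
    have "constant_term norm_N = 0" "constant_term e = 0"
      using constant_term_form[OF is_form_norm_N] constant_term_form[OF is_form_e] by simp_all
    with gen assms(3,4) show ?case by auto
  next
    case (add g h)
    then have "(\<Psi> g - \<Psi> (const (constant_term g))) + (\<Psi> h - \<Psi> (const (constant_term h))) \<in> J"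
      by (intro J.add)
    then show ?case by (simp add: \<Psi>.hom_add ct.hom_add const.hom_add algebra_simps)
  next
    case (mult g h)
    then show ?case by (simp add: \<Psi>.hom_mult ct.hom_mult const.hom_mult J.cong_mult)
  qed
  moreover have "constant_term u = 0"
  proof -
    have "constant_term f = constant_term u"
      using constant_term_tr[OF SN_in_R[OF uv(2)]] by (simp add: uv(3) ct.hom_add)
    then show ?thesis using constant_term_form f(2,3) by simp
  qed
  ultimately have "\<Psi> u \<in> J" by simp
  then show ?thesis using tr_v J.add by (simp add: uv(3) \<Psi>.hom_add)
qed

text \<open>
  The functional certifies that \<open>T\<close> is not a polynomial in invariants of smaller degree.
\<close>

definition indecomposability_witness :: "nat \<Rightarrow> ('f mpoly \<Rightarrow> 'f) \<Rightarrow> 'f mpoly \<Rightarrow> bool" where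
  "indecomposability_witness d \<phi> T \<longleftrightarrow>
     (\<forall>f g. \<phi> (f + g) = \<phi> f + \<phi> g) \<and> (\<forall>c f. \<phi> (const c * f) = c * \<phi> f) \<and>
     (\<forall>i j f g. f \<in> invariants \<longrightarrow> g \<in> invariants \<longrightarrow> is_form i f \<longrightarrow> is_form j g \<longrightarrow>
        0 < i \<longrightarrow> 0 < j \<longrightarrow> \<phi> (f * g) = 0) \<and>
     T \<in> invariants \<and> is_form d T \<and> \<phi> T \<noteq> 0"

section \<open>Indecomposability of the norm\<close>

text \<open>
  Setting all \<open>y i\<close> to \<open>0\<close> kills \<open>e\<close> and all transfers, and maps the norm to \<open>z^(p^2)\<close>.
\<close>

lemma norm_N_indecomposable: "\<exists>\<phi> T. indecomposability_witness (p ^ 2) \<phi> T"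
proof -
  let ?v = "\<lambda>i. if i = p then [:0, 1:] else 0 :: 'f poly"
  let ?\<Psi> = "evaluate (\<lambda>c. [:c:]) ?v"
  have \<kappa>: "comm_ring_hom (\<lambda>c::'f. [:c:])" by (rule pCons_hom[OF id_hom])
  have \<Psi>hom: "comm_ring_hom ?\<Psi>" by (rule evaluate_hom[OF \<kappa>])
  interpret \<Psi>: comm_ring_hom ?\<Psi> by (rule \<Psi>hom)
  let ?J = "{a. monom 1 (p ^ 2) dvd a} :: 'f poly set"
  have J: "ring_ideal ?J" by unfold_locales auto
  have "i mod p \<noteq> p" for i using mod_less_divisor[OF p_pos, of i] by linarith
  then have y: "?\<Psi> (y i) = 0" for i by (simp add: y_def \<kappa>)
  have s: "?\<Psi> s = 0" by (simp add: s_def \<Psi>.hom_sum y)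
  have M: "?\<Psi> (M i) = 0" for i
    by (simp add: M_def \<Psi>.hom_minus \<Psi>.hom_mult \<Psi>.hom_power y power_0_left)
  have z: "?\<Psi> z = monom 1 1" by (simp add: z_def \<kappa> monom_altdef)
  have N: "?\<Psi> N = monom 1 p"
    using p_gt_1 by (simp add: N_def \<Psi>.hom_minus \<Psi>.hom_mult \<Psi>.hom_power s z power_0_left monom_power)
  have N_pow: "?\<Psi> ((\<sigma> ^^ k) N) = monom 1 p" for k
    by (simp add: sigma_pow_N \<Psi>.hom_add \<Psi>.hom_sum M N)
  have norm: "?\<Psi> norm_N = monom 1 (p ^ 2)"
    by (simp add: norm_N_def \<Psi>.hom_prod N_pow monom_power power2_eq_square)
  have S_inv: "?\<Psi> ((\<sigma> ^^ k) a) = ?\<Psi> a" if "a \<in> S" for k a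
  proof (rule hom_eq_on_poly_ring[OF _ \<Psi>hom _ _ that])
    show "comm_ring_hom (\<lambda>f. ?\<Psi> ((\<sigma> ^^ k) f))"
      by (rule comm_ring_hom_compose[OF \<Psi>hom sigma_pow.comm_ring_hom_axioms])
    fix i assume "i < p"
    then have "var i = y i" by (simp add: y_def)
    then show "?\<Psi> ((\<sigma> ^^ k) (var i)) = ?\<Psi> (var i)" by (simp only: sigma_pow_y y)
  qed simp
  have "?\<Psi> (tr (a * N ^ i)) = 0" if "a \<in> S" for a i
  proof -
    have "?\<Psi> (tr (a * N ^ i)) = of_nat p * (?\<Psi> a * monom 1 p ^ i)"
      by (simp add: tr_def \<Psi>.hom_sum \<Psi>.hom_mult \<Psi>.hom_power sigma_pow.hom_mult sigma_pow.hom_power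
          S_inv[OF that] N_pow)
    also have "(of_nat p :: 'f poly) = 0" using of_nat_eq_0[of p] by (simp add: of_nat_poly)
    finally show ?thesis by simp
  qed
  moreover have "?\<Psi> e = 0" using p_pos by (simp add: e_def \<Psi>.hom_prod y power_0_left)
  ultimately have in_J: "?\<Psi> f \<in> ?J" if "f \<in> invariants" "is_form i f" "i > 0" for f i
    using that by (intro positive_invariant_in_ideal[OF \<Psi>hom J _ _ _ that]) (simp_all add: norm)
  let ?\<phi> = "\<lambda>f. coeff (?\<Psi> f) (p ^ 2)"
  have "indecomposability_witness (p ^ 2) ?\<phi> norm_N"
    unfolding indecomposability_witness_def
  proof (intro conjI allI impI)
    fix i j and f g assume f: "f \<in> invariants" "is_form i f" "0 < i" and g: "g \<in> invariants" "is_form j g" "0 < j"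
    have "monom 1 (p ^ 2) * monom 1 (p ^ 2) dvd ?\<Psi> f * ?\<Psi> g"
      using in_J[OF f] in_J[OF g] by (intro mult_dvd_mono) simp_all
    then have "monom 1 (p ^ 2 + p ^ 2) dvd ?\<Psi> (f * g)" by (simp add: mult_monom \<Psi>.hom_mult)
    then show "?\<phi> (f * g) = 0" using p_pos unfolding monom_1_dvd_iff' by simp
  next
    show "norm_N \<in> invariants"
      using generators_invariant by (auto simp: generators_def intro: alg_generated.gen)
  qed (simp_all add: \<Psi>.hom_add \<Psi>.hom_mult \<kappa> is_form_norm_N norm)
  then show ?thesis by blast
qed

section \<open>An ideal containing the specialised invariants\<close>

text \<open>
  The target of the specialisation is the polynomial ring in \<open>X\<close>, \<open>L\<close> and \<open>T\<close>, from the outer to the inner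
  variable. Here \<open>X\<close> is the image of \<open>z\<close>.
\<close>

abbreviation T_coord :: "'f poly3" where "T_coord \<equiv> [:[:[:0, 1:]:]:]"
abbreviation L_coord :: "'f poly3" where "L_coord \<equiv> [:[:0, 1:]:]"
abbreviation X_coord :: "'f poly3" where "X_coord \<equiv> [:0, 1:]"

text \<open>
  The ideal \<open>(X^(p^2), T^p, L^n)\<close>. The first two generators absorb the leading terms of the images of the norm
  and of \<open>e\<close>.
\<close>

definition truncation :: "nat \<Rightarrow> 'f poly3 set" where
  "truncation n = {a * X_coord ^ (p ^ 2) + b * T_coord ^ p + c * L_coord ^ n |a b c. True}"

lemma truncationI: "f = a * X_coord ^ (p ^ 2) + b * T_coord ^ p + c * L_coord ^ n \<Longrightarrow> f \<in> truncation n"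
  unfolding truncation_def by blast

lemma truncation_ideal: "ring_ideal (truncation n)"
proof
  show "0 \<in> truncation n" by (rule truncationI[of _ 0 0 0]) simp
next
  fix f g assume "f \<in> truncation n" "g \<in> truncation n"
  then obtain a b c a' b' c' where "f = a * X_coord ^ (p ^ 2) + b * T_coord ^ p + c * L_coord ^ n"
    "g = a' * X_coord ^ (p ^ 2) + b' * T_coord ^ p + c' * L_coord ^ n" unfolding truncation_def by blast
  then have "f + g = (a + a') * X_coord ^ (p ^ 2) + (b + b') * T_coord ^ p + (c + c') * L_coord ^ n"
    by (simp only: ring_distribs add_ac)
  then show "f + g \<in> truncation n" by (rule truncationI)
next
  fix f g assume "f \<in> truncation n"
  then obtain a b c where "f = a * X_coord ^ (p ^ 2) + b * T_coord ^ p + c * L_coord ^ n"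
    unfolding truncation_def by blast
  then have "g * f = (g * a) * X_coord ^ (p ^ 2) + (g * b) * T_coord ^ p + (g * c) * L_coord ^ n"
    by (simp only: ring_distribs mult.assoc)
  then show "g * f \<in> truncation n" by (rule truncationI)
qed

lemma X_pow_in_truncation: "f * X_coord ^ (p ^ 2) \<in> truncation n"
  and T_pow_in_truncation: "f * T_coord ^ p \<in> truncation n"
proof -
  show "f * X_coord ^ (p ^ 2) \<in> truncation n" by (rule truncationI[of _ f 0 0]) (simp only: mult_zero_left add_0_right)
  show "f * T_coord ^ p \<in> truncation n" by (rule truncationI[of _ 0 f 0]) (simp only: mult_zero_left add_0_right add_0)
qed

lemma L_pow_in_truncation: "n \<le> k \<Longrightarrow> f * L_coord ^ k \<in> truncation n"
proof -
  assume "n \<le> k"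
  then have "L_coord ^ k = L_coord ^ (k - n) * L_coord ^ n" by (simp flip: power_add)
  then show "f * L_coord ^ k \<in> truncation n"
    by (intro truncationI[of _ 0 0 "f * L_coord ^ (k - n)"]) (simp only: mult_zero_left add_0 mult.assoc)
qed

lemma truncation_mono: "m \<le> n \<Longrightarrow> f \<in> truncation n \<Longrightarrow> f \<in> truncation m"
proof -
  interpret ring_ideal "truncation m" by (rule truncation_ideal)
  assume "m \<le> n" "f \<in> truncation n"
  then show ?thesis
    unfolding truncation_def[of n]
    by (auto simp del: mult_pCons_right mult_pCons_left intro!: add X_pow_in_truncation T_pow_in_truncation L_pow_in_truncation)
qed

lemma truncation_mult:
  assumes "f \<in> truncation m" and "g \<in> truncation n"
  shows "f * g \<in> truncation (m + n)"
proof -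
  interpret ring_ideal "truncation (m + n)" by (rule truncation_ideal)
  obtain a b c where f: "f = a * X_coord ^ (p ^ 2) + b * T_coord ^ p + c * L_coord ^ m"
    using assms(1) unfolding truncation_def by blast
  obtain a' b' c' where g: "g = a' * X_coord ^ (p ^ 2) + b' * T_coord ^ p + c' * L_coord ^ n"
    using assms(2) unfolding truncation_def by blast
  have id: "(a * X + b * T + c * l) * (a' * X + b' * T + c' * l') =
    (a * (a' * X + b' * T + c' * l') + c * l * a') * X + (b * (a' * X + b' * T + c' * l') + c * l * b') * T + (c * c') * (l * l')"
    for X T l l' :: "'f poly3"
    by (simp add: algebra_simps)
  show ?thesis
    by (rule truncationI) (simp only: f g id power_add)
qed

text \<open>
  The coefficient of \<open>X^(p(p-1)) L^(2p-3) T^(p-1)\<close>, a monomial just outside the ideal with \<open>n = 2p - 2\<close>.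
\<close>

definition top_coeff :: "'f poly3 \<Rightarrow> 'f" where
  "top_coeff f = coeff (coeff (coeff f (p * (p - 1))) (2 * p - 3)) (p - 1)"

lemma top_coeff_add: "top_coeff (f + g) = top_coeff f + top_coeff g"
  by (simp add: top_coeff_def)

lemma coeff_mult_X_power_low: "k < n \<Longrightarrow> coeff (f * [:0, 1:] ^ n) k = 0" for f :: "'a::comm_ring_1 poly"
  using coeff_monom_mult[of 1 n f k] by (simp add: monom_altdef mult.commute)

lemma top_coeff_truncation:
  assumes "f \<in> truncation (2 * p - 2)" shows "top_coeff f = 0"
proof -
  obtain a b c where f: "f = a * X_coord ^ (p ^ 2) + b * T_coord ^ p + c * L_coord ^ (2 * p - 2)"
    using assms unfolding truncation_def by blast
  have "p * (p - 1) < p ^ 2" using p_gt_1 by (simp add: power2_eq_square)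
  then have "top_coeff (a * X_coord ^ (p ^ 2)) = 0"
    by (simp only: top_coeff_def coeff_mult_X_power_low) simp
  moreover have "top_coeff (b * T_coord ^ p) = 0"
  proof -
    have "coeff (coeff (b * [:[:[:0, 1:] ^ p:]:]) i) j = coeff (coeff b i) j * [:0, 1:] ^ p" for i j
      by (simp add: mult.commute[of _ "pCons _ _"])
    then show ?thesis
      by (simp only: top_coeff_def poly_const_pow) (rule coeff_mult_X_power_low, use p_gt_1 in simp)
  qed
  moreover have "top_coeff (c * L_coord ^ (2 * p - 2)) = 0"
  proof -
    have "coeff (c * [:[:0, 1:] ^ (2 * p - 2):]) i = coeff c i * [:0, 1:] ^ (2 * p - 2)" for i
      by (simp add: mult.commute[of _ "pCons _ _"])
    moreover have "2 * p - 3 < 2 * p - 2" using p_gt_1 by simp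
    ultimately show ?thesis
      by (simp only: top_coeff_def poly_const_pow coeff_mult_X_power_low) simp
  qed
  ultimately show ?thesis by (simp only: f top_coeff_add) simp
qed

definition scalar :: "'f \<Rightarrow> 'f poly3" where "scalar c = [:[:[:c:]:]:]"

lemma scalar_hom: "comm_ring_hom scalar"
  unfolding scalar_def by (intro pCons_hom id_hom)

lemma scalar_of_nat: "scalar (of_nat k) = of_nat k"
  by (simp add: scalar_def of_nat_poly)

text \<open>
  The images of the \<open>y i\<close> are the points with parameter \<open>i * L\<close> on this curve. Its derivative has a linear
  and a quadratic term, so that the images of \<open>u1\<close> below are combinations of \<open>L^2\<close> and \<open>L^3\<close>. A product
  of \<open>p - 2\<close> factors \<open>L^2\<close> or \<open>L^3\<close> has exponent \<open>2p - 3\<close> if exactly one factor is \<open>L^3\<close>.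
\<close>

definition curve :: "'f poly3 \<Rightarrow> 'f poly3" where
  "curve w = T_coord + w ^ 2 + w ^ 3"

definition \<Psi> :: "'f mpoly \<Rightarrow> 'f poly3" where
  "\<Psi> = evaluate scalar (\<lambda>i. if i < p then curve (of_nat i * L_coord) else if i = p then X_coord else 0)"

lemma \<Psi>_hom: "comm_ring_hom \<Psi>"
  unfolding \<Psi>_def by (rule evaluate_hom[OF scalar_hom])

lemma \<Psi>_const: "\<Psi> (const c) = scalar c"
  by (simp add: \<Psi>_def scalar_hom)

lemma of_nat_mod_p_poly: "(of_nat (m mod p) :: 'f poly3) = of_nat m"
  by (simp only: scalar_of_nat[symmetric] of_nat_mod_p)

lemma \<Psi>_y: "\<Psi> (y i) = curve (of_nat i * L_coord)"
proof -
  have "\<Psi> (y i) = curve (of_nat (i mod p) * L_coord)"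
    by (simp add: \<Psi>_def y_def scalar_hom del: mult_pCons_right mult_pCons_left)
  then show ?thesis by (simp only: of_nat_mod_p_poly)
qed

lemma \<Psi>_z: "\<Psi> z = X_coord"
  by (simp add: \<Psi>_def z_def scalar_hom)

lemma power_sum_poly:
  "(\<Sum>k<p. (of_nat k :: 'f poly3) ^ n) = scalar (\<Sum>k<p. of_nat k ^ n)"
proof -
  interpret scalar: comm_ring_hom scalar by (rule scalar_hom)
  show ?thesis by (simp only: scalar.hom_sum scalar.hom_power scalar_of_nat)
qed

lemma power_sum_poly_eq_0: "n < p - 1 \<Longrightarrow> (\<Sum>k<p. (of_nat k :: 'f poly3) ^ n) = 0"
proof -
  interpret scalar: comm_ring_hom scalar by (rule scalar_hom)
  assume "n < p - 1"
  then show ?thesis by (simp only: power_sum_poly power_sum_eq_0 scalar.hom_zero)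
qed

lemma power_sum_poly_eq_minus_1: "(\<Sum>k<p. (of_nat k :: 'f poly3) ^ (p - 1)) = - 1"
proof -
  interpret scalar: comm_ring_hom scalar by (rule scalar_hom)
  show ?thesis
    by (simp only: power_sum_poly power_sum_eq_minus_1 scalar.hom_uminus scalar.hom_one)
qed

text \<open>
  For \<open>p \<ge> 5\<close> the degree of the curve is smaller than \<open>p - 1\<close>, and the power sums vanish.
\<close>

lemma \<Psi>_s:
  assumes "p \<ge> 5" shows "\<Psi> s = 0"
proof -
  interpret \<Psi>: comm_ring_hom \<Psi> by (rule \<Psi>_hom)
  have "\<Psi> s = (\<Sum>i<p. curve (of_nat i * L_coord))" by (simp only: s_def \<Psi>.hom_sum \<Psi>_y)
  also have "\<dots> = (\<Sum>i<p. of_nat i ^ 0) * T_coord + (\<Sum>i<p. of_nat i ^ 2) * L_coord ^ 2 +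
      (\<Sum>i<p. of_nat i ^ 3) * L_coord ^ 3"
    by (simp only: curve_def power_mult_distrib sum.distrib sum_distrib_right power_0 mult_1)
  also have "\<dots> = 0" using assms by (simp only: power_sum_poly_eq_0) simp
  finally show ?thesis .
qed

lemma \<Psi>_N: "p \<ge> 5 \<Longrightarrow> \<Psi> N = X_coord ^ p"
proof -
  interpret \<Psi>: comm_ring_hom \<Psi> by (rule \<Psi>_hom)
  assume "p \<ge> 5"
  then show ?thesis
    by (simp only: N_def \<Psi>.hom_minus \<Psi>.hom_mult \<Psi>.hom_power \<Psi>_s \<Psi>_z power_0_left) (use p_gt_2 in simp)
qed

lemma \<Psi>_M:
  assumes "p \<ge> 5" shows "\<Psi> (M i) \<in> truncation (2 * p - 2)"
proof -
  interpret \<Psi>: comm_ring_hom \<Psi> by (rule \<Psi>_hom)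
  interpret J: ring_ideal "truncation (2 * p - 2)" by (rule truncation_ideal)
  have "\<Psi> (M i) = curve (of_nat i * L_coord) ^ p"
    by (simp only: M_def \<Psi>.hom_minus \<Psi>.hom_mult \<Psi>.hom_power \<Psi>_s[OF assms] \<Psi>_y power_0_left)
      (use p_gt_2 in simp)
  also have "\<dots> = T_coord ^ p + ((of_nat i * L_coord) ^ 2) ^ p + ((of_nat i * L_coord) ^ 3) ^ p"
    unfolding curve_def
    by (subst freshmans_dream, simp add: char_p prime_p, simp add: char_p)+ rule
  also have "\<dots> = 1 * T_coord ^ p + of_nat i ^ (2 * p) * L_coord ^ (2 * p) + of_nat i ^ (3 * p) * L_coord ^ (3 * p)"
    by (simp only: power_mult_distrib power_mult mult_1)
  also have "\<dots> \<in> truncation (2 * p - 2)"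
    by (intro J.add T_pow_in_truncation L_pow_in_truncation) auto
  finally show ?thesis .
qed

lemma \<Psi>_sigma_pow_N:
  assumes "p \<ge> 5" shows "\<Psi> ((\<sigma> ^^ k) N) - X_coord ^ p \<in> truncation (2 * p - 2)"
proof -
  interpret \<Psi>: comm_ring_hom \<Psi> by (rule \<Psi>_hom)
  interpret J: ring_ideal "truncation (2 * p - 2)" by (rule truncation_ideal)
  have "\<Psi> ((\<sigma> ^^ k) N) - X_coord ^ p = (\<Sum>i<k. \<Psi> (M i))"
    by (simp only: sigma_pow_N \<Psi>.hom_add \<Psi>.hom_sum \<Psi>_N[OF assms] add_diff_cancel_left')
  also have "\<dots> \<in> truncation (2 * p - 2)" by (intro J.sum \<Psi>_M[OF assms])
  finally show ?thesis .
qed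

text \<open>
  Modulo the ideal, all conjugates of \<open>N\<close> have the image \<open>X^p\<close>, so the norm becomes \<open>X^(p^2)\<close>.
\<close>

lemma \<Psi>_norm_N:
  assumes "p \<ge> 5" shows "\<Psi> norm_N \<in> truncation (2 * p - 2)"
proof -
  interpret \<Psi>: comm_ring_hom \<Psi> by (rule \<Psi>_hom)
  interpret J: ring_ideal "truncation (2 * p - 2)" by (rule truncation_ideal)
  have "(\<Prod>k<p. \<Psi> ((\<sigma> ^^ k) N)) - (\<Prod>k<p. X_coord ^ p) \<in> truncation (2 * p - 2)"
    by (rule J.cong_prod) (rule \<Psi>_sigma_pow_N[OF assms])
  moreover have "(\<Prod>k<p. X_coord ^ p) = 1 * X_coord ^ (p ^ 2)"
    by (simp only: prod_constant card_lessThan mult_1 power2_eq_square power_mult)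
  ultimately show ?thesis
    unfolding norm_N_def \<Psi>.hom_prod
    using J.add[OF _ X_pow_in_truncation[of 1]] by (metis diff_add_cancel)
qed

lemma \<Psi>_tr:
  assumes "p \<ge> 5" and "a \<in> S"
  shows "\<Psi> (tr (a * N ^ i)) - (\<Sum>k<p. \<Psi> ((\<sigma> ^^ k) a)) * X_coord ^ (p * i) \<in> truncation (2 * p - 2)"
proof -
  interpret \<Psi>: comm_ring_hom \<Psi> by (rule \<Psi>_hom)
  interpret J: ring_ideal "truncation (2 * p - 2)" by (rule truncation_ideal)
  have "\<Psi> (tr (a * N ^ i)) - (\<Sum>k<p. \<Psi> ((\<sigma> ^^ k) a)) * X_coord ^ (p * i) =
    (\<Sum>k<p. \<Psi> ((\<sigma> ^^ k) a) * (\<Psi> ((\<sigma> ^^ k) N) ^ i - (X_coord ^ p) ^ i))"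
    by (simp only: tr_def \<Psi>.hom_sum \<Psi>.hom_mult \<Psi>.hom_power sigma_pow.hom_mult sigma_pow.hom_power
        sum_distrib_right sum_subtractf[symmetric] right_diff_distrib power_mult)
  also have "\<dots> \<in> truncation (2 * p - 2)"
    by (intro J.sum J.mult J.cong_power \<Psi>_sigma_pow_N[OF assms(1)])
  finally show ?thesis .
qed

text \<open>
  Along an orbit the specialised variables lie on a polynomial curve with parameter \<open>k * L\<close>; summing
  over \<open>k\<close> kills all powers of the parameter below \<open>p - 1\<close>.
\<close>

lemma \<Psi>_orbit:
  assumes "f \<in> S"
  shows "\<exists>Q. \<forall>k. \<Psi> ((\<sigma> ^^ k) f) = poly Q (of_nat k * L_coord)"
proof -
  (* The parameter k * L is made a variable, so that one polynomial serves for all k. *)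
  let ?w = "\<lambda>i. [:of_nat i * L_coord, 1:]"
  let ?P = "evaluate (\<lambda>c. [:scalar c:]) (\<lambda>i. [:T_coord:] + ?w i ^ 2 + ?w i ^ 3)"
  have \<kappa>: "comm_ring_hom (\<lambda>c. [:scalar c:])" by (rule pCons_hom[OF scalar_hom])
  have P: "comm_ring_hom ?P" by (rule evaluate_hom[OF \<kappa>])
  interpret P: comm_ring_hom ?P by (rule P)
  have "\<Psi> ((\<sigma> ^^ k) f) = poly (?P f) (of_nat k * L_coord)" for k
  proof (rule hom_eq_on_poly_ring[OF _ _ _ _ assms])
    show "comm_ring_hom (\<lambda>f. \<Psi> ((\<sigma> ^^ k) f))"
      by (rule comm_ring_hom_compose[OF \<Psi>_hom sigma_pow.comm_ring_hom_axioms])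
    show "comm_ring_hom (\<lambda>f. poly (?P f) (of_nat k * L_coord))"
      by standard (simp_all only: P.hom_zero P.hom_one P.hom_add P.hom_mult poly_0 poly_1 poly_add poly_mult)
    show "\<Psi> ((\<sigma> ^^ k) (const c)) = poly (?P (const c)) (of_nat k * L_coord)" for c
      by (simp only: sigma_pow_const \<Psi>_const evaluate_const[OF \<kappa>]) simp
    fix i assume "i < p"
    then have "\<Psi> ((\<sigma> ^^ k) (var i)) = curve (of_nat (i + k) * L_coord)"
      using sigma_pow_y[of k i] \<Psi>_y[of "i + k"] by (simp add: y_def)
    also have "of_nat (i + k) * L_coord = poly (?w i) (of_nat k * L_coord)"
      by (simp add: algebra_simps del: mult_pCons_right mult_pCons_left)
    finally show "\<Psi> ((\<sigma> ^^ k) (var i)) = poly (?P (var i)) (of_nat k * L_coord)"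
      by (simp only: evaluate_var[OF \<kappa>] curve_def poly_add poly_power) simp
  qed
  then show ?thesis by blast
qed

lemma sum_over_curve: "(\<Sum>k<p. poly Q (of_nat k * L_coord)) \<in> truncation (p - 1)"
proof -
  interpret J: ring_ideal "truncation (p - 1)" by (rule truncation_ideal)
  have "(\<Sum>k<p. poly Q (of_nat k * L_coord)) =
    (\<Sum>j\<le>degree Q. (coeff Q j * (\<Sum>k<p. of_nat k ^ j)) * L_coord ^ j)"
    by (simp only: poly_altdef power_mult_distrib sum_distrib_left sum_distrib_right mult.assoc) (rule sum.swap)
  also have "\<dots> \<in> truncation (p - 1)"
  proof (rule J.sum)
    fix j
    show "(coeff Q j * (\<Sum>k<p. of_nat k ^ j)) * L_coord ^ j \<in> truncation (p - 1)"
    proof (cases "j < p - 1")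
      case True
      then show ?thesis by (simp only: power_sum_poly_eq_0 mult_zero_right mult_zero_left J.zero)
    next
      case False
      then show ?thesis by (intro L_pow_in_truncation) simp
    qed
  qed
  finally show ?thesis .
qed

lemma \<Psi>_tr_in_truncation:
  assumes "p \<ge> 5" and "a \<in> S" shows "\<Psi> (tr (a * N ^ i)) \<in> truncation (p - 1)"
proof -
  interpret J: ring_ideal "truncation (p - 1)" by (rule truncation_ideal)
  obtain Q where "\<And>k. \<Psi> ((\<sigma> ^^ k) a) = poly Q (of_nat k * L_coord)" using \<Psi>_orbit[OF assms(2)] by blast
  then have "X_coord ^ (p * i) * (\<Sum>k<p. \<Psi> ((\<sigma> ^^ k) a)) \<in> truncation (p - 1)"
    by (simp only: J.mult sum_over_curve)
  moreover have "\<Psi> (tr (a * N ^ i)) - (\<Sum>k<p. \<Psi> ((\<sigma> ^^ k) a)) * X_coord ^ (p * i) \<in> truncation (p - 1)"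
    by (rule truncation_mono[OF _ \<Psi>_tr[OF assms]]) simp
  ultimately show ?thesis
    using J.add by (metis diff_add_cancel mult.commute)
qed

text \<open>
  Multiplying the parameter by an element of the prime field permutes the factors of the image
  of \<open>e\<close>, so only powers of the parameter with exponent divisible by \<open>p - 1\<close> occur.
\<close>

lemma \<Psi>_e: "\<Psi> e \<in> truncation (p - 1)"
proof -
  interpret \<Psi>: comm_ring_hom \<Psi> by (rule \<Psi>_hom)
  interpret J: ring_ideal "truncation (p - 1)" by (rule truncation_ideal)
  let ?G = "\<lambda>w. [:[:0, 1:]:] + w ^ 2 + w ^ 3 :: 'f poly poly"
  define E where "E = (\<Prod>i<p. ?G (of_nat i * [:0, 1:]))"
  define emb where "emb = (\<lambda>f::'f poly poly. [:f:])"
  have "comm_ring_hom emb" by standard (simp_all add: emb_def one_pCons)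
  then interpret emb: comm_ring_hom emb .
  have L: "L_coord = emb [:0, 1:]" and T: "T_coord = emb [:[:0, 1:]:]" by (simp_all add: emb_def)
  have \<Psi>_e: "\<Psi> e = emb E"
    unfolding e_def \<Psi>.hom_prod E_def emb.hom_prod
    by (simp only: \<Psi>_y curve_def L T emb.hom_add emb.hom_power emb.hom_mult emb.hom_of_nat)
  have low: "coeff E n = 0" if "0 < n" "n < p - 1" for n
  proof -
    obtain c where c: "c \<in> {1..<p}" "(of_nat c :: 'f) ^ n \<noteq> 1" using exists_pow_neq_1[OF \<open>0 < n\<close> \<open>n < p - 1\<close>] by blast
    have of_nat_c: "(of_nat k :: 'f poly poly) = [:[:of_nat k:]:]" for k by (simp add: of_nat_poly)
    have "pcompose E [:0, of_nat c:] = (\<Prod>i<p. ?G (of_nat (c * i mod p) * [:0, 1:]))"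
      unfolding E_def pcompose_prod
    proof (rule prod.cong)
      fix i
      have pow: "pcompose (w ^ j) r = pcompose w r ^ j" for w r :: "'f poly poly" and j
        by (induction j) (simp_all add: pcompose_1 pcompose_mult)
      have "pcompose (of_nat i * [:0, 1:]) [:0, of_nat c:] = of_nat i * (of_nat c * [:0, 1 :: 'f poly:])"
        by (simp add: of_nat_c pcompose_pCons pcompose_mult of_nat_poly)
      also have "\<dots> = of_nat (c * i mod p) * [:0, 1:]"
      proof -
        have "(of_nat (c * i mod p) :: 'f poly poly) = of_nat (c * i)" by (simp only: of_nat_c of_nat_mod_p)
        then show ?thesis by (simp add: mult_ac)
      qed
      finally have w: "pcompose (of_nat i * [:0, 1:]) [:0, of_nat c:] = of_nat (c * i mod p) * [:0, 1 :: 'f poly:]" .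
      show "pcompose (?G (of_nat i * [:0, 1:])) [:0, of_nat c:] = ?G (of_nat (c * i mod p) * [:0, 1:])"
        by (simp only: pcompose_add pow w pcompose_const)
    qed simp
    also have "\<dots> = E"
      unfolding E_def by (rule prod.reindex_bij_betw[OF mult_permutes[OF c(1)]])
    finally have "coeff (pcompose E [:0, of_nat c:]) n = coeff E n" by simp
    then have "of_nat c ^ n * coeff E n = coeff E n" by (simp only: coeff_pcompose_linear)
    then have "(of_nat c ^ n - 1) * coeff E n = 0" by (simp only: left_diff_distrib mult_1 diff_self)
    moreover have "(of_nat c :: 'f poly) ^ n - 1 \<noteq> 0"
      using c(2) by (simp add: of_nat_poly poly_const_pow one_pCons)
    ultimately show ?thesis by simp
  qed
  have E0: "coeff E 0 = [:0, 1:] ^ p"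
    by (simp only: E_def poly_0_coeff_0[symmetric] poly_prod) simp
  have "monom 1 (p - 1) dvd E - [:coeff E 0:]"
    unfolding monom_1_dvd_iff'
  proof (intro allI impI)
    fix k assume "k < p - 1"
    then show "coeff (E - [:coeff E 0:]) k = 0" using low[of k] by (cases k) simp_all
  qed
  then obtain F where "E - [:coeff E 0:] = monom 1 (p - 1) * F" by blast
  then have "E = [:coeff E 0:] + monom 1 (p - 1) * F" by (simp only: diff_eq_eq add.commute)
  moreover have "[:coeff E 0:] = [:[:0, 1:]:] ^ p" by (simp only: E0 poly_const_pow)
  moreover have "monom 1 (p - 1) = ([:0, 1:] :: 'f poly poly) ^ (p - 1)"
    by (simp add: monom_altdef del: power_Suc)
  ultimately have "E = [:[:0, 1:]:] ^ p + F * [:0, 1:] ^ (p - 1)" by (metis mult.commute)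
  then have "\<Psi> e = 1 * T_coord ^ p + emb F * L_coord ^ (p - 1)"
    by (simp only: \<Psi>_e L T emb.hom_add emb.hom_mult emb.hom_power mult_1)
  then show ?thesis by (simp only: J.add T_pow_in_truncation L_pow_in_truncation order_refl)
qed

lemma positive_invariant_in_truncation:
  assumes "p \<ge> 5" and "f \<in> invariants" "is_form d f" "d > 0"
  shows "\<Psi> f \<in> truncation (p - 1)"
proof (rule positive_invariant_in_ideal[OF \<Psi>_hom truncation_ideal _ \<Psi>_e _ assms(2-4)])
  show "\<Psi> norm_N \<in> truncation (p - 1)" by (rule truncation_mono[OF _ \<Psi>_norm_N[OF assms(1)]]) simp
  show "\<Psi> (tr (a * N ^ i)) \<in> truncation (p - 1)" if "a \<in> S" for a i
    by (rule \<Psi>_tr_in_truncation[OF assms(1) that])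
qed

section \<open>An indecomposable transfer\<close>

definition u1 :: "'f mpoly" where
  "u1 = (\<Sum>j<p. const (- (of_nat j ^ (p - 2))) * y j)"

lemma u1_in_S [simp]: "u1 \<in> S" by (simp add: u1_def)

lemma is_form_u1: "is_form 1 u1"
  unfolding u1_def by (rule is_form_sum) (simp add: is_form_mult_const)

lemma power_sums_at_least_p_minus_2:
  assumes "p \<ge> 5"
  shows "(\<Sum>j<p. (of_nat j :: 'f poly3) ^ (p - 2)) = 0"
    and "(\<Sum>j<p. (of_nat j :: 'f poly3) ^ (p - 2) * of_nat j) = - 1"
    and "(\<Sum>j<p. (of_nat j :: 'f poly3) ^ (p - 2) * of_nat j ^ 2) = 0"
    and "(\<Sum>j<p. (of_nat j :: 'f poly3) ^ (p - 2) * of_nat j ^ 3) = 0"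
proof -
  interpret scalar: comm_ring_hom scalar by (rule scalar_hom)
  show "(\<Sum>j<p. (of_nat j :: 'f poly3) ^ (p - 2)) = 0"
    by (rule power_sum_poly_eq_0) (use assms in simp)
  have "p - 1 = Suc (p - 2)" using assms by simp
  then show "(\<Sum>j<p. (of_nat j :: 'f poly3) ^ (p - 2) * of_nat j) = - 1"
    using power_sum_poly_eq_minus_1 by (simp only: power_Suc2)
  have pow_p: "(of_nat j :: 'f poly3) ^ p = of_nat j" for j
    by (simp only: scalar_of_nat[symmetric] scalar.hom_power[symmetric] of_nat_pow_p)
  have "(of_nat j :: 'f poly3) ^ (p - 2) * of_nat j ^ 2 = of_nat j ^ 1" for j
  proof -
    have "p - 2 + 2 = p" using assms by simp
    then have "(of_nat j :: 'f poly3) ^ (p - 2) * of_nat j ^ 2 = of_nat j ^ p"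
      by (simp only: power_add[symmetric])
    then show ?thesis by (simp only: power_one_right pow_p)
  qed
  then show "(\<Sum>j<p. (of_nat j :: 'f poly3) ^ (p - 2) * of_nat j ^ 2) = 0"
    using power_sum_poly_eq_0[of 1] assms by simp
  have "(of_nat j :: 'f poly3) ^ (p - 2) * of_nat j ^ 3 = of_nat j ^ 2" for j
  proof -
    have "p - 2 + 3 = Suc p" using assms by simp
    then have "(of_nat j :: 'f poly3) ^ (p - 2) * of_nat j ^ 3 = of_nat j ^ Suc p"
      by (simp only: power_add[symmetric])
    then show ?thesis by (simp only: power_Suc pow_p power2_eq_square)
  qed
  then show "(\<Sum>j<p. (of_nat j :: 'f poly3) ^ (p - 2) * of_nat j ^ 3) = 0"
    using power_sum_poly_eq_0[of 2] assms by simp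
qed

text \<open>The coefficients in \<open>u1\<close> are chosen to pick out the derivative of the curve.\<close>

lemma \<Psi>_sigma_pow_u1:
  assumes "p \<ge> 5"
  shows "\<Psi> ((\<sigma> ^^ k) u1) = 2 * of_nat k * L_coord ^ 2 + 3 * of_nat k ^ 2 * L_coord ^ 3"
proof -
  interpret \<Psi>: comm_ring_hom \<Psi> by (rule \<Psi>_hom)
  interpret scalar: comm_ring_hom scalar by (rule scalar_hom)
  define K where "K = (of_nat k :: 'f poly3)"
  define L where "L = L_coord"
  define T where "T = T_coord"
  define c where "c j = (of_nat j :: 'f poly3) ^ (p - 2)" for j
  have "\<Psi> ((\<sigma> ^^ k) u1) = (\<Sum>j<p. - (c j * (T + (of_nat j * L + K * L) ^ 2 + (of_nat j * L + K * L) ^ 3)))"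
    by (simp only: u1_def sigma_pow.hom_sum sigma_pow.hom_mult sigma_pow_const sigma_pow_y \<Psi>.hom_sum
        \<Psi>.hom_mult \<Psi>_const \<Psi>_y curve_def scalar.hom_uminus scalar.hom_power scalar_of_nat of_nat_add
        ring_distribs(2) K_def[symmetric] L_def[symmetric] T_def[symmetric] c_def mult_minus_left)
  also have "\<dots> = (\<Sum>j<p. - (c j * (T + K ^ 2 * L ^ 2 + K ^ 3 * L ^ 3)
      + (c j * of_nat j) * (2 * K * L ^ 2 + 3 * K ^ 2 * L ^ 3)
      + (c j * of_nat j ^ 2) * (L ^ 2 + 3 * K * L ^ 3) + (c j * of_nat j ^ 3) * L ^ 3))"
  proof (rule sum.cong)
    fix j
    have "- (C * (T + (J * L + K * L) ^ 2 + (J * L + K * L) ^ 3)) =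
      - (C * (T + K ^ 2 * L ^ 2 + K ^ 3 * L ^ 3) + (C * J) * (2 * K * L ^ 2 + 3 * K ^ 2 * L ^ 3)
      + (C * J ^ 2) * (L ^ 2 + 3 * K * L ^ 3) + (C * J ^ 3) * L ^ 3)" for C J
      by (simp add: algebra_simps power2_eq_square power3_eq_cube)
    then show "- (c j * (T + (of_nat j * L + K * L) ^ 2 + (of_nat j * L + K * L) ^ 3)) =
      - (c j * (T + K ^ 2 * L ^ 2 + K ^ 3 * L ^ 3) + (c j * of_nat j) * (2 * K * L ^ 2 + 3 * K ^ 2 * L ^ 3)
      + (c j * of_nat j ^ 2) * (L ^ 2 + 3 * K * L ^ 3) + (c j * of_nat j ^ 3) * L ^ 3)" .
  qed simp
  also have "\<dots> = - ((\<Sum>j<p. c j) * (T + K ^ 2 * L ^ 2 + K ^ 3 * L ^ 3)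
      + (\<Sum>j<p. c j * of_nat j) * (2 * K * L ^ 2 + 3 * K ^ 2 * L ^ 3)
      + (\<Sum>j<p. c j * of_nat j ^ 2) * (L ^ 2 + 3 * K * L ^ 3) + (\<Sum>j<p. c j * of_nat j ^ 3) * L ^ 3)"
    by (simp only: sum_negf sum.distrib sum_distrib_right)
  also have "\<dots> = 2 * K * L ^ 2 + 3 * K ^ 2 * L ^ 3"
    unfolding c_def power_sums_at_least_p_minus_2[OF assms] by simp
  finally show ?thesis unfolding K_def L_def .
qed

text \<open>
  Its degree is \<open>(p - 1) + (p - 2) + p (p - 1)\<close>.
\<close>

definition top_transfer :: "'f mpoly" where
  "top_transfer = tr (y 0 ^ (p - 1) * u1 ^ (p - 2) * N ^ (p - 1))"

lemma top_transfer_invariant: "top_transfer \<in> invariants"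
  by (simp add: top_transfer_def invariants_def SN_mult_N tr_in_R S_subset_R)

lemma is_form_top_transfer: "is_form (p ^ 2 + p - 3) top_transfer"
proof -
  have "is_form ((p - 1) * 1 + (p - 2) * 1 + (p - 1) * p) top_transfer"
    unfolding top_transfer_def
    by (intro is_form_tr is_form_mult is_form_power is_form_u1 is_form_N) (simp add: is_form_y)
  moreover have "(p - 1) * 1 + (p - 2) * 1 + (p - 1) * p = p * (p - 1) + (2 * p - 3)"
    using p_gt_2 by (simp add: mult.commute)
  ultimately show ?thesis by (simp only: degree_bound)
qed

text \<open>
  The image of each summand of the transfer contains the factor \<open>L^(2p-4)\<close> from the power of \<open>u1\<close>, so the rest matters only
  up to first order in \<open>L\<close>. The zeroth order term has the factor \<open>k^(p-2)\<close> and the first order term \<open>k^(p-1)\<close>; summing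
  over \<open>k\<close> kills the former and turns the latter into \<open>-1\<close>.
\<close>

lemma \<Psi>_top_transfer:
  assumes "p \<ge> 5"
  defines "c \<equiv> - (of_nat (p - 2) * 2 ^ (p - 3) * 3) :: 'f"
  shows "\<Psi> top_transfer - scalar c * T_coord ^ (p - 1) * L_coord ^ (2 * p - 3) * X_coord ^ (p * (p - 1))
    \<in> truncation (2 * p - 2)"
proof -
  interpret \<Psi>: comm_ring_hom \<Psi> by (rule \<Psi>_hom)
  interpret scalar: comm_ring_hom scalar by (rule scalar_hom)
  interpret J: ring_ideal "truncation (2 * p - 2)" by (rule truncation_ideal)
  define L where "L = L_coord"
  define T where "T = T_coord"
  let ?a = "y 0 ^ (p - 1) * u1 ^ (p - 2)"
  define A where "A k = (of_nat k ^ (p - 2) * 2 ^ (p - 2) + of_nat k ^ (p - 1) * (of_nat (p - 2) * 2 ^ (p - 3) * 3) * L) *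
      (T ^ (p - 1) * L ^ (2 * p - 4))" for k
  have term_k: "\<Psi> ((\<sigma> ^^ k) ?a) - A k \<in> truncation (2 * p - 2)" for k
  proof -
    define K where "K = (of_nat k :: 'f poly3)"
    have "\<exists>r. (T + L ^ 2 * (K ^ 2 + K ^ 3 * L)) ^ Suc (p - 2) = T ^ Suc (p - 2) + L ^ 2 * r"
    proof -
      obtain r where "(T + L ^ 2 * (K ^ 2 + K ^ 3 * L)) ^ Suc (p - 2) = T ^ Suc (p - 2) +
          of_nat (Suc (p - 2)) * T ^ (p - 2) * (L ^ 2 * (K ^ 2 + K ^ 3 * L)) + (L ^ 2 * (K ^ 2 + K ^ 3 * L)) ^ 2 * r"
        using first_order_expansion by blast
      also have "\<dots> = T ^ Suc (p - 2) + L ^ 2 * (of_nat (Suc (p - 2)) * T ^ (p - 2) * (K ^ 2 + K ^ 3 * L) +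
          L ^ 2 * (K ^ 2 + K ^ 3 * L) ^ 2 * r)"
        by (simp only: power2_eq_square ring_distribs mult_ac add_ac)
      finally show ?thesis by blast
    qed
    then obtain r where r: "(T + L ^ 2 * (K ^ 2 + K ^ 3 * L)) ^ (p - 1) = T ^ (p - 1) + L ^ 2 * r"
      using assms(1) by (metis One_nat_def Suc_1 Suc_diff_Suc Suc_le_eq diff_Suc_1 numeral_le_one_iff p_gt_1 p_gt_2)
    obtain q where "(2 + 3 * K * L) ^ Suc (p - 3) = 2 ^ Suc (p - 3) + of_nat (Suc (p - 3)) * 2 ^ (p - 3) * (3 * K * L) +
        (3 * K * L) ^ 2 * q" using first_order_expansion by blast
    moreover have "Suc (p - 3) = p - 2" using assms(1) by simp
    ultimately have q: "(2 + 3 * K * L) ^ (p - 2) = 2 ^ (p - 2) + of_nat (p - 2) * 2 ^ (p - 3) * (3 * K * L) +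
        (3 * K * L) ^ 2 * q" by simp
    have y0: "\<Psi> ((\<sigma> ^^ k) (y 0)) = T + L ^ 2 * (K ^ 2 + K ^ 3 * L)"
    proof -
      have "\<Psi> ((\<sigma> ^^ k) (y 0)) = T + (K * L) ^ 2 + (K * L) ^ 3"
        by (simp only: sigma_pow_y \<Psi>_y curve_def K_def L_def T_def add_0)
      also have "\<dots> = T + L ^ 2 * (K ^ 2 + K ^ 3 * L)"
        by (simp add: algebra_simps power2_eq_square power3_eq_cube)
      finally show ?thesis .
    qed
    have u1: "\<Psi> ((\<sigma> ^^ k) u1) = L ^ 2 * K * (2 + 3 * K * L)"
    proof -
      have "\<Psi> ((\<sigma> ^^ k) u1) = 2 * K * L ^ 2 + 3 * K ^ 2 * L ^ 3"
        by (simp only: \<Psi>_sigma_pow_u1[OF assms(1)] K_def L_def)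
      also have "\<dots> = L ^ 2 * K * (2 + 3 * K * L)"
        by (simp add: algebra_simps power2_eq_square power3_eq_cube)
      finally show ?thesis .
    qed
    have L_pow: "(L ^ 2) ^ (p - 2) = L ^ (2 * p - 4)"
    proof -
      have "2 * (p - 2) = 2 * p - 4" by simp
      then show ?thesis by (simp only: power_mult[symmetric])
    qed
    have K_pow: "K ^ (p - 2) * K = K ^ (p - 1)"
    proof -
      have "p - 1 = Suc (p - 2)" using assms(1) by simp
      then show ?thesis by (simp only: power_Suc2)
    qed
    have eq: "\<Psi> ((\<sigma> ^^ k) ?a) = (T ^ (p - 1) + L ^ 2 * r) * (L ^ (2 * p - 4) * K ^ (p - 2) *
        (2 ^ (p - 2) + of_nat (p - 2) * 2 ^ (p - 3) * (3 * K * L) + (3 * K * L) ^ 2 * q))"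
      by (simp only: sigma_pow.hom_mult sigma_pow.hom_power \<Psi>.hom_mult \<Psi>.hom_power y0 u1 r
          power_mult_distrib[of "L ^ 2 * K"] power_mult_distrib[of "L ^ 2" K "p - 2"] L_pow q)
    have "\<Psi> ((\<sigma> ^^ k) ?a) - A k = (r * (K ^ (p - 2) * (2 ^ (p - 2) + of_nat (p - 2) * 2 ^ (p - 3) * (3 * K * L) + (3 * K * L) ^ 2 * q))
        + T ^ (p - 1) * K ^ (p - 2) * (9 * K ^ 2 * q)) * (L ^ (2 * p - 4) * L ^ 2)"
    proof -
      have "(t + L ^ 2 * r) * (l * k2 * (a + b * (3 * K * L) + (3 * K * L) ^ 2 * q)) -
          (k2 * a + (k2 * K) * (b * 3) * L) * (t * l) =
        (r * (k2 * (a + b * (3 * K * L) + (3 * K * L) ^ 2 * q)) + t * k2 * (9 * K ^ 2 * q)) * (l * L ^ 2)"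
        for t l k2 a b
        by (rule leading_term_difference)
      then show ?thesis unfolding eq A_def K_def[symmetric] K_pow[symmetric] .
    qed
    moreover have "L ^ (2 * p - 4) * L ^ 2 = L_coord ^ (2 * p - 2)"
    proof -
      have "2 * p - 4 + 2 = 2 * p - 2" using assms(1) by simp
      then show ?thesis by (simp only: L_def power_add[symmetric])
    qed
    ultimately show ?thesis by (simp only: L_pow_in_truncation order_refl)
  qed
  have diff: "(\<Sum>k<p. \<Psi> ((\<sigma> ^^ k) ?a)) - (\<Sum>k<p. A k) \<in> truncation (2 * p - 2)"
    unfolding sum_subtractf[symmetric] by (intro J.sum term_k)
  have sum_A: "(\<Sum>k<p. A k) = scalar c * T_coord ^ (p - 1) * L_coord ^ (2 * p - 3)"
  proof -
    have "(\<Sum>k<p. A k) = ((\<Sum>k<p. of_nat k ^ (p - 2)) * 2 ^ (p - 2) +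
        (\<Sum>k<p. of_nat k ^ (p - 1)) * (of_nat (p - 2) * 2 ^ (p - 3) * 3) * L) * (T ^ (p - 1) * L ^ (2 * p - 4))"
      by (simp only: A_def sum.distrib sum_distrib_right[symmetric])
    also have "\<dots> = - (of_nat (p - 2) * 2 ^ (p - 3) * 3) * T ^ (p - 1) * (L ^ (2 * p - 4) * L)"
      by (simp only: power_sums_at_least_p_minus_2(1)[OF assms(1)] power_sum_poly_eq_minus_1) (simp add: mult_ac)
    also have "L ^ (2 * p - 4) * L = L ^ (2 * p - 3)"
    proof -
      have "2 * p - 3 = Suc (2 * p - 4)" using assms(1) by simp
      then show ?thesis by (simp only: power_Suc2)
    qed
    also have "- (of_nat (p - 2) * 2 ^ (p - 3) * 3) = scalar c"
      by (simp only: c_def scalar.hom_uminus scalar.hom_mult scalar.hom_power scalar_of_nat scalar.hom_numeral)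
    finally show ?thesis unfolding L_def T_def .
  qed
  have "X_coord ^ (p * (p - 1)) * ((\<Sum>k<p. \<Psi> ((\<sigma> ^^ k) ?a)) -
      scalar c * T_coord ^ (p - 1) * L_coord ^ (2 * p - 3)) \<in> truncation (2 * p - 2)"
    by (rule J.mult) (rule diff[unfolded sum_A])
  moreover have "\<Psi> top_transfer - (\<Sum>k<p. \<Psi> ((\<sigma> ^^ k) ?a)) * X_coord ^ (p * (p - 1)) \<in> truncation (2 * p - 2)"
    unfolding top_transfer_def by (rule \<Psi>_tr[OF assms(1)]) simp
  ultimately have "(\<Psi> top_transfer - (\<Sum>k<p. \<Psi> ((\<sigma> ^^ k) ?a)) * X_coord ^ (p * (p - 1))) +
      X_coord ^ (p * (p - 1)) * ((\<Sum>k<p. \<Psi> ((\<sigma> ^^ k) ?a)) -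
      scalar c * T_coord ^ (p - 1) * L_coord ^ (2 * p - 3)) \<in> truncation (2 * p - 2)"
    by (intro J.add)
  moreover have "(a - b * x) + x * (b - m) = a - m * x" for a b x m :: "'f poly3"
    by (simp add: algebra_simps)
  ultimately show ?thesis by (simp only:)
qed

lemma top_transfer_indecomposable:
  assumes "p \<ge> 5"
  shows "\<exists>\<phi> T. indecomposability_witness (p ^ 2 + p - 3) \<phi> T"
proof -
  interpret \<Psi>: comm_ring_hom \<Psi> by (rule \<Psi>_hom)
  let ?\<phi> = "\<lambda>f. top_coeff (\<Psi> f)"
  let ?c = "- (of_nat (p - 2) * 2 ^ (p - 3) * 3) :: 'f"
  have "indecomposability_witness (p ^ 2 + p - 3) ?\<phi> top_transfer"
    unfolding indecomposability_witness_def
  proof (intro conjI allI impI)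
    fix f g c
    show "?\<phi> (f + g) = ?\<phi> f + ?\<phi> g" by (simp only: \<Psi>.hom_add top_coeff_add)
    show "?\<phi> (const c * f) = c * ?\<phi> f"
      by (simp only: \<Psi>.hom_mult \<Psi>_const) (simp add: top_coeff_def scalar_def)
  next
    fix i j and f g assume f: "f \<in> invariants" "is_form i f" "0 < i" and g: "g \<in> invariants" "is_form j g" "0 < j"
    have "\<Psi> f * \<Psi> g \<in> truncation ((p - 1) + (p - 1))"
      by (intro truncation_mult positive_invariant_in_truncation[OF assms f]
          positive_invariant_in_truncation[OF assms g])
    moreover have "(p - 1) + (p - 1) = 2 * p - 2" by simp
    ultimately show "?\<phi> (f * g) = 0" by (simp only: \<Psi>.hom_mult top_coeff_truncation)
  next
    show "?\<phi> top_transfer \<noteq> 0"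
    proof -
      let ?m = "scalar ?c * T_coord ^ (p - 1) * L_coord ^ (2 * p - 3) * X_coord ^ (p * (p - 1))"
      have "top_coeff (\<Psi> top_transfer) = top_coeff ((\<Psi> top_transfer - ?m) + ?m)" by simp
      also have "\<dots> = top_coeff ?m"
        using top_coeff_truncation[OF \<Psi>_top_transfer[OF assms]] by (simp only: top_coeff_add add_0)
      also have "?m = monom (monom (monom ?c (p - 1)) (2 * p - 3)) (p * (p - 1))"
        by (simp add: scalar_def monom_altdef poly_const_pow mult.assoc)
      also have "top_coeff \<dots> = ?c" by (simp only: top_coeff_def coeff_monom if_True refl)
      finally have "top_coeff (\<Psi> top_transfer) = ?c" .
      moreover have "?c \<noteq> 0"
      proof -
        have "of_nat k \<noteq> (0::'f)" if "0 < k" "k < p" for k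
          using that by (simp only: of_nat_eq_0) (auto dest: dvd_imp_le)
        from this[of "p - 2"] this[of 2] this[of 3] assms show ?thesis by simp
      qed
      ultimately show ?thesis by simp
    qed
  qed (rule top_transfer_invariant is_form_top_transfer)+
  then show ?thesis by blast
qed

lemma indecomposable_in_top_degree:
  "\<exists>\<phi> T. indecomposability_witness (p ^ 2 + p - 3) \<phi> T"
proof (cases "p = 3")
  case True
  then have "p ^ 2 + p - 3 = p ^ 2" by simp
  with norm_N_indecomposable show ?thesis by simp
next
  case False
  have "p \<noteq> 4" using prime_p by auto
  with False p_gt_2 have "p \<ge> 5" by linarith
  then show ?thesis by (rule top_transfer_indecomposable)
qed

section \<open>The Jordan block and the cyclic permutation\<close>

definition action_matrix :: "'f mat" where
  "action_matrix = mat (Suc p) (Suc p) (\<lambda>(i, j).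
     if i < p then if j = Suc i mod p then 1 else 0 else if j = p \<or> j = 0 then 1 else 0)"

lemma matrix_subst_action_matrix:
  assumes "f \<in> R" shows "matrix_subst (Suc p) action_matrix f = \<sigma> f"
proof (rule hom_eq_on_poly_ring[OF matrix_subst_hom sigma.comm_ring_hom_axioms _ _ assms])
  fix i assume i: "i < Suc p"
  show "matrix_subst (Suc p) action_matrix (var i) = \<sigma> (var i)"
  proof (cases "i < p")
    case True
    have "(\<Sum>j<Suc p. const (action_matrix $$ (i, j)) * var j) =
        (\<Sum>j<Suc p. if j = Suc i mod p then var j else 0)"
      using True by (intro sum.cong) (auto simp: action_matrix_def)
    also have "\<dots> = var (Suc i mod p)"
    proof -
      have "Suc i mod p < Suc p" using mod_less_divisor[OF p_pos, of "Suc i"] by linarith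
      then show ?thesis by (subst sum.delta) auto
    qed
    finally show ?thesis using True by (simp add: matrix_subst_def \<sigma>_def y_def)
  next
    case False
    with i have "i = p" by simp
    have "(\<Sum>j<Suc p. const (action_matrix $$ (p, j)) * var j) =
        (\<Sum>j<Suc p. if j = p \<or> j = 0 then var j else 0)"
      by (intro sum.cong) (auto simp: action_matrix_def)
    also have "\<dots> = (\<Sum>j\<in>{0, p}. var j)"
      by (rule sum.mono_neutral_cong_right) auto
    also have "\<dots> = var 0 + var p" using p_gt_1 by simp
    finally show ?thesis using \<open>i = p\<close> by (simp add: matrix_subst_def \<sigma>_def y_def z_def add.commute)
  qed
qed (simp_all add: matrix_subst_const)

text \<open>
  The coefficients of \<open>X^i = ((1 + X) - 1)^i\<close> in the expansion by powers of \<open>1 + X\<close>.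
\<close>

lemma binomial_inversion:
  assumes "i < p"
  shows "(\<Sum>k<p. of_nat (i choose k) * (-1) ^ (i - k) * of_nat (k choose l)) = (if i = l then 1 else 0 :: 'f)"
proof -
  have coeff: "coeff ([:1, 1:] ^ k :: 'f poly) l = of_nat (k choose l)" for k
  proof (cases "l \<le> k")
    case True
    then show ?thesis by (simp add: coeff_linear_poly_power)
  next
    case False
    then have "k < l" by simp
    then show ?thesis by (simp add: coeff_linear_power_above binomial_eq_0)
  qed
  have "monom 1 i = (([:1, 1:] + [:-1:]) ^ i :: 'f poly)" by (simp add: monom_altdef)
  also have "\<dots> = (\<Sum>k\<le>i. of_nat (i choose k) * [:1, 1:] ^ k * [:-1:] ^ (i - k))"
    by (rule binomial_ring)
  also have "\<dots> = (\<Sum>k\<le>i. Polynomial.smult (of_nat (i choose k) * (-1) ^ (i - k)) ([:1, 1:] ^ k))"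
    by (rule sum.cong) (simp_all add: poly_const_pow of_nat_poly mult_ac)
  finally have "coeff (monom 1 i) l = coeff (\<Sum>k\<le>i. Polynomial.smult (of_nat (i choose k) * (-1) ^ (i - k)) ([:1, 1:] ^ k) :: 'f poly) l"
    by simp
  then have "(if i = l then 1 else 0 :: 'f) = (\<Sum>k\<le>i. of_nat (i choose k) * (-1) ^ (i - k) * of_nat (k choose l))"
    by (simp add: coeff_sum coeff)
  also have "\<dots> = (\<Sum>k<p. of_nat (i choose k) * (-1) ^ (i - k) * of_nat (k choose l))"
    by (rule sum.mono_neutral_left) (use assms in \<open>auto simp: binomial_eq_0\<close>)
  finally show ?thesis by simp
qed

text \<open>
  Iterating \<open>\<sigma> - 1\<close> on \<open>z\<close> gives \<open>y 0\<close> and then its iterated differences. Conversely,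
  \<open>y k = \<sigma>^k (y 0)\<close> is the combination of these differences with binomial coefficients.
\<close>

lemma similar_jordan_block_action_matrix: "similar_mat (jordan_block (Suc p) (1::'f)) action_matrix"
proof -
  define Q :: "'f mat" where "Q = mat (Suc p) (Suc p) (\<lambda>(k, j). case j of 0 \<Rightarrow> if k = p then 1 else 0
    | Suc i \<Rightarrow> if k < p then of_nat (k choose i) else 0)"
  define P :: "'f mat" where "P = mat (Suc p) (Suc p) (\<lambda>(j, k). case j of 0 \<Rightarrow> if k = p then 1 else 0
    | Suc i \<Rightarrow> if k < p then of_nat (i choose k) * (-1) ^ (i - k) else 0)"
  let ?J = "jordan_block (Suc p) (1::'f)"
  have carr: "Q \<in> carrier_mat (Suc p) (Suc p)" "P \<in> carrier_mat (Suc p) (Suc p)"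
    "?J \<in> carrier_mat (Suc p) (Suc p)" "action_matrix \<in> carrier_mat (Suc p) (Suc p)"
    by (simp_all add: Q_def P_def action_matrix_def)
  have entry: "(A * B) $$ (i, j) = (\<Sum>k<p. A $$ (i, k) * B $$ (k, j)) + A $$ (i, p) * B $$ (p, j)"
    if "A \<in> carrier_mat (Suc p) (Suc p)" "B \<in> carrier_mat (Suc p) (Suc p)" "i < Suc p" "j < Suc p"
    for A B :: "'f mat" and i j
    using that by (simp add: scalar_prod_def atLeast0LessThan)
  have PQ: "P * Q = 1\<^sub>m (Suc p)"
  proof (rule eq_matI)
    fix i j assume "i < dim_row (1\<^sub>m (Suc p))" "j < dim_col (1\<^sub>m (Suc p))"
    then have ij: "i < Suc p" "j < Suc p" by simp_all
    show "(P * Q) $$ (i, j) = 1\<^sub>m (Suc p) $$ (i, j)"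
      unfolding entry[OF carr(2,1) ij] using ij binomial_inversion[of "i - 1" "j - 1"]
      by (cases i; cases j) (simp_all add: P_def Q_def)
  qed (use carr in auto)
  have CQ: "action_matrix * Q = Q * ?J"
  proof (rule eq_matI)
    fix k j assume "k < dim_row (Q * ?J)" "j < dim_col (Q * ?J)"
    then have kj: "k < Suc p" "j < Suc p" using carr by auto
    have "(Q * ?J) $$ (k, j) = (\<Sum>m<Suc p. Q $$ (k, m) * ?J $$ (m, j))"
      using carr kj by (simp add: scalar_prod_def atLeast0LessThan)
    also have "\<dots> = (\<Sum>m<Suc p. (if m = j then Q $$ (k, m) else 0) + (if Suc m = j then Q $$ (k, m) else 0))"
      using kj by (intro sum.cong) auto
    also have "\<dots> = Q $$ (k, j) + (case j of 0 \<Rightarrow> 0 | Suc i \<Rightarrow> Q $$ (k, i))"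
      using kj p_gt_1 unfolding sum.distrib by (cases j) auto
    finally have QJ: "(Q * ?J) $$ (k, j) = Q $$ (k, j) + (case j of 0 \<Rightarrow> 0 | Suc i \<Rightarrow> Q $$ (k, i))" .
    have AQ: "(action_matrix * Q) $$ (k, j) = (\<Sum>m<Suc p. action_matrix $$ (k, m) * Q $$ (m, j))"
      using carr kj by (simp add: scalar_prod_def atLeast0LessThan)
    show "(action_matrix * Q) $$ (k, j) = (Q * ?J) $$ (k, j)"
    proof (cases "k < p")
      case True
      define r where "r = Suc k mod p"
      have less: "r < p" by (simp add: r_def)
      have "(action_matrix * Q) $$ (k, j) = (\<Sum>m<Suc p. if m = r then Q $$ (m, j) else 0)"
        unfolding AQ using True kj by (intro sum.cong) (auto simp: action_matrix_def r_def)
      also have "\<dots> = Q $$ (r, j)"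
        using less_SucI[OF less] by (subst sum.delta) auto
      also have "\<dots> = Q $$ (k, j) + (case j of 0 \<Rightarrow> 0 | Suc i \<Rightarrow> Q $$ (k, i))"
      proof (cases j)
        case 0
        then show ?thesis using True less kj by (simp add: Q_def)
      next
        case (Suc i)
        show ?thesis
        proof (cases i)
          case 0
          then show ?thesis using True less kj Suc by (simp add: Q_def)
        next
          case (Suc h)
          have choose: "of_nat (r choose Suc h) = (of_nat (Suc k choose Suc h) :: 'f)"
          proof (cases "Suc k = p")
            case True
            have "p dvd (p choose Suc h)"
              by (rule dvd_choose_prime) (use kj \<open>j = Suc i\<close> Suc prime_p in auto)
            then have "(of_nat (p choose Suc h) :: 'f) = 0" by (simp only: of_nat_eq_0)
            with True show ?thesis by (simp add: r_def)
          next
            case False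
            with \<open>k < p\<close> show ?thesis by (simp add: r_def)
          qed
          show ?thesis
            using True less kj \<open>j = Suc i\<close> Suc choose by (simp add: Q_def add.commute)
        qed
      qed
      finally show ?thesis by (simp only: QJ)
    next
      case False
      with kj have "k = p" by simp
      have "(action_matrix * Q) $$ (k, j) = (\<Sum>m<Suc p. if m = p \<or> m = 0 then Q $$ (m, j) else 0)"
        unfolding AQ using \<open>k = p\<close> kj by (intro sum.cong) (auto simp: action_matrix_def)
      also have "\<dots> = (\<Sum>m\<in>{0, p}. Q $$ (m, j))"
        by (rule sum.mono_neutral_cong_right) auto
      also have "\<dots> = Q $$ (0, j) + Q $$ (p, j)" using p_gt_1 by simp
      finally show ?thesis
        unfolding QJ using \<open>k = p\<close> kj p_gt_1 by (cases j) (auto simp: Q_def split: nat.splits)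
    qed
  qed (use carr in auto)
  have "P * action_matrix * Q = P * (Q * ?J)" using carr CQ by (simp add: assoc_mult_mat[of _ "Suc p" "Suc p"])
  also have "\<dots> = ?J"
    using carr PQ assoc_mult_mat[of P "Suc p" "Suc p" Q "Suc p" ?J "Suc p"] by (metis left_mult_one_mat)
  finally have "?J = P * action_matrix * Q" ..
  moreover have "Q * P = 1\<^sub>m (Suc p)" by (rule mat_mult_left_right_inverse[OF carr(2,1) PQ])
  ultimately show ?thesis using carr PQ by (intro similar_matI[of _ _ P Q "Suc p"]) auto
qed

text \<open>
  A change of coordinates is an isomorphism of graded algebras, along which the generators, the functional and
  its witness are carried over.
\<close>

lemma noether_number_of_similar_action:
  assumes "similar_mat A action_matrix" and A: "A \<in> carrier_mat (Suc p) (Suc p)"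
  shows "is_noether_number {f \<in> R. matrix_subst (Suc p) A f = f} (p ^ 2 + p - 3)"
proof -
  let ?n = "Suc p"
  let ?A = "{f \<in> R. matrix_subst ?n A f = f}"
  obtain P Q where "similar_mat_wit A action_matrix P Q" using assms(1) by (auto simp: similar_mat_def)
  then have carr: "P \<in> carrier_mat ?n ?n" "Q \<in> carrier_mat ?n ?n" "action_matrix \<in> carrier_mat ?n ?n"
    and PQ: "P * Q = 1\<^sub>m ?n" "Q * P = 1\<^sub>m ?n" and A_eq: "A = P * action_matrix * Q"
    using A by (auto simp: similar_mat_wit_def Let_def)
  have QP_id: "matrix_subst ?n Q (matrix_subst ?n P f) = f"
    and PQ_id: "matrix_subst ?n P (matrix_subst ?n Q f) = f" if "f \<in> R" for f
    using that carr by (simp_all add: matrix_subst_mult PQ matrix_subst_one)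
  have A_subst: "matrix_subst ?n A f = matrix_subst ?n Q (\<sigma> (matrix_subst ?n P f))" if "f \<in> R" for f
  proof -
    have "matrix_subst ?n A f = matrix_subst ?n Q (matrix_subst ?n (P * action_matrix) f)"
      unfolding A_eq using carr that by (intro matrix_subst_mult[symmetric]) auto
    also have "matrix_subst ?n (P * action_matrix) f = matrix_subst ?n action_matrix (matrix_subst ?n P f)"
      using carr that by (intro matrix_subst_mult[symmetric]) auto
    also have "\<dots> = \<sigma> (matrix_subst ?n P f)" by (rule matrix_subst_action_matrix[OF matrix_subst_in[OF that]])
    finally show ?thesis .
  qed
  have P_inv: "matrix_subst ?n P f \<in> invariants" if "f \<in> ?A" for f
  proof -
    have f: "f \<in> R" "matrix_subst ?n Q (\<sigma> (matrix_subst ?n P f)) = f" using that A_subst by auto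
    have "\<sigma> (matrix_subst ?n P f) = matrix_subst ?n P (matrix_subst ?n Q (\<sigma> (matrix_subst ?n P f)))"
      using f(1) by (intro PQ_id[symmetric] sigma_in_R matrix_subst_in)
    then show ?thesis using f by (simp add: invariants_def matrix_subst_in)
  qed
  have Q_inv: "matrix_subst ?n Q h \<in> ?A" if "h \<in> invariants" for h
    using that PQ_id[of h] A_subst[of "matrix_subst ?n Q h"] by (auto simp: invariants_def matrix_subst_in)
  have "?A = matrix_subst ?n Q ` invariants"
  proof (intro equalityI subsetI)
    fix f assume "f \<in> ?A"
    then show "f \<in> matrix_subst ?n Q ` invariants"
      using P_inv QP_id by (intro image_eqI[of _ _ "matrix_subst ?n P f"]) auto
  qed (use Q_inv in auto)
  then have gen: "?A = alg_generated (matrix_subst ?n Q ` generators)"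
    by (simp only: alg_generated_image[OF matrix_subst_hom matrix_subst_const] invariants_eq_alg_generated)
  interpret P: comm_ring_hom "matrix_subst ?n P" by (rule matrix_subst_hom)
  obtain \<phi> T where "indecomposability_witness (p ^ 2 + p - 3) \<phi> T"
    using indecomposable_in_top_degree by blast
  then have \<phi>_add: "\<And>f g. \<phi> (f + g) = \<phi> f + \<phi> g" and \<phi>_scale: "\<And>c f. \<phi> (const c * f) = c * \<phi> f"
    and \<phi>_mult: "\<And>i j f g. f \<in> invariants \<Longrightarrow> g \<in> invariants \<Longrightarrow> is_form i f \<Longrightarrow> is_form j g \<Longrightarrow>
        0 < i \<Longrightarrow> 0 < j \<Longrightarrow> \<phi> (f * g) = 0"
    and T: "T \<in> invariants" "is_form (p ^ 2 + p - 3) T" "\<phi> T \<noteq> 0"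
    unfolding indecomposability_witness_def by blast+
  show ?thesis
  proof (rule is_noether_numberI[where \<phi> = "\<lambda>f. \<phi> (matrix_subst ?n P f)" and T = "matrix_subst ?n Q T", OF _ _ gen])
    show "finite (matrix_subst ?n Q ` generators)" by (rule finite_imageI[OF finite_generators])
    show "\<exists>k\<le>p ^ 2 + p - 3. is_form k b" if "b \<in> matrix_subst ?n Q ` generators" for b
      using that generators_degree is_form_matrix_subst by blast
    show "0 < p ^ 2 + p - 3" using degree_bound(2) p_pos by (metis gr0I le_zero_eq less_irrefl power_not_zero)
    show "\<phi> (matrix_subst ?n P (matrix_subst ?n Q T)) \<noteq> 0"
      using T PQ_id[of T] by (simp add: invariants_def)
    show "is_form (p ^ 2 + p - 3) (matrix_subst ?n Q T)" by (rule is_form_matrix_subst[OF T(2)])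
    show "matrix_subst ?n Q T \<in> ?A" by (rule Q_inv[OF T(1)])
    fix f g i j
    show "\<phi> (matrix_subst ?n P (f + g)) = \<phi> (matrix_subst ?n P f) + \<phi> (matrix_subst ?n P g)"
      by (simp only: P.hom_add \<phi>_add)
    show "\<phi> (matrix_subst ?n P (const c * f)) = c * \<phi> (matrix_subst ?n P f)" for c
      by (simp only: P.hom_mult matrix_subst_const \<phi>_scale)
    show "\<phi> (matrix_subst ?n P (f * g)) = 0"
      if "f \<in> ?A" "g \<in> ?A" "is_form i f" "is_form j g" "0 < i" "0 < j"
      using that P_inv is_form_matrix_subst by (simp only: P.hom_mult) (rule \<phi>_mult, blast+)
  qed
qed

end

theorem theorem4p1:
  fixes p :: nat
    and G :: "('g, 'm) monoid_scheme"
    and \<rho> :: "'g \<Rightarrow> 'f::field mat"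
  assumes "prime p" and "p > 2"
    and "CHAR('f) = p"
    and "group G" and "G \<cong> integer_mod_group (p ^ 2)"
    and "single_jordan_block_module G (p + 1) \<rho>"
  shows "is_noether_number (invariant_ring G (p + 1) \<rho>) (p ^ 2 + p - 3)"
proof -
  interpret normal_form p "TYPE('f)" by (rule normal_form.intro[OF assms(1-3)])
  obtain g where rep: "representation G (Suc p) \<rho>" and g: "g \<in> carrier G" "generate G {g} = carrier G"
    and "similar_mat (\<rho> g) (jordan_block (Suc p) 1)"
    using assms(6) by (auto simp: single_jordan_block_module_def)
  then have similar: "similar_mat (\<rho> g) action_matrix"
    using similar_mat_trans similar_jordan_block_action_matrix by blast
  have "\<rho> g \<in> carrier_mat (Suc p) (Suc p)"
    using rep hom_carrier g(1) by (fastforce simp: representation_def units_of_carrier Units_def ring_mat_simps)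
  from noether_number_of_similar_action[OF similar this] show ?thesis
    by (simp add: invariant_ring_cyclic[OF assms(4) rep g])
qed

end
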